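(* Let $\Theta$ be an inner function. (1) Let $A\in\mathcal{T}(\Theta)$ and let $\mu\in\mathcal{C}_2(\Theta)$ be a complex measure such that $A=A^\Theta_\mu$. If $A$ is bounded below, then $\iota_\mu$ is also bounded below, i.e. there exists $C>0$ (depending only on $\mu$ and $\Theta$) such that $$\int_{\mathbb{T}}|f|^2\,dm\le C\int_{\mathbb{T}}|\iota_\mu(f)|^2\,d|\mu|\quad\text{for all } f\in K_\Theta.$$ (2) Let $A\in\mathcal{T}(\Theta)^+$ and let $\mu\in\mathcal{C}_2^+(\Theta)$ be such that $A=A^\Theta_\mu$. The following assertions are equivalent: (a) the operator $A$ is invertible; (b) there exists $C>0$ (depending only on $\mu$ and $\Theta$) such that $$\int_{\mathbb{T}}|f|^2\,dm\le C\int_{\mathbb{T}}|\iota_\mu(f)|^2\,d\mu\quad\text{for all } f\in K_\Theta.$$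
   Context: $\mathbb{D}$ is the open unit disc and $\mathbb{T}$ the unit circle with normalized Lebesgue measure $m$. $H^p$ is the Hardy space of $\mathbb{D}$, identified through boundary values with a subspace of $L^p=L^p(\mathbb{T},m)$. An inner function is $\Theta\in H^\infty$ with $|\Theta|=1$ $m$-a.e. on $\mathbb{T}$. The model space is $K_\Theta=H^2\ominus\Theta H^2$; $P_\Theta$ is the orthogonal projection of $L^2$ onto $K_\Theta$. For $\phi\in L^2$, $A^\Theta_\phi$ is the operator with domain $K_\Theta\cap H^\infty$ (dense in $K_\Theta$) given by $A^\Theta_\phi f=P_\Theta(\phi f)$. If it extends to a bounded operator on $K_\Theta$, the extension is called a truncated Toeplitz operator (TTO); $\mathcal{T}(\Theta)$ is the set of all TTOs on $K_\Theta$ and $\mathcal{T}(\Theta)^+$ the set of those that are nonnegative operators. $\mathcal{C}_2(\Theta)$ is the set of finite complex Borel measures $\mu$ on $\mathbb{T}$ such that the embedding $K_\Theta\hookrightarrow L^2(|\mu|)$ is bounded, meaning: there is $C>0$ with $\|f\|_{L^2(|\mu|)}\le C\|f\|_2$ for all $f\in K_\Theta$ that extend continuously to $\overline{\mathbb{D}}$. Such $f$ are dense in $K_\Theta$, and $\iota_\mu:K_\Theta\to L^2(|\mu|)$ denotes the resulting bounded extension of $f\mapsto f|_{\mathbb{T}}$. $\mathcal{C}^+_2(\Theta)$ is the set of positive measures in $\mathcal{C}_2(\Theta)$. For $\mu\in\mathcal{C}_2(\Theta)$, $A^\Theta_\mu$ is the bounded operator on $K_\Theta$ defined by $\langle A^\Theta_\mu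 f,g\rangle=\int_{\mathbb{T}}\iota_\mu(f)\,\overline{\iota_\mu(g)}\,d\mu$ for $f,g\in K_\Theta$. A bounded operator $T$ on a Hilbert space is bounded below if there is $c>0$ with $\|Tf\|\ge c\|f\|$ for all $f$. *)

theory Defs
  imports "HOL-Analysis.Analysis"
begin

section \<open>The unit circle and square-integrable functions\<close>

abbreviation unit_disc :: "complex set" where
  "unit_disc \<equiv> ball 0 1"

abbreviation unit_circle :: "complex set" where
  "unit_circle \<equiv> sphere 0 1"

definition circle_borel :: "complex measure" where
  "circle_borel = restrict_space borel unit_circle"

definition circle_measure :: "complex measure" where
  "circle_measure = distr (uniform_measure lborel {0..<2 * pi}) circle_borel cis"

text \<open>
  Elements of \<open>L\<^sup>2(\<nu>)\<close> are represented by functions, identified when they agree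
  \<open>\<nu>\<close>-almost everywhere. Accordingly, all equations between elements of an \<open>L\<^sup>2\<close> space
  below are equations almost everywhere, and the function spaces below are closed
  under changing a function on a null set.
\<close>

definition L2_fun :: "complex measure \<Rightarrow> (complex \<Rightarrow> complex) set" where
  "L2_fun \<nu> = {f \<in> borel_measurable \<nu>. integrable \<nu> (\<lambda>z. (cmod (f z))\<^sup>2)}"

definition L2_inner :: "complex measure \<Rightarrow> (complex \<Rightarrow> complex) \<Rightarrow> (complex \<Rightarrow> complex) \<Rightarrow> complex" where
  "L2_inner \<nu> f g = (\<integral>z. f z * cnj (g z) \<partial>\<nu>)"

definition L2_norm :: "complex measure \<Rightarrow> (complex \<Rightarrow> complex) \<Rightarrow> real" where
  "L2_norm \<nu> f = sqrt (\<integral>z. (cmod (f z))\<^sup>2 \<partial>\<nu>)"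

definition eq_ae :: "complex measure \<Rightarrow> (complex \<Rightarrow> complex) \<Rightarrow> (complex \<Rightarrow> complex) \<Rightarrow> bool" where
  "eq_ae \<nu> f g \<longleftrightarrow> (AE z in \<nu>. f z = g z)"

text \<open>
  Bounded linear maps from a subspace \<open>V\<close> of \<open>L\<^sup>2(\<nu>)\<close> to a subspace \<open>W\<close> of \<open>L\<^sup>2(\<nu>')\<close>.
  Linearity and boundedness together force \<open>T f\<close> and \<open>T g\<close> to agree \<open>\<nu>'\<close>-a.e. whenever
  \<open>f\<close> and \<open>g\<close> agree \<open>\<nu>\<close>-a.e., so \<open>T\<close> is well defined on equivalence classes.
\<close>

definition L2_bounded_linear ::
  "complex measure \<Rightarrow> (complex \<Rightarrow> complex) set \<Rightarrow> complex measure \<Rightarrow> (complex \<Rightarrow> complex) set \<Rightarrow>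
    ((complex \<Rightarrow> complex) \<Rightarrow> (complex \<Rightarrow> complex)) \<Rightarrow> bool" where
  "L2_bounded_linear \<nu> V \<nu>' W T \<longleftrightarrow>
     (\<forall>f\<in>V. T f \<in> W) \<and>
     (\<forall>f\<in>V. \<forall>g\<in>V. eq_ae \<nu>' (T (\<lambda>z. f z + g z)) (\<lambda>z. T f z + T g z)) \<and>
     (\<forall>c. \<forall>f\<in>V. eq_ae \<nu>' (T (\<lambda>z. c * f z)) (\<lambda>z. c * T f z)) \<and>
     (\<exists>C. \<forall>f\<in>V. L2_norm \<nu>' (T f) \<le> C * L2_norm \<nu> f)"

section \<open>Hardy spaces, inner functions, model spaces\<close>

definition hardy2_disc :: "(complex \<Rightarrow> complex) set" where
  "hardy2_disc = {F. F holomorphic_on unit_disc \<and>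
     (\<exists>B. \<forall>r\<in>{0..<1}. (\<integral>z. (cmod (F (of_real r * z)))\<^sup>2 \<partial>circle_measure) \<le> B)}"

definition hardy_inf_disc :: "(complex \<Rightarrow> complex) set" where
  "hardy_inf_disc = {F. F holomorphic_on unit_disc \<and> bounded (F ` unit_disc)}"

definition radial_boundary_function :: "(complex \<Rightarrow> complex) \<Rightarrow> (complex \<Rightarrow> complex) \<Rightarrow> bool" where
  "radial_boundary_function F f \<longleftrightarrow>
     (AE z in circle_measure. ((\<lambda>r. F (of_real r * z)) \<longlongrightarrow> f z) (at_left (1::real)))"

definition H2 :: "(complex \<Rightarrow> complex) set" where
  "H2 = {f \<in> L2_fun circle_measure. \<exists>F\<in>hardy2_disc. radial_boundary_function F f}"

definition Hinf :: "(complex \<Rightarrow> complex) set" where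
  "Hinf = {f \<in> borel_measurable circle_measure. \<exists>F\<in>hardy_inf_disc. radial_boundary_function F f}"

definition inner_function :: "(complex \<Rightarrow> complex) \<Rightarrow> bool" where
  "inner_function \<Theta> \<longleftrightarrow> \<Theta> \<in> Hinf \<and> (AE z in circle_measure. cmod (\<Theta> z) = 1)"

definition model_space :: "(complex \<Rightarrow> complex) \<Rightarrow> (complex \<Rightarrow> complex) set" where
  "model_space \<Theta> = {f \<in> H2. \<forall>g\<in>H2. L2_inner circle_measure f (\<lambda>z. \<Theta> z * g z) = 0}"

definition model_proj :: "(complex \<Rightarrow> complex) \<Rightarrow> (complex \<Rightarrow> complex) \<Rightarrow> (complex \<Rightarrow> complex)" where
  "model_proj \<Theta> f = (SOME p. p \<in> model_space \<Theta> \<and>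
     (\<forall>g\<in>model_space \<Theta>. L2_inner circle_measure (\<lambda>z. f z - p z) g = 0))"

section \<open>Truncated Toeplitz operators\<close>

definition model_operator ::
  "(complex \<Rightarrow> complex) \<Rightarrow> ((complex \<Rightarrow> complex) \<Rightarrow> (complex \<Rightarrow> complex)) \<Rightarrow> bool" where
  "model_operator \<Theta> A \<longleftrightarrow>
     L2_bounded_linear circle_measure (model_space \<Theta>) circle_measure (model_space \<Theta>) A"

definition TTO :: "(complex \<Rightarrow> complex) \<Rightarrow> ((complex \<Rightarrow> complex) \<Rightarrow> (complex \<Rightarrow> complex)) set" where
  "TTO \<Theta> = {A. model_operator \<Theta> A \<and>
     (\<exists>\<phi>\<in>L2_fun circle_measure. \<forall>f\<in>model_space \<Theta> \<inter> Hinf.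
        eq_ae circle_measure (A f) (model_proj \<Theta> (\<lambda>z. \<phi> z * f z)))}"

definition TTO_nonneg :: "(complex \<Rightarrow> complex) \<Rightarrow> ((complex \<Rightarrow> complex) \<Rightarrow> (complex \<Rightarrow> complex)) set" where
  "TTO_nonneg \<Theta> = {A \<in> TTO \<Theta>. \<forall>f\<in>model_space \<Theta>. L2_inner circle_measure (A f) f \<in> \<real>\<^sub>\<ge>\<^sub>0}"

definition model_bounded_below ::
  "(complex \<Rightarrow> complex) \<Rightarrow> ((complex \<Rightarrow> complex) \<Rightarrow> (complex \<Rightarrow> complex)) \<Rightarrow> bool" where
  "model_bounded_below \<Theta> A \<longleftrightarrow>
     (\<exists>c>0. \<forall>f\<in>model_space \<Theta>. L2_norm circle_measure (A f) \<ge> c * L2_norm circle_measure f)"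

definition model_invertible ::
  "(complex \<Rightarrow> complex) \<Rightarrow> ((complex \<Rightarrow> complex) \<Rightarrow> (complex \<Rightarrow> complex)) \<Rightarrow> bool" where
  "model_invertible \<Theta> A \<longleftrightarrow>
     (\<exists>B. model_operator \<Theta> B \<and>
        (\<forall>f\<in>model_space \<Theta>. eq_ae circle_measure (A (B f)) f \<and> eq_ae circle_measure (B (A f)) f))"

section \<open>Complex measures on the circle\<close>

text \<open>
  A finite complex Borel measure on the circle is a countably additive complex-valued
  function of Borel subsets of the circle; its values on other sets are irrelevant.
\<close>

definition complex_measure :: "(complex set \<Rightarrow> complex) \<Rightarrow> bool" where
  "complex_measure \<mu> \<longleftrightarrow>
     (\<forall>A :: nat \<Rightarrow> complex set. range A \<subseteq> sets circle_borel \<longrightarrow> disjoint_family A \<longrightarrow>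
        (\<lambda>n. \<mu> (A n)) sums \<mu> (\<Union>n. A n))"

definition variation :: "(complex set \<Rightarrow> complex) \<Rightarrow> complex measure" where
  "variation \<mu> = measure_of unit_circle (sets circle_borel)
     (\<lambda>E. SUP P\<in>{P. finite P \<and> P \<subseteq> sets circle_borel \<and> partition_on E P}.
        \<Sum>X\<in>P. ennreal (cmod (\<mu> X)))"

text \<open>
  Integration against \<open>\<mu>\<close> is defined through the polar decomposition \<open>d\<mu> = h d|\<mu>|\<close>
  with \<open>|h| = 1\<close>; \<open>h\<close> is unique up to \<open>|\<mu>|\<close>-null sets.
\<close>

definition polar_density :: "(complex set \<Rightarrow> complex) \<Rightarrow> complex \<Rightarrow> complex" where
  "polar_density \<mu> = (SOME h. h \<in> borel_measurable (variation \<mu>) \<and> (\<forall>z. cmod (h z) = 1) \<and>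
     (\<forall>E\<in>sets circle_borel. \<mu> E = (LINT z:E|variation \<mu>. h z)))"

definition complex_integral :: "(complex set \<Rightarrow> complex) \<Rightarrow> (complex \<Rightarrow> complex) \<Rightarrow> complex" where
  "complex_integral \<mu> f = (\<integral>z. f z * polar_density \<mu> z \<partial>variation \<mu>)"

section \<open>Carleson-type measures and the embedding operator\<close>

text \<open>
  \<open>F\<close> is the continuous extension to the closed disc of the element of \<open>H\<^sup>2\<close>
  represented by \<open>f\<close>. The representative \<open>f\<close> need not coincide with \<open>F\<close> on a given
  null set, which may well be charged by \<open>\<mu>\<close>: the function to be integrated against
  \<open>|\<mu>|\<close> is \<open>F\<close>.
\<close>

definition continuous_extension :: "(complex \<Rightarrow> complex) \<Rightarrow> (complex \<Rightarrow> complex) \<Rightarrow> bool" where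
  "continuous_extension f F \<longleftrightarrow>
     continuous_on (cball 0 1) F \<and> F holomorphic_on unit_disc \<and> eq_ae circle_measure F f"

definition C2 :: "(complex \<Rightarrow> complex) \<Rightarrow> (complex set \<Rightarrow> complex) set" where
  "C2 \<Theta> = {\<mu>. complex_measure \<mu> \<and>
     (\<exists>C>0. \<forall>f\<in>model_space \<Theta>. \<forall>F. continuous_extension f F \<longrightarrow>
        L2_norm (variation \<mu>) F \<le> C * L2_norm circle_measure f)}"

definition C2_pos :: "(complex \<Rightarrow> complex) \<Rightarrow> (complex set \<Rightarrow> complex) set" where
  "C2_pos \<Theta> = {\<mu> \<in> C2 \<Theta>. \<forall>E\<in>sets circle_borel. \<mu> E \<in> \<real>\<^sub>\<ge>\<^sub>0}"

text \<open>
  The bounded extension is determined up to \<open>|\<mu>|\<close>-null sets, because the functions in the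
  model space that extend continuously to the closed disc are dense in it.
\<close>

definition iota ::
  "(complex \<Rightarrow> complex) \<Rightarrow> (complex set \<Rightarrow> complex) \<Rightarrow> (complex \<Rightarrow> complex) \<Rightarrow> (complex \<Rightarrow> complex)" where
  "iota \<Theta> \<mu> = (SOME J.
     L2_bounded_linear circle_measure (model_space \<Theta>) (variation \<mu>) (L2_fun (variation \<mu>)) J \<and>
     (\<forall>f\<in>model_space \<Theta>. \<forall>F. continuous_extension f F \<longrightarrow> eq_ae (variation \<mu>) (J f) F))"

text \<open>\<open>is_measure_operator \<Theta> \<mu> A\<close> says that \<open>A\<close> is the operator \<open>A\<^sup>\<Theta>\<^sub>\<mu>\<close>, which is unique a.e.\<close>

definition is_measure_operator ::
  "(complex \<Rightarrow> complex) \<Rightarrow> (complex set \<Rightarrow> complex) \<Rightarrow> ((complex \<Rightarrow> complex) \<Rightarrow> (complex \<Rightarrow> complex)) \<Rightarrow> bool" where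
  "is_measure_operator \<Theta> \<mu> A \<longleftrightarrow> model_operator \<Theta> A \<and>
     (\<forall>f\<in>model_space \<Theta>. \<forall>g\<in>model_space \<Theta>.
        L2_inner circle_measure (A f) g =
          complex_integral \<mu> (\<lambda>z. iota \<Theta> \<mu> f z * cnj (iota \<Theta> \<mu> g z)))"

end

theory Submission
  imports Defs "HOL-Complex_Analysis.Cauchy_Integral_Formula"
begin

text \<open>
  Part (1): \<open>\<parallel>A f\<parallel>\<^sup>2 = \<langle>A f, A f\<rangle>\<close> is the integral of \<open>\<iota> f \<cdot> cnj (\<iota> (A f))\<close> against \<open>\<mu>\<close>, hence at most
  \<open>\<parallel>\<iota> f\<parallel> \<parallel>\<iota>\<parallel> \<parallel>A f\<parallel>\<close>. Part (2): for nonnegative \<open>A\<close> the Cauchy--Schwarz inequality for the form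
  \<open>\<langle>A f, g\<rangle>\<close> gives \<open>\<parallel>A f\<parallel>\<^sup>2 \<le> \<parallel>A\<parallel> \<langle>A f, f\<rangle>\<close>, so invertibility makes the form coercive; conversely, an
  operator with coercive form on a complete space is invertible.

  The substance is in the existence of \<open>\<iota>\<close> and in the completeness of the model space. For the
  former it suffices to extend from the functions with continuous extension to their closure and to
  compose with the orthogonal projection onto it, so their density is not needed. The
  latter amounts to Fatou's theorem for \<open>H\<^sup>2\<close>: the limit of boundary functions is again the radial
  limit of a holomorphic function, by the weak type estimate for the radial maximal function.
\<close>

section \<open>The space \<open>L\<^sup>2\<close> of a measure\<close>

text \<open>\<open>iota\<close> and \<open>polar_density\<close> are values of \<open>SOME\<close>,
  so nothing is known about them until a witness is exhibited. Hence the total variation must be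
  shown finite and the polar decomposition proved in full: only a density of modulus 1 turns a bound
  for an integral against \<mu> into one for an integral against its variation. Functions stand for
  their a.e. classes, so operators are linear only up to null sets, and the extension is built as a
  relation from which values are selected afterwards.

  Membership in \<open>H2\<close> concerns radial limits at almost every boundary point, and
  convergence in norm does not obviously respect these. It gives locally uniform convergence of
  Poisson integrals, but with constants that blow up at the circle. The maximal function supplies a
  bound uniform in the radius, outside sets of small measure, and the Borel-Cantelli lemma disposes
  of those sets along a fast subsequence.

  In (2), the integral of the squared modulus of \<open>iota \<Theta> \<mu> f\<close> against \<mu>
  is the form <A f, f> itself, so (b) is literally coercivity.\<close>

lemma L2_funD:
  assumes "f \<in> L2_fun \<nu>"
  shows "f \<in> borel_measurable \<nu>" "integrable \<nu> (\<lambda>z. (cmod (f z))\<^sup>2)"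
  using assms by (auto simp: L2_fun_def)

lemma L2_fun_mult_integrable:
  assumes "f \<in> L2_fun \<nu>" "g \<in> L2_fun \<nu>"
  shows "integrable \<nu> (\<lambda>z. cmod (f z) * cmod (g z))"
proof (rule Bochner_Integration.integrable_bound)
  show "integrable \<nu> (\<lambda>z. (cmod (f z))\<^sup>2 + (cmod (g z))\<^sup>2)"
    using assms by (intro Bochner_Integration.integrable_add L2_funD)
  show "(\<lambda>z. cmod (f z) * cmod (g z)) \<in> borel_measurable \<nu>"
    using assms[THEN L2_funD(1)] by measurable
  have "a * b \<le> a\<^sup>2 + b\<^sup>2" if "a \<ge> 0" "b \<ge> 0" for a b :: real
    using sum_squares_bound[of a b] mult_nonneg_nonneg[OF that] by linarith
  then show "AE z in \<nu>. norm (cmod (f z) * cmod (g z)) \<le> norm ((cmod (f z))\<^sup>2 + (cmod (g z))\<^sup>2)"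
    by simp
qed

lemma L2_fun_inner_integrable:
  assumes "f \<in> L2_fun \<nu>" "g \<in> L2_fun \<nu>"
  shows "integrable \<nu> (\<lambda>z. f z * cnj (g z))"
proof (rule Bochner_Integration.integrable_bound[OF L2_fun_mult_integrable[OF assms]])
  show "(\<lambda>z. f z * cnj (g z)) \<in> borel_measurable \<nu>"
    using assms[THEN L2_funD(1)] by (intro borel_measurable_times measurable_compose[of g \<nu> borel cnj borel])
      (auto intro!: borel_measurable_continuous_onI continuous_intros)
qed (simp add: norm_mult)

lemma L2_fun_add:
  assumes "f \<in> L2_fun \<nu>" "g \<in> L2_fun \<nu>"
  shows "(\<lambda>z. f z + g z) \<in> L2_fun \<nu>"
proof -
  have m: "(\<lambda>z. f z + g z) \<in> borel_measurable \<nu>" using assms[THEN L2_funD(1)] by measurable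
  have "integrable \<nu> (\<lambda>z. (cmod (f z + g z))\<^sup>2)"
  proof (rule Bochner_Integration.integrable_bound)
    show "integrable \<nu> (\<lambda>z. 2 * (cmod (f z))\<^sup>2 + 2 * (cmod (g z))\<^sup>2)"
      using assms by (intro Bochner_Integration.integrable_add integrable_mult_right L2_funD)
    show "(\<lambda>z. (cmod (f z + g z))\<^sup>2) \<in> borel_measurable \<nu>" using m by measurable
    have "(cmod (a + b))\<^sup>2 \<le> 2 * (cmod a)\<^sup>2 + 2 * (cmod b)\<^sup>2" for a b
    proof -
      have "(cmod (a + b))\<^sup>2 \<le> (cmod a + cmod b)\<^sup>2" by (intro power_mono norm_triangle_ineq) auto
      also have "\<dots> \<le> 2 * (cmod a)\<^sup>2 + 2 * (cmod b)\<^sup>2"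
        using sum_squares_bound[of "cmod a" "cmod b"] by (simp add: power2_sum)
      finally show ?thesis .
    qed
    then show "AE z in \<nu>. norm ((cmod (f z + g z))\<^sup>2) \<le> norm (2 * (cmod (f z))\<^sup>2 + 2 * (cmod (g z))\<^sup>2)"
      by simp
  qed
  with m show ?thesis by (simp add: L2_fun_def)
qed

lemma L2_fun_scale:
  assumes "f \<in> L2_fun \<nu>"
  shows "(\<lambda>z. c * f z) \<in> L2_fun \<nu>"
  using assms L2_funD[OF assms] by (auto simp: L2_fun_def norm_mult power_mult_distrib)

lemma L2_fun_diff:
  assumes "f \<in> L2_fun \<nu>" "g \<in> L2_fun \<nu>"
  shows "(\<lambda>z. f z - g z) \<in> L2_fun \<nu>"
  using L2_fun_add[OF assms(1) L2_fun_scale[OF assms(2), of "-1"]] by simp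

lemma L2_fun_zero: "(\<lambda>z. 0) \<in> L2_fun \<nu>"
  by (simp add: L2_fun_def)

lemma L2_norm_nonneg [simp]: "L2_norm \<nu> f \<ge> 0"
  by (simp add: L2_norm_def)

lemma L2_norm_sq: "(L2_norm \<nu> f)\<^sup>2 = (\<integral>z. (cmod (f z))\<^sup>2 \<partial>\<nu>)"
  by (simp add: L2_norm_def)

lemma L2_inner_self: "L2_inner \<nu> f f = of_real ((L2_norm \<nu> f)\<^sup>2)"
  unfolding L2_norm_sq L2_inner_def by (simp flip: complex_norm_square of_real_power)

lemma L2_norm_cong:
  assumes "eq_ae \<nu> f g" "f \<in> borel_measurable \<nu>" "g \<in> borel_measurable \<nu>"
  shows "L2_norm \<nu> f = L2_norm \<nu> g"
proof -
  have "(\<integral>z. (cmod (f z))\<^sup>2 \<partial>\<nu>) = (\<integral>z. (cmod (g z))\<^sup>2 \<partial>\<nu>)"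
    using assms by (intro integral_cong_AE) (auto simp: eq_ae_def)
  then show ?thesis by (simp add: L2_norm_def)
qed

lemma L2_norm_eq_0_iff:
  assumes "f \<in> L2_fun \<nu>"
  shows "L2_norm \<nu> f = 0 \<longleftrightarrow> (AE z in \<nu>. f z = 0)"
  using integral_nonneg_eq_0_iff_AE[OF L2_funD(2)[OF assms]] by (simp add: L2_norm_def)

lemma L2_norm_diff_eq_0:
  assumes "f \<in> L2_fun \<nu>" "g \<in> L2_fun \<nu>" "L2_norm \<nu> (\<lambda>z. f z - g z) = 0"
  shows "eq_ae \<nu> f g"
  using L2_norm_eq_0_iff[OF L2_fun_diff[OF assms(1,2)]] assms(3) by (simp add: eq_ae_def)

lemma L2_norm_scale: "L2_norm \<nu> (\<lambda>z. c * f z) = cmod c * L2_norm \<nu> f"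
  by (simp add: L2_norm_def norm_mult power_mult_distrib real_sqrt_mult)

lemma L2_norm_minus_commute: "L2_norm \<nu> (\<lambda>z. f z - g z) = L2_norm \<nu> (\<lambda>z. g z - f z)"
  by (simp add: L2_norm_def norm_minus_commute)

text \<open>Weighted arithmetic-geometric mean inequality, integrated. Stated with absolute values
  inside the integral because the integrals against a complex measure and the triangle inequality
  both need that stronger form.\<close>

lemma L2_Cauchy_Schwarz_abs:
  assumes "f \<in> L2_fun \<nu>" "g \<in> L2_fun \<nu>"
  shows "(\<integral>z. cmod (f z) * cmod (g z) \<partial>\<nu>) \<le> L2_norm \<nu> f * L2_norm \<nu> g"
proof (cases "L2_norm \<nu> f = 0 \<or> L2_norm \<nu> g = 0")
  case True
  then have "AE z in \<nu>. cmod (f z) * cmod (g z) = 0"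
    using L2_norm_eq_0_iff[OF assms(1)] L2_norm_eq_0_iff[OF assms(2)] by auto
  then have "(\<integral>z. cmod (f z) * cmod (g z) \<partial>\<nu>) = 0"
    by (rule integral_eq_zero_AE)
  then show ?thesis by simp
next
  case False
  define a b where "a = L2_norm \<nu> f" and "b = L2_norm \<nu> g"
  have ab: "a > 0" "b > 0" using False by (auto simp: a_def b_def less_le)
  \<comment> \<open>The weights are chosen so that, with a and b the two norms, each summand
    integrates to a * b / 2.\<close>
  have pt: "x * y \<le> b / (2 * a) * x\<^sup>2 + a / (2 * b) * y\<^sup>2" for x y :: real
  proof -
    have "2 * (b * x) * (a * y) \<le> (b * x)\<^sup>2 + (a * y)\<^sup>2" by (rule sum_squares_bound)
    then show ?thesis using ab by (simp add: field_simps power2_eq_square)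
  qed
  have "(\<integral>z. cmod (f z) * cmod (g z) \<partial>\<nu>)
      \<le> (\<integral>z. b / (2 * a) * (cmod (f z))\<^sup>2 + a / (2 * b) * (cmod (g z))\<^sup>2 \<partial>\<nu>)"
    using assms by (intro integral_mono pt L2_fun_mult_integrable Bochner_Integration.integrable_add
        integrable_mult_right L2_funD)
  also have "\<dots> = b / (2 * a) * a\<^sup>2 + a / (2 * b) * b\<^sup>2"
    unfolding a_def b_def L2_norm_sq using assms
    by (subst Bochner_Integration.integral_add) (auto intro!: integrable_mult_right L2_funD)
  also have "\<dots> = a * b" using ab by (simp add: field_simps power2_eq_square)
  finally show ?thesis by (simp add: a_def b_def)
qed

lemma L2_Cauchy_Schwarz:
  assumes "f \<in> L2_fun \<nu>" "g \<in> L2_fun \<nu>"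
  shows "cmod (L2_inner \<nu> f g) \<le> L2_norm \<nu> f * L2_norm \<nu> g"
proof -
  have "cmod (L2_inner \<nu> f g) \<le> (\<integral>z. cmod (f z * cnj (g z)) \<partial>\<nu>)"
    unfolding L2_inner_def by (rule integral_norm_bound)
  also have "\<dots> \<le> L2_norm \<nu> f * L2_norm \<nu> g"
    using L2_Cauchy_Schwarz_abs[OF assms] by (simp add: norm_mult)
  finally show ?thesis .
qed

lemma L2_norm_triangle:
  assumes "f \<in> L2_fun \<nu>" "g \<in> L2_fun \<nu>"
  shows "L2_norm \<nu> (\<lambda>z. f z + g z) \<le> L2_norm \<nu> f + L2_norm \<nu> g"
proof (rule power2_le_imp_le)
  have "(L2_norm \<nu> (\<lambda>z. f z + g z))\<^sup>2 \<le>
      (\<integral>z. ((cmod (f z))\<^sup>2 + (cmod (g z))\<^sup>2) + 2 * (cmod (f z) * cmod (g z)) \<partial>\<nu>)"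
    unfolding L2_norm_sq
  proof (intro integral_mono)
    fix z
    have "(cmod (f z + g z))\<^sup>2 \<le> (cmod (f z) + cmod (g z))\<^sup>2"
      by (intro power_mono norm_triangle_ineq) auto
    then show "(cmod (f z + g z))\<^sup>2 \<le> ((cmod (f z))\<^sup>2 + (cmod (g z))\<^sup>2) + 2 * (cmod (f z) * cmod (g z))"
      by (simp add: power2_sum)
  qed (use assms in \<open>auto intro!: L2_funD L2_fun_add L2_fun_mult_integrable\<close>)
  also have "\<dots> = (L2_norm \<nu> f)\<^sup>2 + (L2_norm \<nu> g)\<^sup>2 + 2 * (\<integral>z. cmod (f z) * cmod (g z) \<partial>\<nu>)"
    unfolding L2_norm_sq using assms
    by (simp add: L2_funD L2_fun_mult_integrable)
  also have "\<dots> \<le> (L2_norm \<nu> f + L2_norm \<nu> g)\<^sup>2"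
    using L2_Cauchy_Schwarz_abs[OF assms] by (simp add: power2_sum)
  finally show "(L2_norm \<nu> (\<lambda>z. f z + g z))\<^sup>2 \<le> (L2_norm \<nu> f + L2_norm \<nu> g)\<^sup>2" .
qed simp

lemma L2_norm_triangle_diff:
  assumes "f \<in> L2_fun \<nu>" "g \<in> L2_fun \<nu>" "h \<in> L2_fun \<nu>"
  shows "L2_norm \<nu> (\<lambda>z. f z - h z) \<le> L2_norm \<nu> (\<lambda>z. f z - g z) + L2_norm \<nu> (\<lambda>z. g z - h z)"
  using L2_norm_triangle[OF L2_fun_diff[OF assms(1,2)] L2_fun_diff[OF assms(2,3)]] by simp

lemma L2_norm_le_add_diff:
  assumes "f \<in> L2_fun \<nu>" "g \<in> L2_fun \<nu>"
  shows "L2_norm \<nu> f \<le> L2_norm \<nu> g + L2_norm \<nu> (\<lambda>z. f z - g z)"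
  using L2_norm_triangle[OF assms(2) L2_fun_diff[OF assms]] by simp

lemma L2_inner_add_left:
  assumes "f \<in> L2_fun \<nu>" "g \<in> L2_fun \<nu>" "h \<in> L2_fun \<nu>"
  shows "L2_inner \<nu> (\<lambda>z. f z + g z) h = L2_inner \<nu> f h + L2_inner \<nu> g h"
  unfolding L2_inner_def using assms
  by (simp add: distrib_right L2_fun_inner_integrable)

lemma L2_inner_add_right:
  assumes "f \<in> L2_fun \<nu>" "g \<in> L2_fun \<nu>" "h \<in> L2_fun \<nu>"
  shows "L2_inner \<nu> h (\<lambda>z. f z + g z) = L2_inner \<nu> h f + L2_inner \<nu> h g"
  unfolding L2_inner_def using assms
  by (simp add: distrib_left L2_fun_inner_integrable)

lemma L2_inner_scale_left: "L2_inner \<nu> (\<lambda>z. c * f z) h = c * L2_inner \<nu> f h"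
  by (simp add: L2_inner_def mult.assoc)

lemma L2_inner_scale_right: "L2_inner \<nu> h (\<lambda>z. c * f z) = cnj c * L2_inner \<nu> h f"
  by (simp add: L2_inner_def mult.left_commute)

lemma L2_inner_diff_left:
  assumes "f \<in> L2_fun \<nu>" "g \<in> L2_fun \<nu>" "h \<in> L2_fun \<nu>"
  shows "L2_inner \<nu> (\<lambda>z. f z - g z) h = L2_inner \<nu> f h - L2_inner \<nu> g h"
  unfolding L2_inner_def using assms
  by (simp add: left_diff_distrib L2_fun_inner_integrable)

lemma L2_inner_cong_left:
  assumes "eq_ae \<nu> f g" "f \<in> L2_fun \<nu>" "g \<in> L2_fun \<nu>" "h \<in> L2_fun \<nu>"
  shows "L2_inner \<nu> f h = L2_inner \<nu> g h"
  unfolding L2_inner_def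
  using assms(1) L2_fun_inner_integrable[OF assms(2,4)] L2_fun_inner_integrable[OF assms(3,4)]
  by (intro integral_cong_AE) (auto simp: eq_ae_def)

lemma L2_norm_sq_diff:
  assumes "f \<in> L2_fun \<nu>" "g \<in> L2_fun \<nu>"
  shows "(L2_norm \<nu> (\<lambda>z. f z - g z))\<^sup>2
    = (L2_norm \<nu> f)\<^sup>2 - 2 * Re (L2_inner \<nu> f g) + (L2_norm \<nu> g)\<^sup>2"
proof -
  have pt: "(cmod (a - b))\<^sup>2 = (cmod a)\<^sup>2 - 2 * Re (a * cnj b) + (cmod b)\<^sup>2" for a b
    unfolding cmod_power2 by (simp add: power2_eq_square algebra_simps)
  have "Re (L2_inner \<nu> f g) = (\<integral>z. Re (f z * cnj (g z)) \<partial>\<nu>)"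
    unfolding L2_inner_def by (rule integral_Re[symmetric, OF L2_fun_inner_integrable[OF assms]])
  moreover have "(\<integral>z. (cmod (f z))\<^sup>2 - 2 * Re (f z * cnj (g z)) + (cmod (g z))\<^sup>2 \<partial>\<nu>)
    = (\<integral>z. (cmod (f z))\<^sup>2 \<partial>\<nu>) - 2 * (\<integral>z. Re (f z * cnj (g z)) \<partial>\<nu>) + (\<integral>z. (cmod (g z))\<^sup>2 \<partial>\<nu>)"
    using integrable_Re[OF L2_fun_inner_integrable[OF assms]] assms[THEN L2_funD(2)]
    \<comment> \<open>The real part of the product must stay unexpanded to match the integrability
      fact for \<open>Re\<close>.\<close>
    by (simp del: times_complex.sel)
  ultimately show ?thesis
    unfolding L2_norm_sq pt by simp
qed

lemma L2_parallelogram: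
  assumes "f \<in> L2_fun \<nu>" "g \<in> L2_fun \<nu>"
  shows "(L2_norm \<nu> (\<lambda>z. f z + g z))\<^sup>2 + (L2_norm \<nu> (\<lambda>z. f z - g z))\<^sup>2
    = 2 * (L2_norm \<nu> f)\<^sup>2 + 2 * (L2_norm \<nu> g)\<^sup>2"
  using L2_norm_sq_diff[OF assms] L2_norm_sq_diff[OF assms(1) L2_fun_scale[OF assms(2), of "-1"]]
    L2_norm_scale[of \<nu> "-1" g] L2_inner_scale_right[of \<nu> f "-1" g] by simp

section \<open>Completeness of L2 (Riesz-Fischer)\<close>

lemma nn_integral_L2:
  assumes "f \<in> L2_fun \<nu>"
  shows "(\<integral>\<^sup>+z. ennreal ((cmod (f z))\<^sup>2) \<partial>\<nu>) = ennreal ((L2_norm \<nu> f)\<^sup>2)"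
  unfolding L2_norm_sq by (rule nn_integral_eq_integral[OF L2_funD(2)[OF assms]]) simp

text \<open>The squared increments, weighted by 2^k, have integrals at most 2^k * 4^(-k), so their
  sum is finite almost everywhere. Working with squares keeps the argument valid for an arbitrary
  measure, where L2 norms do not control L1 norms.\<close>

lemma fast_Cauchy_AE_convergent:
  fixes f :: "nat \<Rightarrow> complex \<Rightarrow> complex"
  assumes f: "\<And>n. f n \<in> L2_fun \<nu>"
    and le: "\<And>k. L2_norm \<nu> (\<lambda>z. f (Suc k) z - f k z) \<le> (1/2) ^ k"
  shows "AE z in \<nu>. convergent (\<lambda>k. f k z)"
proof -
  let ?d = "\<lambda>k z. ennreal (2 ^ k * (cmod (f (Suc k) z - f k z))\<^sup>2)"
  have d: "(\<lambda>z. f (Suc k) z - f k z) \<in> L2_fun \<nu>" for k by (intro L2_fun_diff f)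
  have m: "?d k \<in> borel_measurable \<nu>" for k using L2_funD[OF d[of k]] by measurable
  have "(\<integral>\<^sup>+z. (\<Sum>k. ?d k z) \<partial>\<nu>) = (\<Sum>k. \<integral>\<^sup>+z. ?d k z \<partial>\<nu>)"
    by (rule nn_integral_suminf[OF m])
  also have "\<dots> \<le> (\<Sum>k. ennreal ((1/2) ^ k))"
  proof (rule suminf_le)
    fix k
    have "(\<integral>\<^sup>+z. ?d k z \<partial>\<nu>) = ennreal (2 ^ k) * ennreal ((L2_norm \<nu> (\<lambda>z. f (Suc k) z - f k z))\<^sup>2)"
      using L2_funD[OF d[of k]] nn_integral_L2[OF d[of k]] by (simp add: ennreal_mult nn_integral_cmult)
    also have "\<dots> \<le> ennreal (2 ^ k * ((1/2) ^ k)\<^sup>2)"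
      using power_mono[OF le[of k], of 2] by (simp add: ennreal_mult[symmetric] ennreal_leI)
    also have "(2::real) ^ k * ((1/2) ^ k)\<^sup>2 = (1/2) ^ k"
      by (simp add: power2_eq_square field_simps)
    finally show "(\<integral>\<^sup>+z. ?d k z \<partial>\<nu>) \<le> ennreal ((1/2) ^ k)" .
  qed auto
  also have "\<dots> = ennreal (\<Sum>k. (1/2) ^ k)"
    by (rule suminf_ennreal2) (auto intro!: summable_geometric)
  finally have "(\<integral>\<^sup>+z. (\<Sum>k. ?d k z) \<partial>\<nu>) \<noteq> \<infinity>"
    by (auto simp: top_unique)
  then have "AE z in \<nu>. (\<Sum>k. ?d k z) \<noteq> \<infinity>"
    using m by (intro nn_integral_PInf_AE) auto
  then show ?thesis
  proof eventually_elim
    fix z assume fin: "(\<Sum>k. ?d k z) \<noteq> \<infinity>"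
    have "summable (\<lambda>k. 2 ^ k * (cmod (f (Suc k) z - f k z))\<^sup>2)"
      using fin by (intro summable_suminf_not_top) auto
    then have "summable (\<lambda>k. 2 ^ k * (cmod (f (Suc k) z - f k z))\<^sup>2 + (1/2) ^ k)"
      by (intro summable_add) (auto intro!: summable_geometric)
    then have "summable (\<lambda>k. f (Suc k) z - f k z)"
    proof (rule summable_comparison_test'[where N=0])
      fix k :: nat
      let ?x = "cmod (f (Suc k) z - f k z)"
      \<comment> \<open>Passes from weighted squares to the increments themselves: 2 x is at most
        2^k x^2 + 2^(-k), and both terms are summable.\<close>
      have "2 * ((2::real) ^ k * ?x) * 1 \<le> (2 ^ k * ?x)\<^sup>2 + 1\<^sup>2" by (rule sum_squares_bound)
      also have "\<dots> = 2 ^ k * (2 ^ k * ?x\<^sup>2 + (1/2) ^ k)"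
        by (simp add: power2_eq_square field_simps)
      finally have "2 * ?x \<le> 2 ^ k * ?x\<^sup>2 + (1/2) ^ k" by simp
      then show "norm (f (Suc k) z - f k z) \<le> 2 ^ k * ?x\<^sup>2 + (1/2) ^ k"
        using norm_ge_zero[of "f (Suc k) z - f k z"] by linarith
    qed
    then have "convergent (\<lambda>n. \<Sum>k<n. f (Suc k) z - f k z)"
      by (simp add: summable_iff_convergent)
    then have "convergent (\<lambda>n. f n z - f 0 z)"
      using sum_lessThan_telescope[of "\<lambda>k. f k z"] by simp
    then show "convergent (\<lambda>k. f k z)"
      by (simp add: convergent_diff_const_right_iff)
  qed
qed

lemma L2_complete:
  fixes f :: "nat \<Rightarrow> complex \<Rightarrow> complex"
  assumes f: "\<And>n. f n \<in> L2_fun \<nu>"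
    and Cauchy: "\<And>e. e > 0 \<Longrightarrow> \<exists>N. \<forall>m\<ge>N. \<forall>n\<ge>N. L2_norm \<nu> (\<lambda>z. f m z - f n z) \<le> e"
  obtains g where "g \<in> L2_fun \<nu>" "(\<lambda>n. L2_norm \<nu> (\<lambda>z. f n z - g z)) \<longlonglongrightarrow> 0"
proof -
  have "\<exists>N. \<forall>k. \<forall>m\<ge>N k. \<forall>n\<ge>N k. L2_norm \<nu> (\<lambda>z. f m z - f n z) \<le> (1/2) ^ k"
    using Cauchy by (intro choice) auto
  then obtain N where N: "\<And>k m n. m \<ge> N k \<Longrightarrow> n \<ge> N k \<Longrightarrow> L2_norm \<nu> (\<lambda>z. f m z - f n z) \<le> (1/2) ^ k"
    by blast
  \<comment> \<open>The sum over i up to k puts both \<open>M k\<close> and \<open>M (Suc k)\<close>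
    beyond \<open>N k\<close>; the summand k makes \<open>M k\<close> tend to infinity.\<close>
  define M where "M k = k + (\<Sum>i\<le>k. N i)" for k
  have M: "M k \<ge> N k" "M (Suc k) \<ge> N k" for k
    using member_le_sum[of k "{..k}" N] by (auto simp: M_def)
  have Mk: "M k \<ge> k" for k by (simp add: M_def)
  have mf: "f n \<in> borel_measurable \<nu>" for n using L2_funD[OF f] by blast
  have AE: "AE z in \<nu>. convergent (\<lambda>k. f (M k) z)"
    by (rule fast_Cauchy_AE_convergent) (use f N M in auto)
  \<comment> \<open>The value 0 off the (measurable) set of convergence makes g measurable
    everywhere.\<close>
  define g where "g z = (if convergent (\<lambda>k. f (M k) z) then lim (\<lambda>k. f (M k) z) else 0)" for z
  have mg: "g \<in> borel_measurable \<nu>"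
  proof -
    have "{z \<in> space \<nu>. convergent (\<lambda>k. f (M k) z)} \<in> sets \<nu>"
      unfolding Cauchy_convergent_iff[symmetric] using mf by measurable
    then show ?thesis
      unfolding g_def using mf by (intro measurable_If borel_measurable_lim_metric) auto
  qed
  have AE_g: "AE z in \<nu>. (\<lambda>k. f (M k) z) \<longlonglongrightarrow> g z"
    using AE by eventually_elim (auto simp: g_def convergent_LIMSEQ_iff)
  \<comment> \<open>Fatou's lemma along the subsequence; the whole sequence then converges because n
    is not restricted to the subsequence.\<close>
  have bound: "(\<integral>\<^sup>+z. ennreal ((cmod (f n z - g z))\<^sup>2) \<partial>\<nu>) \<le> ennreal (e\<^sup>2)"
    if "e > 0" and K: "\<And>m n. m \<ge> K \<Longrightarrow> n \<ge> K \<Longrightarrow> L2_norm \<nu> (\<lambda>z. f m z - f n z) \<le> e" and "n \<ge> K" for e K n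
  proof -
    have "(\<integral>\<^sup>+z. ennreal ((cmod (f n z - g z))\<^sup>2) \<partial>\<nu>)
        = (\<integral>\<^sup>+z. liminf (\<lambda>k. ennreal ((cmod (f n z - f (M k) z))\<^sup>2)) \<partial>\<nu>)"
    proof (rule nn_integral_cong_AE)
      show "AE z in \<nu>. ennreal ((cmod (f n z - g z))\<^sup>2) = liminf (\<lambda>k. ennreal ((cmod (f n z - f (M k) z))\<^sup>2))"
        using AE_g
      proof eventually_elim
        fix z assume "(\<lambda>k. f (M k) z) \<longlonglongrightarrow> g z"
        then have "(\<lambda>k. ennreal ((cmod (f n z - f (M k) z))\<^sup>2)) \<longlonglongrightarrow> ennreal ((cmod (f n z - g z))\<^sup>2)"
          by (intro tendsto_intros)
        then show "ennreal ((cmod (f n z - g z))\<^sup>2) = liminf (\<lambda>k. ennreal ((cmod (f n z - f (M k) z))\<^sup>2))"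
          by (rule lim_imp_Liminf[OF sequentially_bot, symmetric])
      qed
    qed
    also have "\<dots> \<le> liminf (\<lambda>k. \<integral>\<^sup>+z. ennreal ((cmod (f n z - f (M k) z))\<^sup>2) \<partial>\<nu>)"
      using mf by (intro nn_integral_liminf) measurable
    also have "\<dots> \<le> ennreal (e\<^sup>2)"
    proof (rule order.trans[OF Liminf_le_Limsup[OF sequentially_bot] Limsup_bounded])
      show "\<forall>\<^sub>F k in sequentially. (\<integral>\<^sup>+z. ennreal ((cmod (f n z - f (M k) z))\<^sup>2) \<partial>\<nu>) \<le> ennreal (e\<^sup>2)"
        using eventually_ge_at_top[of K]
      proof eventually_elim
        case (elim k)
        then have "L2_norm \<nu> (\<lambda>z. f n z - f (M k) z) \<le> e"
          using K[of n "M k"] Mk[of k] \<open>n \<ge> K\<close> by simp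
        then show ?case
          unfolding nn_integral_L2[OF L2_fun_diff[OF f f]] by (intro ennreal_leI power_mono) auto
      qed
    qed
    finally show ?thesis .
  qed
  have main: "(\<lambda>z. f n z - g z) \<in> L2_fun \<nu> \<and> L2_norm \<nu> (\<lambda>z. f n z - g z) \<le> e"
    if "e > 0" and K: "\<And>m n. m \<ge> K \<Longrightarrow> n \<ge> K \<Longrightarrow> L2_norm \<nu> (\<lambda>z. f m z - f n z) \<le> e" and "n \<ge> K" for e K n
  proof -
    note b = bound[OF that]
    have "integrable \<nu> (\<lambda>z. (cmod (f n z - g z))\<^sup>2)"
      using b mf mg by (intro integrableI_bounded) (auto simp: less_top[symmetric] top_unique)
    then have *: "(\<lambda>z. f n z - g z) \<in> L2_fun \<nu>" using mf mg by (simp add: L2_fun_def)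
    have "(L2_norm \<nu> (\<lambda>z. f n z - g z))\<^sup>2 \<le> e\<^sup>2"
      using b unfolding nn_integral_L2[OF *] by (simp add: ennreal_le_iff)
    then have "L2_norm \<nu> (\<lambda>z. f n z - g z) \<le> e"
      using \<open>e > 0\<close> by (simp add: power2_le_iff_abs_le)
    with * show ?thesis by simp
  qed
  show ?thesis
  proof
    obtain K where "\<And>m n. m \<ge> K \<Longrightarrow> n \<ge> K \<Longrightarrow> L2_norm \<nu> (\<lambda>z. f m z - f n z) \<le> 1"
      using Cauchy[of 1] by auto
    then have "(\<lambda>z. f K z - g z) \<in> L2_fun \<nu>" using main[of 1 K K] by simp
    from L2_fun_diff[OF f[of K] this] show "g \<in> L2_fun \<nu>" by simp
    show "(\<lambda>n. L2_norm \<nu> (\<lambda>z. f n z - g z)) \<longlonglongrightarrow> 0"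
    proof (rule LIMSEQ_I)
      fix e :: real assume "e > 0"
      then obtain K where K: "\<And>m n. m \<ge> K \<Longrightarrow> n \<ge> K \<Longrightarrow> L2_norm \<nu> (\<lambda>z. f m z - f n z) \<le> e / 2"
        using Cauchy[of "e/2"] by auto
      have "norm (L2_norm \<nu> (\<lambda>z. f n z - g z) - 0) < e" if "n \<ge> K" for n
        using main[of "e/2" K n, OF _ K that] \<open>e > 0\<close> by auto
      then show "\<exists>K. \<forall>n\<ge>K. norm (L2_norm \<nu> (\<lambda>z. f n z - g z) - 0) < e" by blast
    qed
  qed
qed

lemma L2_limit_imp_Cauchy:
  assumes f: "\<And>n. f n \<in> L2_fun \<nu>" and g: "g \<in> L2_fun \<nu>"
    and lim: "(\<lambda>n. L2_norm \<nu> (\<lambda>z. f n z - g z)) \<longlonglongrightarrow> 0" and "e > 0"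
  shows "\<exists>N. \<forall>m\<ge>N. \<forall>n\<ge>N. L2_norm \<nu> (\<lambda>z. f m z - f n z) \<le> e"
proof -
  obtain N where N: "\<And>n. n \<ge> N \<Longrightarrow> L2_norm \<nu> (\<lambda>z. f n z - g z) < e / 2"
    using LIMSEQ_D[OF lim, of "e/2"] \<open>e > 0\<close> by auto
  have "L2_norm \<nu> (\<lambda>z. f m z - f n z) \<le> e" if "m \<ge> N" "n \<ge> N" for m n
    using L2_norm_triangle_diff[OF f[of m] g f[of n]] N[OF that(1)] N[OF that(2)]
      L2_norm_minus_commute[of \<nu> g "f n"] by simp
  then show ?thesis by blast
qed

lemma L2_norm_tendsto:
  assumes f: "\<And>n. f n \<in> L2_fun \<nu>" and g: "g \<in> L2_fun \<nu>"
    and lim: "(\<lambda>n. L2_norm \<nu> (\<lambda>z. f n z - g z)) \<longlonglongrightarrow> 0"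
  shows "(\<lambda>n. L2_norm \<nu> (f n)) \<longlonglongrightarrow> L2_norm \<nu> g"
proof (rule Lim_transform2[OF tendsto_const])
  have "\<bar>L2_norm \<nu> g - L2_norm \<nu> (f n)\<bar> \<le> L2_norm \<nu> (\<lambda>z. f n z - g z)" for n
    using L2_norm_le_add_diff[OF f[of n] g] L2_norm_le_add_diff[OF g f[of n]]
      L2_norm_minus_commute[of \<nu> g "f n"] by linarith
  then show "(\<lambda>n. L2_norm \<nu> g - L2_norm \<nu> (f n)) \<longlonglongrightarrow> 0"
    by (intro Lim_null_comparison[OF _ lim]) auto
qed

lemma L2_inner_tendsto:
  assumes f: "\<And>n. f n \<in> L2_fun \<nu>" and g: "g \<in> L2_fun \<nu>" and h: "h \<in> L2_fun \<nu>"
    and lim: "(\<lambda>n. L2_norm \<nu> (\<lambda>z. f n z - g z)) \<longlonglongrightarrow> 0"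
  shows "(\<lambda>n. L2_inner \<nu> (f n) h) \<longlonglongrightarrow> L2_inner \<nu> g h"
proof -
  have "norm (L2_inner \<nu> (f n) h - L2_inner \<nu> g h) \<le> L2_norm \<nu> (\<lambda>z. f n z - g z) * L2_norm \<nu> h" for n
    using L2_Cauchy_Schwarz[OF L2_fun_diff[OF f[of n] g] h] L2_inner_diff_left[OF f[of n] g h] by simp
  then have "\<forall>\<^sub>F n in sequentially. norm (L2_inner \<nu> (f n) h - L2_inner \<nu> g h)
      \<le> L2_norm \<nu> (\<lambda>z. f n z - g z) * L2_norm \<nu> h"
    by (intro always_eventually allI)
  from Lim_null_comparison[OF this tendsto_mult_left_zero[OF lim]]
  have "(\<lambda>n. L2_inner \<nu> (f n) h - L2_inner \<nu> g h) \<longlonglongrightarrow> 0" .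
  then show ?thesis by (simp add: LIM_zero_iff)
qed

text \<open>D need not be closed, so the projection p lies only in its closure and is delivered
  together with a minimizing sequence d from D. That sequence is what later carries an operator from
  D over to p.\<close>

lemma L2_projection:
  assumes sub: "D \<subseteq> L2_fun \<nu>" and ne: "D \<noteq> {}"
    and add: "\<And>f g. f \<in> D \<Longrightarrow> g \<in> D \<Longrightarrow> (\<lambda>z. f z + g z) \<in> D"
    and scale: "\<And>c f. f \<in> D \<Longrightarrow> (\<lambda>z. c * f z) \<in> D"
    and f: "f \<in> L2_fun \<nu>"
  obtains p d where "p \<in> L2_fun \<nu>" "\<And>n. d n \<in> D" "(\<lambda>n. L2_norm \<nu> (\<lambda>z. d n z - p z)) \<longlonglongrightarrow> 0"
    "\<And>e. e \<in> D \<Longrightarrow> L2_inner \<nu> (\<lambda>z. f z - p z) e = 0"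
proof -
  let ?N = "L2_norm \<nu>"
  define S where "S = (\<lambda>e. (?N (\<lambda>z. f z - e z))\<^sup>2) ` D"
  define I where "I = Inf S"
  have S: "S \<noteq> {}" "bdd_below S" using ne by (auto simp: S_def intro!: bdd_belowI[of _ 0])
  have I_le: "I \<le> (?N (\<lambda>z. f z - e z))\<^sup>2" if "e \<in> D" for e
    unfolding I_def by (rule cInf_lower) (use that S in \<open>auto simp: S_def\<close>)
  have "\<exists>d. \<forall>n. d n \<in> D \<and> (?N (\<lambda>z. f z - d n z))\<^sup>2 < I + 1 / real (Suc n)"
  proof (intro choice allI)
    fix n
    have "Inf S < I + 1 / real (Suc n)" by (simp add: I_def)
    then show "\<exists>d. d \<in> D \<and> (?N (\<lambda>z. f z - d z))\<^sup>2 < I + 1 / real (Suc n)"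
      using cInf_lessD[OF S(1)] by (auto simp: S_def)
  qed
  then obtain d where d: "\<And>n. d n \<in> D" and dI: "\<And>n. (?N (\<lambda>z. f z - d n z))\<^sup>2 < I + 1 / real (Suc n)"
    by blast
  have dL: "d n \<in> L2_fun \<nu>" for n using d sub by blast
  \<comment> \<open>Parallelogram law for f - d n and f - d m: the midpoint of d n and d m belongs
    to D, so its squared distance to f is at least I.\<close>
  have par: "(?N (\<lambda>z. d m z - d n z))\<^sup>2 \<le> 2 / real (Suc m) + 2 / real (Suc n)" for m n
  proof -
    have "(?N (\<lambda>z. (f z - d n z) + (f z - d m z)))\<^sup>2 + (?N (\<lambda>z. (f z - d n z) - (f z - d m z)))\<^sup>2
      = 2 * (?N (\<lambda>z. f z - d n z))\<^sup>2 + 2 * (?N (\<lambda>z. f z - d m z))\<^sup>2"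
      by (intro L2_parallelogram L2_fun_diff f dL)
    moreover have "(\<lambda>z. (f z - d n z) + (f z - d m z)) = (\<lambda>z. 2 * (f z - (1/2) * (d n z + d m z)))"
      and "(\<lambda>z. (f z - d n z) - (f z - d m z)) = (\<lambda>z. d m z - d n z)"
      by (simp_all add: fun_eq_iff algebra_simps)
    moreover have "I \<le> (?N (\<lambda>z. f z - (1/2) * (d n z + d m z)))\<^sup>2"
      by (intro I_le scale add d)
    moreover note dI[of m] dI[of n]
    ultimately show ?thesis
      by (simp only: L2_norm_scale power_mult_distrib) simp
  qed
  obtain p where p: "p \<in> L2_fun \<nu>" and lim: "(\<lambda>n. ?N (\<lambda>z. d n z - p z)) \<longlonglongrightarrow> 0"
  proof (rule L2_complete[OF dL])
    fix e :: real assume "e > 0"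
    obtain K where "4 / e\<^sup>2 < real K"
      using reals_Archimedean2 by blast
    then have K: "4 / e\<^sup>2 < real (Suc K)" by simp
    have "?N (\<lambda>z. d m z - d n z) \<le> e" if "m \<ge> K" "n \<ge> K" for m n
    proof (rule power2_le_imp_le)
      have "2 / real (Suc m) \<le> 2 / real (Suc K)" "2 / real (Suc n) \<le> 2 / real (Suc K)"
        using that by (auto intro!: divide_left_mono)
      moreover have "4 / real (Suc K) < e\<^sup>2"
        using K \<open>e > 0\<close> by (simp add: field_simps)
      ultimately show "(?N (\<lambda>z. d m z - d n z))\<^sup>2 \<le> e\<^sup>2" using par[of m n] by simp
    qed (use \<open>e > 0\<close> in simp)
    then show "\<exists>N. \<forall>m\<ge>N. \<forall>n\<ge>N. ?N (\<lambda>z. d m z - d n z) \<le> e" by blast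
  qed
  have fp: "(\<lambda>z. f z - p z) \<in> L2_fun \<nu>" by (intro L2_fun_diff f p)
  have lim': "(\<lambda>n. ?N (\<lambda>z. (f z - c * e z - d n z) - (f z - p z - c * e z))) \<longlonglongrightarrow> 0" for c e
  proof -
    have "(\<lambda>z. (f z - c * e z - d n z) - (f z - p z - c * e z)) = (\<lambda>z. p z - d n z)" for n
      by (simp add: fun_eq_iff algebra_simps)
    then show ?thesis using lim by (simp add: L2_norm_minus_commute[of \<nu> p])
  qed
  have "L2_inner \<nu> (\<lambda>z. f z - p z) e = 0" if e: "e \<in> D" for e
  proof -
    have eL: "e \<in> L2_fun \<nu>" using e sub by blast
    define a where "a = L2_inner \<nu> (\<lambda>z. f z - p z) e"
    \<comment> \<open>The vacuous term 0 * e is there so that \<open>lim'\<close> applies with c =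
      0.\<close>
    have "(\<lambda>n. (?N (\<lambda>z. f z - 0 * e z - d n z))\<^sup>2) \<longlonglongrightarrow> (?N (\<lambda>z. f z - p z - 0 * e z))\<^sup>2"
      by (intro tendsto_power L2_norm_tendsto L2_fun_diff L2_fun_scale f p dL eL lim')
    moreover have "(\<lambda>n. I + 1 / real (Suc n)) \<longlonglongrightarrow> I + 0"
      by (intro tendsto_add tendsto_const LIMSEQ_Suc[OF lim_1_over_n])
    ultimately have up: "(?N (\<lambda>z. f z - p z))\<^sup>2 \<le> I"
      using dI by (intro LIMSEQ_le[where X="\<lambda>n. (?N (\<lambda>z. f z - d n z))\<^sup>2" and Y="\<lambda>n. I + 1 / real (Suc n)"])
        (auto intro: less_imp_le)
    have low: "I \<le> (?N (\<lambda>z. f z - p z - c * e z))\<^sup>2" for c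
    proof (rule LIMSEQ_le_const)
      show "(\<lambda>n. (?N (\<lambda>z. f z - c * e z - d n z))\<^sup>2) \<longlonglongrightarrow> (?N (\<lambda>z. f z - p z - c * e z))\<^sup>2"
        by (intro tendsto_power L2_norm_tendsto L2_fun_diff L2_fun_scale f p dL eL lim')
      have "I \<le> (?N (\<lambda>z. f z - (d n z + c * e z)))\<^sup>2" for n
        by (intro I_le add scale d e)
      then show "\<exists>N. \<forall>n\<ge>N. I \<le> (?N (\<lambda>z. f z - c * e z - d n z))\<^sup>2"
        by (simp add: algebra_simps)
    qed
    \<comment> \<open>Minimality tested against moving p by t * a in the direction e: the linear
      term in t cannot be beaten by the quadratic one for small t unless a = 0.\<close>
    have ineq: "2 * t * (cmod a)\<^sup>2 \<le> t\<^sup>2 * (cmod a)\<^sup>2 * (?N e)\<^sup>2" for t :: real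
    proof -
      have "(?N (\<lambda>z. f z - p z - (of_real t * a) * e z))\<^sup>2
        = (?N (\<lambda>z. f z - p z))\<^sup>2 - 2 * (t * (cmod a)\<^sup>2) + t\<^sup>2 * (cmod a)\<^sup>2 * (?N e)\<^sup>2"
      proof -
        have "Re (L2_inner \<nu> (\<lambda>z. f z - p z) (\<lambda>z. (of_real t * a) * e z)) = t * (cmod a)\<^sup>2"
          unfolding L2_inner_scale_right a_def[symmetric] cmod_power2
          by (simp add: power2_eq_square algebra_simps)
        then show ?thesis
          using L2_norm_sq_diff[OF fp L2_fun_scale[OF eL, of "of_real t * a"]]
          by (simp add: L2_norm_scale norm_mult power_mult_distrib)
      qed
      then show ?thesis using up low[of "of_real t * a"] by simp
    qed
    have "a = 0"
    proof (rule ccontr)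
      assume "a \<noteq> 0"
      then have *: "2 * t \<le> t\<^sup>2 * (?N e)\<^sup>2" for t using ineq[of t] by (simp add: mult.commute mult.left_commute)
      \<comment> \<open>The summand 1 covers a direction e of norm 0 as well; this t gives 2 t at
        most t, the contradiction.\<close>
      define t where "t = 1 / ((?N e)\<^sup>2 + 1)"
      have t: "t > 0" "t * (?N e)\<^sup>2 \<le> 1" by (auto simp: t_def field_simps add_pos_nonneg add_nonneg_pos)
      have "t\<^sup>2 * (?N e)\<^sup>2 \<le> t * 1" using t mult_left_mono[OF t(2), of t] by (simp add: power2_eq_square mult.assoc)
      with *[of t] t(1) show False by simp
    qed
    then show ?thesis by (simp add: a_def)
  qed
  with that[OF p d lim] show ?thesis by blast
qed

section \<open>The total variation of a complex measure\<close>

text \<open>Holds for every set function, since \<open>measure_of\<close> takes its sigma-algebra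
  from the generator alone, whether or not the given values form a measure.\<close>

lemma sets_variation [simp, measurable_cong]: "sets (variation \<mu>) = sets circle_borel"
proof -
  have "sigma_sets unit_circle (sets circle_borel) = sets circle_borel"
    using sets.sigma_sets_eq[of circle_borel] by (simp add: circle_borel_def space_restrict_space)
  moreover have "sets circle_borel \<subseteq> Pow unit_circle"
    using sets.space_closed[of circle_borel] by (simp add: circle_borel_def space_restrict_space)
  ultimately show ?thesis by (simp add: variation_def)
qed

lemma space_circle_borel [simp]: "space circle_borel = unit_circle"
  by (simp add: circle_borel_def space_restrict_space)

lemma space_variation [simp]: "space (variation \<mu>) = unit_circle"
  using sets_eq_imp_space_eq[OF sets_variation] by simp

lemma complex_measureD:
  assumes "complex_measure \<mu>" "range A \<subseteq> sets circle_borel" "disjoint_family A"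
  shows "(\<lambda>n. \<mu> (A n)) sums \<mu> (\<Union>n. A n)"
  using assms by (simp add: complex_measure_def)

lemma complex_measure_empty:
  assumes "complex_measure \<mu>"
  shows "\<mu> {} = 0"
proof -
  have "(\<lambda>n::nat. \<mu> {}) sums \<mu> {}"
    using complex_measureD[OF assms, of "\<lambda>n. {}"] by (simp add: disjoint_family_on_def)
  then show ?thesis
    using summable_LIMSEQ_zero[OF sums_summable] LIMSEQ_const_iff by blast
qed

lemma complex_measure_Un:
  assumes "complex_measure \<mu>" "A \<in> sets circle_borel" "B \<in> sets circle_borel" "A \<inter> B = {}"
  shows "\<mu> (A \<union> B) = \<mu> A + \<mu> B"
proof -
  have "(\<lambda>n. \<mu> (binaryset A B n)) sums \<mu> (\<Union>n. binaryset A B n)"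
    using assms by (intro complex_measureD) (auto simp: range_binaryset_eq disjoint_family_on_def binaryset_def)
  moreover have "(\<lambda>n. \<mu> (binaryset A B n)) sums (\<mu> A + \<mu> B)"
    by (rule binaryset_sums) (rule complex_measure_empty[OF assms(1)])
  ultimately show ?thesis by (simp add: UN_binaryset_eq sums_unique2)
qed

lemma complex_measure_Diff:
  assumes "complex_measure \<mu>" "A \<in> sets circle_borel" "B \<in> sets circle_borel" "A \<subseteq> B"
  shows "\<mu> (B - A) = \<mu> B - \<mu> A"
  using complex_measure_Un[OF assms(1,2), of "B - A"] assms(2-4)
  by (auto simp: Un_absorb1 Un_Diff_cancel)

lemma complex_measure_Union:
  assumes "complex_measure \<mu>" "finite P" "P \<subseteq> sets circle_borel" "disjoint P"
  shows "\<mu> (\<Union>P) = (\<Sum>X\<in>P. \<mu> X)"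
  using assms(2-4)
proof (induction P rule: finite_induct)
  case empty
  then show ?case by (simp add: complex_measure_empty[OF assms(1)])
next
  case (insert X P)
  have "X \<inter> \<Union>P = {}" using insert.prems insert.hyps by (auto simp: disjoint_def)
  moreover have "\<Union>P \<in> sets circle_borel" using insert by (intro sets.finite_Union) auto
  ultimately show ?case
    using insert complex_measure_Un[OF assms(1), of X "\<Union>P"] by (auto simp: disjoint_def)
qed

lemma ennreal_norm_le_suminf:
  fixes f :: "nat \<Rightarrow> 'a::real_normed_vector"
  assumes "f sums s"
  shows "ennreal (norm s) \<le> (\<Sum>i. ennreal (norm (f i)))"
proof (rule LIMSEQ_le_const2)
  show "(\<lambda>n. ennreal (norm (\<Sum>i<n. f i))) \<longlonglongrightarrow> ennreal (norm s)"
    using assms by (intro tendsto_ennrealI tendsto_norm) (simp add: sums_def)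
  have "ennreal (norm (\<Sum>i<n. f i)) \<le> (\<Sum>i. ennreal (norm (f i)))" for n
  proof -
    have "ennreal (norm (\<Sum>i<n. f i)) \<le> ennreal (\<Sum>i<n. norm (f i))"
      by (intro ennreal_leI norm_sum)
    also have "\<dots> = (\<Sum>i<n. ennreal (norm (f i)))" by simp
    also have "\<dots> \<le> (\<Sum>i. ennreal (norm (f i)))" by (intro sum_le_suminf) auto
    finally show ?thesis .
  qed
  then show "\<exists>N. \<forall>n\<ge>N. ennreal (norm (\<Sum>i<n. f i)) \<le> (\<Sum>i. ennreal (norm (f i)))" by blast
qed

text \<open>The set function inside \<open>variation\<close>, given a name because
  \<open>measure_of\<close> returns it as the measure of a set only after countable additivity is
  known.\<close>

definition partition_sums :: "(complex set \<Rightarrow> complex) \<Rightarrow> complex set \<Rightarrow> ennreal" where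
  "partition_sums \<mu> E = (SUP P\<in>{P. finite P \<and> P \<subseteq> sets circle_borel \<and> partition_on E P}.
     \<Sum>X\<in>P. ennreal (cmod (\<mu> X)))"

lemma partition_sums_upper:
  assumes "finite P" "P \<subseteq> sets circle_borel" "partition_on E P"
  shows "(\<Sum>X\<in>P. ennreal (cmod (\<mu> X))) \<le> partition_sums \<mu> E"
  unfolding partition_sums_def by (rule SUP_upper) (use assms in auto)

text \<open>A partition of A and one of B together partition the union. Only superadditivity comes
  this cheaply; the reverse inequality, for countable unions at once, needs countable additivity of
  \<mu>.\<close>

lemma partition_sums_Un:
  assumes "A \<in> sets circle_borel" "B \<in> sets circle_borel" "A \<inter> B = {}"
  shows "partition_sums \<mu> A + partition_sums \<mu> B \<le> partition_sums \<mu> (A \<union> B)"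
proof -
  let ?\<P> = "\<lambda>E. {P. finite P \<and> P \<subseteq> sets circle_borel \<and> partition_on E P}"
  let ?s = "\<lambda>P. \<Sum>X\<in>P. ennreal (cmod (\<mu> X))"
  have ne: "?\<P> E \<noteq> {}" if "E \<in> sets circle_borel" for E
  proof (cases "E = {}")
    case True
    then have "{} \<in> ?\<P> E" by (simp add: partition_on_empty)
    then show ?thesis by blast
  next
    case False
    then have "{E} \<in> ?\<P> E" using that by (simp add: partition_on_space)
    then show ?thesis by blast
  qed
  have le: "?s P + ?s Q \<le> partition_sums \<mu> (A \<union> B)" if P: "P \<in> ?\<P> A" and Q: "Q \<in> ?\<P> B" for P Q
  proof -
    have dis: "X \<inter> Y = {}" if "X \<in> P" "Y \<in> Q" for X Y
      using that P Q assms(3) by (auto simp: partition_on_def)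
    \<comment> \<open>A common block would be disjoint from itself, hence empty, and partitions have
      no empty block.\<close>
    have "P \<inter> Q = {}" using dis P by (fastforce simp: partition_on_def)
    then have "?s P + ?s Q = ?s (P \<union> Q)" using P Q by (intro sum.union_disjoint[symmetric]) auto
    also have "\<dots> \<le> partition_sums \<mu> (A \<union> B)"
    proof (rule partition_sums_upper)
      have "disjoint (P \<union> Q)"
      proof (rule disjointI)
        fix X Y assume *: "X \<in> P \<union> Q" "Y \<in> P \<union> Q" "X \<noteq> Y"
        have dPQ: "disjoint P" "disjoint Q" using P Q by (auto simp: partition_on_def)
        from *(1,2) show "X \<inter> Y = {}"
          using disjointD[OF dPQ(1) _ _ *(3)] disjointD[OF dPQ(2) _ _ *(3)] dis[of X Y] dis[of Y X]
          by (elim UnE) (simp_all add: Int_commute)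
      qed
      then show "partition_on (A \<union> B) (P \<union> Q)" using P Q by (auto simp: partition_on_def)
    qed (use P Q in auto)
    finally show ?thesis .
  qed
  have "partition_sums \<mu> A + partition_sums \<mu> B = (SUP P\<in>?\<P> A. ?s P + partition_sums \<mu> B)"
    unfolding partition_sums_def[of \<mu> A] by (rule ennreal_SUP_add_left[OF ne[OF assms(1)], symmetric])
  also have "\<dots> \<le> partition_sums \<mu> (A \<union> B)"
  proof (rule SUP_least)
    fix P assume P: "P \<in> ?\<P> A"
    have "?s P + partition_sums \<mu> B = (SUP Q\<in>?\<P> B. ?s P + ?s Q)"
      unfolding partition_sums_def[of \<mu> B] by (rule ennreal_SUP_add_right[OF ne[OF assms(2)]])
    also have "\<dots> \<le> partition_sums \<mu> (A \<union> B)" by (intro SUP_least le P)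
    finally show "?s P + partition_sums \<mu> B \<le> partition_sums \<mu> (A \<union> B)" .
  qed
  finally show ?thesis .
qed

lemma partition_sums_mono:
  assumes "A \<in> sets circle_borel" "B \<in> sets circle_borel" "A \<subseteq> B"
  shows "partition_sums \<mu> A \<le> partition_sums \<mu> B"
proof -
  have "partition_sums \<mu> A \<le> partition_sums \<mu> A + partition_sums \<mu> (B - A)" by simp
  also have "\<dots> \<le> partition_sums \<mu> (A \<union> (B - A))" using assms by (intro partition_sums_Un) auto
  finally show ?thesis using assms(3) by (simp add: Un_absorb1 Un_Diff_cancel)
qed

lemma partition_sums_UN_lessThan:
  fixes A :: "nat \<Rightarrow> complex set"
  assumes "range A \<subseteq> sets circle_borel" "disjoint_family A"
  shows "(\<Sum>i<n. partition_sums \<mu> (A i)) \<le> partition_sums \<mu> (\<Union>i<n. A i)"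
proof (induction n)
  case 0
  then show ?case by simp
next
  case (Suc n)
  have U: "(\<Union>i<n. A i) \<in> sets circle_borel" using assms(1) by auto
  have "A i \<inter> A n = {}" if "i < n" for i
    using that assms(2) by (intro disjoint_family_onD) auto
  then have "(\<Union>i<n. A i) \<inter> A n = {}" by blast
  then have "partition_sums \<mu> (\<Union>i<n. A i) + partition_sums \<mu> (A n)
      \<le> partition_sums \<mu> ((\<Union>i<n. A i) \<union> A n)"
    using U assms(1) by (intro partition_sums_Un) auto
  with add_right_mono[OF Suc, of "partition_sums \<mu> (A n)"]
  have "(\<Sum>i<n. partition_sums \<mu> (A i)) + partition_sums \<mu> (A n)
      \<le> partition_sums \<mu> ((\<Union>i<n. A i) \<union> A n)"
    by (rule order_trans)
  then show ?case by (simp add: lessThan_Suc Un_commute add.commute)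
qed

text \<open>One inequality is finite superadditivity and monotonicity. For the other, a partition of
  the union is cut along the sets A i: each \<mu> X is the sum of its traces, and the traces on A i
  form a partition of A i.\<close>

lemma partition_sums_countably_additive:
  assumes "complex_measure \<mu>"
  shows "countably_additive (sets circle_borel) (partition_sums \<mu>)"
proof (rule countably_additiveI)
  fix A :: "nat \<Rightarrow> complex set"
  assume A: "range A \<subseteq> sets circle_borel" "disjoint_family A" "(\<Union>i. A i) \<in> sets circle_borel"
  show "(\<Sum>i. partition_sums \<mu> (A i)) = partition_sums \<mu> (\<Union>i. A i)"
  proof (rule antisym)
    show "(\<Sum>i. partition_sums \<mu> (A i)) \<le> partition_sums \<mu> (\<Union>i. A i)"
    proof (rule suminf_le_const)
      fix n
      have "partition_sums \<mu> (\<Union>i<n. A i) \<le> partition_sums \<mu> (\<Union>i. A i)"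
        using A by (intro partition_sums_mono) auto
      with partition_sums_UN_lessThan[OF A(1,2)]
      show "(\<Sum>i<n. partition_sums \<mu> (A i)) \<le> partition_sums \<mu> (\<Union>i. A i)"
        by (rule order_trans)
    qed simp
    have "(\<Sum>X\<in>P. ennreal (cmod (\<mu> X))) \<le> (\<Sum>i. partition_sums \<mu> (A i))"
      if P: "finite P" "P \<subseteq> sets circle_borel" "partition_on (\<Union>i. A i) P" for P
    proof -
      have "(\<Sum>X\<in>P. ennreal (cmod (\<mu> X))) \<le> (\<Sum>X\<in>P. \<Sum>i. ennreal (cmod (\<mu> (X \<inter> A i))))"
      proof (rule sum_mono)
        fix X assume X: "X \<in> P"
        have "(\<lambda>i. \<mu> (X \<inter> A i)) sums \<mu> (\<Union>i. X \<inter> A i)"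
        proof (rule complex_measureD[OF assms])
          show "range (\<lambda>i. X \<inter> A i) \<subseteq> sets circle_borel" using X P(2) A(1) by auto
          show "disjoint_family (\<lambda>i. X \<inter> A i)"
            by (rule disjoint_family_on_bisimulation[OF A(2)]) auto
        qed
        moreover have "(\<Union>i. X \<inter> A i) = X" using X P(3) by (auto simp: partition_on_def)
        ultimately have "(\<lambda>i. \<mu> (X \<inter> A i)) sums \<mu> X" by simp
        then show "ennreal (cmod (\<mu> X)) \<le> (\<Sum>i. ennreal (cmod (\<mu> (X \<inter> A i))))"
          by (rule ennreal_norm_le_suminf)
      qed
      also have "\<dots> = (\<Sum>i. \<Sum>X\<in>P. ennreal (cmod (\<mu> (X \<inter> A i))))"
        by (rule suminf_sum[symmetric]) simp
      also have "\<dots> \<le> (\<Sum>i. partition_sums \<mu> (A i))"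
      proof (rule suminf_le)
        fix i
        \<comment> \<open>Empty traces are dropped, since they may not be blocks and would spoil
          injectivity of the trace map; they contribute nothing because \<mu> {} = 0.\<close>
        let ?Q = "{X \<in> P. X \<inter> A i \<noteq> {}}"
        have inj: "inj_on (\<lambda>X. X \<inter> A i) ?Q"
        proof (rule inj_onI)
          fix X Y assume "X \<in> ?Q" "Y \<in> ?Q" "X \<inter> A i = Y \<inter> A i"
          then have "X \<in> P" "Y \<in> P" "X \<inter> Y \<noteq> {}" by auto
          then show "X = Y" using P(3) by (auto simp: partition_on_def disjoint_def)
        qed
        have "(\<Sum>X\<in>P. ennreal (cmod (\<mu> (X \<inter> A i)))) = (\<Sum>X\<in>?Q. ennreal (cmod (\<mu> (X \<inter> A i))))"
          using P(1) by (intro sum.mono_neutral_right) (auto simp: complex_measure_empty[OF assms])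
        also have "\<dots> = (\<Sum>Y\<in>(\<lambda>X. X \<inter> A i) ` ?Q. ennreal (cmod (\<mu> Y)))"
          by (simp add: sum.reindex[OF inj])
        also have "\<dots> \<le> partition_sums \<mu> (A i)"
        proof (rule partition_sums_upper)
          have "(\<lambda>X. X \<inter> A i) ` ?Q = (\<inter>) (A i) ` P - {{}}" by auto
          moreover have "A i \<inter> (\<Union>i. A i) = A i" by auto
          ultimately show "partition_on (A i) ((\<lambda>X. X \<inter> A i) ` ?Q)"
            using partition_on_restrict[OF P(3), of "A i"] by simp
        qed (use P A(1) in auto)
        finally show "(\<Sum>X\<in>P. ennreal (cmod (\<mu> (X \<inter> A i)))) \<le> partition_sums \<mu> (A i)" .
      qed auto
      finally show ?thesis .
    qed
    then show "partition_sums \<mu> (\<Union>i. A i) \<le> (\<Sum>i. partition_sums \<mu> (A i))"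
      unfolding partition_sums_def[of \<mu> "\<Union>i. A i"] by (intro SUP_least) auto
  qed
qed

lemma emeasure_variation:
  assumes "complex_measure \<mu>" "E \<in> sets circle_borel"
  shows "emeasure (variation \<mu>) E = partition_sums \<mu> E"
proof -
  have var: "variation \<mu> = measure_of unit_circle (sets circle_borel) (partition_sums \<mu>)"
    unfolding variation_def partition_sums_def[abs_def] ..
  have "positive (sets circle_borel) (partition_sums \<mu>)"
  proof -
    have "{P :: complex set set. finite P \<and> P \<subseteq> sets circle_borel \<and> partition_on {} P} = {{}}"
      by (auto simp: partition_on_empty)
    then show ?thesis by (simp add: positive_def partition_sums_def)
  qed
  then show ?thesis
    unfolding var
    using partition_sums_countably_additive[OF assms(1)] assms(2) sets.sigma_algebra_axioms[of circle_borel]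
    by (intro emeasure_measure_of_sigma) simp_all
qed

lemma norm_le_variation:
  assumes "complex_measure \<mu>" "E \<in> sets circle_borel"
  shows "ennreal (cmod (\<mu> E)) \<le> emeasure (variation \<mu>) E"
proof (cases "E = {}")
  case True
  then show ?thesis by (simp add: complex_measure_empty[OF assms(1)])
next
  case False
  then show ?thesis
    using partition_sums_upper[of "{E}" E \<mu>] assms by (simp add: emeasure_variation partition_on_space)
qed

text \<open>The modulus is at most the sum of the absolute real and imaginary parts. Splitting each
  by sign yields four subsets, one of which accounts for at least a quarter of the total.\<close>

lemma exists_subset_norm_sum_ge:
  fixes f :: "'a \<Rightarrow> complex"
  assumes "finite P"
  shows "\<exists>S\<subseteq>P. (\<Sum>x\<in>P. cmod (f x)) \<le> 4 * cmod (\<Sum>x\<in>S. f x)"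
proof -
  let ?A = "{x\<in>P. Re (f x) \<ge> 0}" and ?B = "{x\<in>P. \<not> Re (f x) \<ge> 0}"
    and ?C = "{x\<in>P. Im (f x) \<ge> 0}" and ?D = "{x\<in>P. \<not> Im (f x) \<ge> 0}"
  have split: "(\<Sum>x\<in>P. g x) = (\<Sum>x\<in>{x\<in>P. Q x}. g x) + (\<Sum>x\<in>{x\<in>P. \<not> Q x}. g x)" for g :: "'a \<Rightarrow> real" and Q
  proof -
    have "P = {x\<in>P. Q x} \<union> {x\<in>P. \<not> Q x}" by auto
    then show ?thesis using assms by (subst \<open>P = _\<close>, subst sum.union_disjoint) auto
  qed
  have "(\<Sum>x\<in>P. cmod (f x)) \<le> (\<Sum>x\<in>P. \<bar>Re (f x)\<bar> + \<bar>Im (f x)\<bar>)"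
    by (intro sum_mono cmod_le)
  also have "\<dots> = (\<Sum>x\<in>?A. Re (f x)) + (\<Sum>x\<in>?B. - Re (f x)) + ((\<Sum>x\<in>?C. Im (f x)) + (\<Sum>x\<in>?D. - Im (f x)))"
    unfolding sum.distrib
    by (subst split[of "\<lambda>x. \<bar>Re (f x)\<bar>" "\<lambda>x. Re (f x) \<ge> 0"], subst split[of "\<lambda>x. \<bar>Im (f x)\<bar>" "\<lambda>x. Im (f x) \<ge> 0"])
      (intro arg_cong2[where f="(+)"] sum.cong; auto)
  also have "\<dots> = Re (\<Sum>x\<in>?A. f x) - Re (\<Sum>x\<in>?B. f x) + (Im (\<Sum>x\<in>?C. f x) - Im (\<Sum>x\<in>?D. f x))"
    by (simp add: sum_negf)
  also have "\<dots> \<le> cmod (\<Sum>x\<in>?A. f x) + cmod (\<Sum>x\<in>?B. f x) + (cmod (\<Sum>x\<in>?C. f x) + cmod (\<Sum>x\<in>?D. f x))"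
    using abs_Re_le_cmod[of "\<Sum>x\<in>?A. f x"] abs_Re_le_cmod[of "\<Sum>x\<in>?B. f x"]
      abs_Im_le_cmod[of "\<Sum>x\<in>?C. f x"] abs_Im_le_cmod[of "\<Sum>x\<in>?D. f x"] by linarith
  finally have "\<exists>S\<in>{?A, ?B, ?C, ?D}. (\<Sum>x\<in>P. cmod (f x)) \<le> 4 * cmod (\<Sum>x\<in>S. f x)"
    by simp linarith
  then obtain S where S: "S \<in> {?A, ?B, ?C, ?D}" "(\<Sum>x\<in>P. cmod (f x)) \<le> 4 * cmod (\<Sum>x\<in>S. f x)"
    by (rule bexE)
  from S(1) have "S \<subseteq> P" by auto
  with S(2) show ?thesis by (intro exI conjI)
qed

text \<open>E is cut into two pieces on both of which \<mu> exceeds 1 in modulus. One piece inherits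
  the infinite variation and becomes B; the other is E - B.\<close>

lemma variation_infinite_split:
  assumes cm: "complex_measure \<mu>" and E: "E \<in> sets circle_borel" "emeasure (variation \<mu>) E = \<infinity>"
  shows "\<exists>B\<in>sets circle_borel. B \<subseteq> E \<and> emeasure (variation \<mu>) B = \<infinity> \<and> cmod (\<mu> (E - B)) > 1"
proof -
  \<comment> \<open>The factor 4 is lost in choosing a subfamily of a partition. What remains, 1 +
    |\<mu> E|, makes |\<mu> A| large enough that |\<mu> (E - A)| exceeds 1 too.\<close>
  have "ennreal (4 * (1 + cmod (\<mu> E))) < partition_sums \<mu> E"
    using E by (simp add: emeasure_variation[OF cm])
  then obtain P where P: "finite P" "P \<subseteq> sets circle_borel" "partition_on E P"
    and gt: "ennreal (4 * (1 + cmod (\<mu> E))) < (\<Sum>X\<in>P. ennreal (cmod (\<mu> X)))"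
    unfolding partition_sums_def less_SUP_iff by blast
  have gt': "4 * (1 + cmod (\<mu> E)) < (\<Sum>X\<in>P. cmod (\<mu> X))"
  proof (rule ccontr)
    assume "\<not> ?thesis"
    then have "ennreal (\<Sum>X\<in>P. cmod (\<mu> X)) \<le> ennreal (4 * (1 + cmod (\<mu> E)))"
      by (intro ennreal_leI) simp
    with gt show False by (simp add: sum_ennreal flip: not_less)
  qed
  obtain S where S: "S \<subseteq> P" "(\<Sum>X\<in>P. cmod (\<mu> X)) \<le> 4 * cmod (\<Sum>X\<in>S. \<mu> X)"
    using exists_subset_norm_sum_ge[OF P(1)] by blast
  define A where "A = \<Union>S"
  have fS: "finite S" "S \<subseteq> sets circle_borel" using S(1) P(1,2) finite_subset by auto
  have A: "A \<in> sets circle_borel" "A \<subseteq> E"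
    using fS S(1) P(3) by (auto simp: A_def partition_on_def)
  have "disjoint S" using S(1) P(3) by (auto simp: partition_on_def disjoint_def)
  then have "\<mu> A = (\<Sum>X\<in>S. \<mu> X)"
    unfolding A_def by (rule complex_measure_Union[OF cm fS])
  then have muA: "cmod (\<mu> A) > 1 + cmod (\<mu> E)" using gt' S(2) by simp
  have muB: "cmod (\<mu> (E - A)) > 1"
    using complex_measure_Diff[OF cm A(1) E(1) A(2)] norm_triangle_ineq2[of "\<mu> A" "\<mu> E"] muA
    by (simp add: norm_minus_commute)
  have "emeasure (variation \<mu>) E = emeasure (variation \<mu>) A + emeasure (variation \<mu>) (E - A)"
  proof -
    have "A \<union> (E - A) = E" using A by auto
    then show ?thesis
      using plus_emeasure[of A "variation \<mu>" "E - A"] A E by auto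
  qed
  then consider "emeasure (variation \<mu>) A = \<infinity>" | "emeasure (variation \<mu>) (E - A) = \<infinity>"
    using E(2) by (metis ennreal_add_eq_top infinity_ennreal_def)
  then show ?thesis
  proof cases
    case 1
    then show ?thesis using A muB by blast
  next
    case 2
    have "E - (E - A) = A" using A by auto
    moreover have "cmod (\<mu> A) > 1" using muA norm_ge_zero[of "\<mu> E"] by linarith
    ultimately show ?thesis using 2 A E by (intro bexI[of _ "E - A"]) auto
  qed
qed

text \<open>Repeated splitting would give a decreasing sequence whose successive differences are
  disjoint and have \<mu>-values of modulus above 1. By countable additivity the series of those
  values converges, which is absurd.\<close>

lemma finite_measure_variation:
  assumes cm: "complex_measure \<mu>"
  shows "finite_measure (variation \<mu>)"
proof (rule finite_measureI, rule ccontr)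
  let ?P = "\<lambda>E. E \<in> sets circle_borel \<and> emeasure (variation \<mu>) E = \<infinity>"
  assume "\<not> emeasure (variation \<mu>) (space (variation \<mu>)) \<noteq> \<infinity>"
  moreover have "unit_circle \<in> sets circle_borel"
    using sets.top[of circle_borel] by simp
  ultimately have "?P unit_circle" by simp
  moreover have "\<exists>B. ?P B \<and> (B \<subseteq> E \<and> cmod (\<mu> (E - B)) > 1)" if "?P E" for E
    using variation_infinite_split[OF cm, of E] that by blast
  ultimately obtain E where E: "\<And>n. ?P (E n)" "\<And>n. E (Suc n) \<subseteq> E n \<and> cmod (\<mu> (E n - E (Suc n))) > 1"
    using dependent_nat_choice[of "\<lambda>_. ?P" "\<lambda>_ E B. B \<subseteq> E \<and> cmod (\<mu> (E - B)) > 1"] by metis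
  have dec: "E n \<subseteq> E m" if "m \<le> n" for m n
    by (rule lift_Suc_antimono_le[OF _ that]) (use E(2) in blast)
  have "disjoint_family (\<lambda>n. E n - E (Suc n))"
    unfolding disjoint_family_on_def
  proof (intro ballI impI)
    fix m n :: nat assume "m \<noteq> n"
    then have "Suc m \<le> n \<or> Suc n \<le> m" by auto
    then show "(E m - E (Suc m)) \<inter> (E n - E (Suc n)) = {}"
      using dec[of "Suc m" n] dec[of "Suc n" m] by auto
  qed
  then have "(\<lambda>n. \<mu> (E n - E (Suc n))) sums \<mu> (\<Union>n. E n - E (Suc n))"
    using E(1) by (intro complex_measureD[OF cm]) auto
  then have "(\<lambda>n. \<mu> (E n - E (Suc n))) \<longlonglongrightarrow> 0"
    by (intro summable_LIMSEQ_zero sums_summable)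
  from LIMSEQ_D[OF this, of 1] obtain N where "\<forall>n\<ge>N. norm (\<mu> (E n - E (Suc n)) - 0) < 1"
    by auto
  then have "cmod (\<mu> (E N - E (Suc N))) < 1" by simp
  moreover have "cmod (\<mu> (E N - E (Suc N))) > 1" using E(2) by blast
  ultimately show False by simp
qed

section \<open>The polar decomposition of a complex measure\<close>

text \<open>Domination by M makes r + M a nonnegative finite measure, absolutely continuous with
  respect to M; its density minus 1 represents r. This avoids a Hahn decomposition.\<close>

lemma signed_Radon_Nikodym:
  fixes r :: "'a set \<Rightarrow> real"
  assumes "finite_measure M"
    and add: "\<And>A :: nat \<Rightarrow> 'a set. range A \<subseteq> sets M \<Longrightarrow> disjoint_family A \<Longrightarrow>
        (\<lambda>n. r (A n)) sums r (\<Union>n. A n)"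
    and le: "\<And>E. E \<in> sets M \<Longrightarrow> \<bar>r E\<bar> \<le> measure M E"
  shows "\<exists>g. integrable M g \<and> (\<forall>E\<in>sets M. r E = (LINT x:E|M. g x))"
proof -
  interpret finite_measure M by fact
  define N where "N = measure_of (space M) (sets M) (\<lambda>E. ennreal (r E + measure M E))"
  have nn: "0 \<le> r E + measure M E" if "E \<in> sets M" for E using le[OF that] by linarith
  have eN: "emeasure N E = ennreal (r E + measure M E)" if "E \<in> sets M" for E
    unfolding N_def
  proof (rule emeasure_measure_of_sigma[OF sets.sigma_algebra_axioms _ _ that])
    show "positive (sets M) (\<lambda>E. ennreal (r E + measure M E))"
      using le[of "{}"] by (simp add: positive_def)
    show "countably_additive (sets M) (\<lambda>E. ennreal (r E + measure M E))"
    proof (rule countably_additiveI)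
      fix A :: "nat \<Rightarrow> 'a set"
      assume A: "range A \<subseteq> sets M" "disjoint_family A"
      have "(\<lambda>n. r (A n) + measure M (A n)) sums (r (\<Union>n. A n) + measure M (\<Union>n. A n))"
        by (intro sums_add add finite_measure_UNION A)
      then show "(\<Sum>i. ennreal (r (A i) + measure M (A i))) = ennreal (r (\<Union>i. A i) + measure M (\<Union>i. A i))"
        using A nn by (intro suminf_ennreal_eq) auto
    qed
  qed
  have sN [simp]: "sets N = sets M" "space N = space M" by (simp_all add: N_def)
  have "absolutely_continuous M N"
    unfolding absolutely_continuous_def
  proof
    fix E assume "E \<in> null_sets M"
    then have "E \<in> sets M" "measure M E = 0" by (auto simp: null_sets_def measure_def)
    then show "E \<in> null_sets N" using le[of E] eN[of E] by (auto simp: null_sets_def)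
  qed
  moreover have "finite_measure N"
    by (rule finite_measureI) (simp add: eN)
  ultimately obtain f where f: "f \<in> borel_measurable M" "density M f = N"
    using Radon_Nikodym_finite_measure[of N] by auto
  have "(\<integral>\<^sup>+x. f x \<partial>M) = emeasure N (space M)"
    using f by (simp add: emeasure_density flip: f(2))
  then have "(\<integral>\<^sup>+x. f x \<partial>M) \<noteq> \<infinity>" by (simp add: eN)
  then have fin: "AE x in M. f x \<noteq> \<infinity>" by (rule nn_integral_PInf_AE[OF f(1)])
  define g where "g x = enn2real (f x)" for x
  have gf: "AE x in M. ennreal (g x) = f x"
    using fin by eventually_elim (simp add: g_def less_top)
  have mg: "g \<in> borel_measurable M" unfolding g_def using f(1) by measurable
  have "(\<integral>\<^sup>+x. ennreal (g x) \<partial>M) = (\<integral>\<^sup>+x. f x \<partial>M)" by (rule nn_integral_cong_AE[OF gf])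
  then have ig: "integrable M g"
    using \<open>(\<integral>\<^sup>+x. f x \<partial>M) \<noteq> \<infinity>\<close> mg by (intro integrableI_nonneg) (auto simp: g_def less_top)
  have main: "r E + measure M E = (LINT x:E|M. g x)" if E: "E \<in> sets M" for E
  proof -
    have iE: "set_integrable M E g"
      unfolding set_integrable_def using integrable_mult_indicator[OF E ig] .
    have "ennreal (r E + measure M E) = (\<integral>\<^sup>+x. f x * indicator E x \<partial>M)"
      using eN[OF E] f E by (metis emeasure_density)
    also have "\<dots> = (\<integral>\<^sup>+x. ennreal (indicator E x *\<^sub>R g x) \<partial>M)"
      using gf by (intro nn_integral_cong_AE) (auto elim!: eventually_mono simp: indicator_def)
    also have "\<dots> = ennreal (LINT x:E|M. g x)"
      unfolding set_lebesgue_integral_def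
      by (rule nn_integral_eq_integral[OF iE[unfolded set_integrable_def]]) (simp add: g_def)
    finally show ?thesis
      using nn[OF E] by (simp add: set_lebesgue_integral_def g_def integral_nonneg_AE)
  qed
  show ?thesis
  proof (intro exI conjI ballI)
    show "integrable M (\<lambda>x. g x - 1)" using ig by simp
    fix E assume E: "E \<in> sets M"
    have "(LINT x:E|M. g x - 1) = (LINT x:E|M. g x) - (LINT x:E|M. 1)"
      by (rule set_integral_diff(2))
        (use E integrable_mult_indicator[OF E ig] integrable_mult_indicator[OF E integrable_const[of "1::real"]] in \<open>simp_all add: set_integrable_def\<close>)
    also have "(LINT x:E|M. 1) = measure M E"
      using E by (simp add: set_lebesgue_integral_def)
    finally show "r E = (LINT x:E|M. g x - 1)" using main[OF E] by simp
  qed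
qed

text \<open>Densities of the real and imaginary parts combine to a density k. The bound |\<mu> E| <=
  |\<mu>|(E) forces |k| <= 1 almost everywhere, and the supremum over partitions forces the integral
  of |k| to be at least the total mass, so |k| = 1 almost everywhere.\<close>

lemma polar_decomposition:
  assumes cm: "complex_measure \<mu>"
  shows "\<exists>h. h \<in> borel_measurable (variation \<mu>) \<and> (\<forall>z. cmod (h z) = 1) \<and>
     (\<forall>E\<in>sets circle_borel. \<mu> E = (LINT z:E|variation \<mu>. h z))"
proof -
  let ?v = "variation \<mu>"
  interpret finite_measure ?v by (rule finite_measure_variation[OF cm])
  have le: "cmod (\<mu> E) \<le> measure ?v E" if "E \<in> sets circle_borel" for E
    using norm_le_variation[OF cm that] emeasure_eq_measure[of E] by simp
  have "\<exists>g. integrable ?v g \<and> (\<forall>E\<in>sets ?v. Re (\<mu> E) = (LINT x:E|?v. g x))"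
    by (rule signed_Radon_Nikodym[OF finite_measure_axioms])
      (use le in \<open>auto intro: sums_Re complex_measureD[OF cm] order_trans[OF abs_Re_le_cmod]\<close>)
  then obtain g1 where g1: "integrable ?v g1" "\<And>E. E \<in> sets circle_borel \<Longrightarrow> Re (\<mu> E) = (LINT x:E|?v. g1 x)"
    by auto
  have "\<exists>g. integrable ?v g \<and> (\<forall>E\<in>sets ?v. Im (\<mu> E) = (LINT x:E|?v. g x))"
    by (rule signed_Radon_Nikodym[OF finite_measure_axioms])
      (use le in \<open>auto intro: sums_Im complex_measureD[OF cm] order_trans[OF abs_Im_le_cmod]\<close>)
  then obtain g2 where g2: "integrable ?v g2" "\<And>E. E \<in> sets circle_borel \<Longrightarrow> Im (\<mu> E) = (LINT x:E|?v. g2 x)"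
    by auto
  define k where "k z = complex_of_real (g1 z) + \<i> * complex_of_real (g2 z)" for z
  have ik: "integrable ?v k"
    unfolding k_def using g1(1) g2(1)
    by (intro Bochner_Integration.integrable_add integrable_mult_right integrable_of_real)
  have ik_E: "integrable ?v (\<lambda>z. indicator E z *\<^sub>R k z)" if "E \<in> sets circle_borel" for E
    using that ik by (intro integrable_mult_indicator) auto
  have k: "\<mu> E = (LINT z:E|?v. k z)" if E: "E \<in> sets circle_borel" for E
  proof (rule complex_eqI)
    show "Re (\<mu> E) = Re (LINT z:E|?v. k z)"
      using g1(2)[OF E] unfolding set_lebesgue_integral_def
      by (subst integral_Re[OF ik_E[OF E], symmetric]) (simp add: k_def)
    show "Im (\<mu> E) = Im (LINT z:E|?v. k z)"
      using g2(2)[OF E] unfolding set_lebesgue_integral_def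
      by (subst integral_Im[OF ik_E[OF E], symmetric]) (simp add: k_def)
  qed
  have mk [measurable]: "k \<in> borel_measurable ?v" using ik by auto
  \<comment> \<open>On the set where Re (c k) exceeds |c|, the excess is positive, yet its integral
    is Re (c * \<mu> E) - |c| * |\<mu>|(E), which is at most 0.\<close>
  have half_plane: "AE z in ?v. Re (c * k z) \<le> cmod c" for c
  proof -
    let ?E = "{z\<in>space ?v. Re (c * k z) > cmod c}"
    let ?f = "\<lambda>z. indicator ?E z * (Re (c * k z) - cmod c)"
    have E: "?E \<in> sets circle_borel" using sets.sets_Collect measurable_sets
      by (subst sets_variation[of \<mu>, symmetric]) measurable
    have i1: "integrable ?v (\<lambda>z. indicator ?E z * Re (c * k z))"
      using integrable_Re[OF integrable_mult_right[OF ik_E[OF E], of c]] by (simp add: algebra_simps)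
    have i2: "integrable ?v (\<lambda>z. indicator ?E z * cmod c)"
      using integrable_mult_indicator[OF _ integrable_const[of "cmod c"], of ?E] E by simp
    have i3: "integrable ?v ?f" using Bochner_Integration.integrable_diff[OF i1 i2] by (simp add: algebra_simps)
    have "(\<integral>z. ?f z \<partial>?v) = (\<integral>z. indicator ?E z * Re (c * k z) \<partial>?v) - (\<integral>z. indicator ?E z * cmod c \<partial>?v)"
      using Bochner_Integration.integral_diff[OF i1 i2] by (simp add: algebra_simps)
    also have "(\<integral>z. indicator ?E z * Re (c * k z) \<partial>?v) = Re (c * \<mu> ?E)"
      unfolding k[OF E] set_lebesgue_integral_def
      by (subst Bochner_Integration.integral_mult_right[OF ik_E[OF E], symmetric],
          subst integral_Re[OF integrable_mult_right[OF ik_E[OF E]], symmetric]) (simp add: algebra_simps)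
    also have "(\<integral>z. indicator ?E z * cmod c \<partial>?v) = measure ?v ?E * cmod c"
    proof -
      have "?E \<inter> space ?v = ?E" by blast
      then show ?thesis
        using Bochner_Integration.integral_indicator[of ?v ?E]
        by (simp only: Bochner_Integration.integral_mult_left_zero)
    qed
    also have "Re (c * \<mu> ?E) \<le> cmod c * measure ?v ?E"
      using complex_Re_le_cmod[of "c * \<mu> ?E"] mult_left_mono[OF le[OF E], of "cmod c"]
      by (simp add: norm_mult)
    finally have "(\<integral>z. ?f z \<partial>?v) \<le> 0" by simp
    moreover have nn: "AE z in ?v. 0 \<le> ?f z" by (auto simp: indicator_def)
    ultimately have "(\<integral>z. ?f z \<partial>?v) = 0" using integral_nonneg_AE[OF nn] by simp
    then have "AE z in ?v. ?f z = 0" using integral_nonneg_eq_0_iff_AE[OF i3 nn] by blast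
    then show ?thesis using AE_space by eventually_elim (auto simp: indicator_def)
  qed
  \<comment> \<open>Countability allows the exceptional null sets for the different c to be united;
    density and continuity then give the inequality for all c.\<close>
  obtain D :: "complex set" where D: "countable D" "closure D = UNIV"
  proof -
    obtain D :: "complex set" where D: "countable D" "\<And>X. open X \<Longrightarrow> X \<noteq> {} \<Longrightarrow> \<exists>d\<in>D. d \<in> X"
      by (rule countable_dense_setE) blast
    have "x \<in> closure D" for x
    proof (rule ccontr)
      assume "x \<notin> closure D"
      then have "- closure D \<noteq> {}" by blast
      then obtain d where "d \<in> D" "d \<in> - closure D"
        using D(2)[of "- closure D"] by (metis closed_closure open_Compl)
      then show False using closure_subset by blast
    qed
    with D(1) that show ?thesis by blast
  qed
  have "AE z in ?v. \<forall>c\<in>D. Re (c * k z) \<le> cmod c"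
    using half_plane D(1) by (intro AE_ball_countable') auto
  then have up: "AE z in ?v. cmod (k z) \<le> 1"
  proof eventually_elim
    fix z assume *: "\<forall>c\<in>D. Re (c * k z) \<le> cmod c"
    have "closed {c. Re (c * k z) \<le> cmod c}" by (intro closed_Collect_le continuous_intros)
    then have "closure D \<subseteq> {c. Re (c * k z) \<le> cmod c}" using * by (intro closure_minimal) auto
    \<comment> \<open>The choice c = cnj (k z) yields |k z|^2 <= |k z|.\<close>
    then have "Re (cnj (k z) * k z) \<le> cmod (cnj (k z))" using D(2) by blast
    also have "Re (cnj (k z) * k z) = (cmod (k z))\<^sup>2" unfolding cmod_power2 by (simp add: power2_eq_square)
    finally have "cmod (k z) * cmod (k z) \<le> cmod (k z) * 1" by (simp add: power2_eq_square)
    then show "cmod (k z) \<le> 1"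
      by (cases "k z = 0") (auto simp: mult_le_cancel_left)
  qed
  have circ: "unit_circle \<in> sets circle_borel" using sets.top[of circle_borel] by simp
  \<comment> \<open>For any finite partition, the sum of the |\<mu> X| is at most the integral of
    |k| over the circle; the supremum of these sums is the total variation.\<close>
  have low: "measure ?v unit_circle \<le> (\<integral>z. cmod (k z) \<partial>?v)"
  proof -
    have "emeasure ?v unit_circle \<le> ennreal (\<integral>z. cmod (k z) \<partial>?v)"
      unfolding emeasure_variation[OF cm circ] partition_sums_def
    proof (rule SUP_least, clarify)
      fix P assume P: "finite P" "P \<subseteq> sets circle_borel" "partition_on unit_circle P"
      have i: "integrable ?v (\<lambda>z. indicator X z * cmod (k z))" if "X \<in> P" for X
        using integrable_mult_indicator[OF _ integrable_norm[OF ik], of X] P(2) that by auto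
      have "(\<Sum>X\<in>P. cmod (\<mu> X)) \<le> (\<Sum>X\<in>P. \<integral>z. indicator X z * cmod (k z) \<partial>?v)"
      proof (rule sum_mono)
        fix X assume "X \<in> P"
        then have "X \<in> sets circle_borel" using P by auto
        from k[OF this] show "cmod (\<mu> X) \<le> (\<integral>z. indicator X z * cmod (k z) \<partial>?v)"
          using integral_norm_bound[of ?v "\<lambda>z. indicator X z *\<^sub>R k z"]
          by (simp add: set_lebesgue_integral_def)
      qed
      also have "\<dots> = (\<integral>z. (\<Sum>X\<in>P. indicator X z * cmod (k z)) \<partial>?v)"
        by (rule Bochner_Integration.integral_sum[OF i, symmetric])
      also have "\<dots> = (\<integral>z. cmod (k z) \<partial>?v)"
      proof (rule Bochner_Integration.integral_cong[OF refl])
        fix z assume "z \<in> space ?v"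
        then have "z \<in> \<Union>P" using P(3) by (simp add: partition_on_def)
        then obtain X where X: "X \<in> P" "z \<in> X" by (rule UnionE)
        have "(\<Sum>X\<in>P. indicator X z :: real) = (\<Sum>Y\<in>{X}. indicator Y z)"
        proof (intro sum.mono_neutral_right ballI)
          fix Y assume Y: "Y \<in> P - {X}"
          then have "X \<inter> Y = {}" using X(1) P(3) by (intro disjointD[of P]) (auto simp: partition_on_def)
          then show "indicator Y z = (0::real)" using X(2) by (auto simp: indicator_def)
        qed (use X P in auto)
        then show "(\<Sum>X\<in>P. indicator X z * cmod (k z)) = cmod (k z)"
          using X by (simp flip: sum_distrib_right)
      qed
      finally show "(\<Sum>X\<in>P. ennreal (cmod (\<mu> X))) \<le> ennreal (\<integral>z. cmod (k z) \<partial>?v)"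
        by (simp add: ennreal_leI)
    qed
    then show ?thesis
      unfolding emeasure_eq_measure by (simp add: ennreal_le_iff integral_nonneg_AE)
  qed
  have ik1: "integrable ?v (\<lambda>z. 1 - cmod (k z))" using ik by simp
  have nn: "AE z in ?v. 0 \<le> 1 - cmod (k z)" using up by auto
  have "(\<integral>z. 1 - cmod (k z) \<partial>?v) = measure ?v unit_circle - (\<integral>z. cmod (k z) \<partial>?v)"
    using ik by simp
  then have "(\<integral>z. 1 - cmod (k z) \<partial>?v) = 0" using low integral_nonneg_AE[OF nn] by linarith
  then have k1: "AE z in ?v. cmod (k z) = 1"
    using integral_nonneg_eq_0_iff_AE[OF ik1 nn] by auto
  \<comment> \<open>The definition of \<open>polar_density\<close> asks for modulus 1 at every
    point, so k is altered on a null set.\<close>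
  define h where "h z = (if cmod (k z) = 1 then k z else 1)" for z
  have mh: "h \<in> borel_measurable ?v" unfolding h_def by measurable
  show ?thesis
  proof (intro exI conjI allI ballI)
    show "h \<in> borel_measurable ?v" by (rule mh)
    show "cmod (h z) = 1" for z by (simp add: h_def)
    fix E assume E: "E \<in> sets circle_borel"
    have "(LINT z:E|?v. k z) = (LINT z:E|?v. h z)"
      unfolding set_lebesgue_integral_def
    proof (rule integral_cong_AE)
      show "AE z in ?v. indicat_real E z *\<^sub>R k z = indicat_real E z *\<^sub>R h z"
        using k1 by eventually_elim (simp add: h_def)
    qed (use E mh in measurable)
    with k[OF E] show "\<mu> E = (LINT z:E|?v. h z)" by simp
  qed
qed

lemma polar_density:
  assumes "complex_measure \<mu>"
  shows "polar_density \<mu> \<in> borel_measurable (variation \<mu>)" "cmod (polar_density \<mu> z) = 1"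
  using someI_ex[OF polar_decomposition[OF assms]] unfolding polar_density_def by blast+

lemma norm_complex_integral_le:
  assumes "complex_measure \<mu>"
  shows "cmod (complex_integral \<mu> f) \<le> (\<integral>z. cmod (f z) \<partial>variation \<mu>)"
  using integral_norm_bound[of "variation \<mu>" "\<lambda>z. f z * polar_density \<mu> z"] polar_density(2)[OF assms]
  by (simp add: complex_integral_def norm_mult)

section \<open>Model spaces and the embedding operator\<close>

lemma sets_circle_measure [simp, measurable_cong]: "sets circle_measure = sets circle_borel"
  by (simp add: circle_measure_def)

lemma space_circle_measure [simp]: "space circle_measure = unit_circle"
  by (simp add: circle_measure_def)

lemma cis_measurable [measurable]: "cis \<in> borel \<rightarrow>\<^sub>M circle_borel"
  unfolding circle_borel_def
  by (intro measurable_restrict_space2 borel_measurable_continuous_onI) (auto intro!: continuous_intros)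

lemma cis_measurable_uniform [measurable]:
  "cis \<in> uniform_measure lborel {0..<2 * pi} \<rightarrow>\<^sub>M circle_borel"
  using cis_measurable by simp

lemma emeasure_circle_measure_space: "emeasure circle_measure unit_circle = 1"
proof -
  have "cis -` unit_circle = UNIV" by auto
  then show ?thesis
    using sets.top[of circle_borel]
    by (simp add: circle_measure_def emeasure_distr ennreal_divide_self[of "ennreal (2 * pi)"])
qed

lemma continuous_on_circle_measurable:
  "continuous_on unit_circle F \<Longrightarrow> F \<in> borel_measurable circle_borel"
  unfolding circle_borel_def by (rule borel_measurable_continuous_on_restrict)

lemma integrable_continuous_circle:
  fixes F :: "complex \<Rightarrow> 'a::{banach, second_countable_topology}"
  assumes "finite_measure \<nu>" "sets \<nu> = sets circle_borel" "continuous_on unit_circle F"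
  shows "integrable \<nu> F"
proof -
  have sp: "space \<nu> = unit_circle" using sets_eq_imp_space_eq[OF assms(2)] by simp
  have "compact (F ` unit_circle)" by (intro compact_continuous_image assms(3)) auto
  then obtain B where "\<And>z. z \<in> unit_circle \<Longrightarrow> norm (F z) \<le> B"
    using compact_imp_bounded bounded_iff by (metis imageI)
  then show ?thesis
    using continuous_on_circle_measurable[OF assms(3)] measurable_cong_sets[OF assms(2) refl] sp
    by (intro finite_measure.integrable_const_bound[OF assms(1), of _ B]) (auto intro!: AE_I2)
qed

lemma finite_measure_circle_measure: "finite_measure circle_measure"
  by (rule finite_measureI) (simp add: emeasure_circle_measure_space)

lemma continuous_on_circle_L2_fun:
  assumes "finite_measure \<nu>" "sets \<nu> = sets circle_borel" "continuous_on unit_circle F"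
  shows "F \<in> L2_fun \<nu>"
  using continuous_on_circle_measurable[OF assms(3)] measurable_cong_sets[OF assms(2) refl]
    integrable_continuous_circle[OF assms(1,2) continuous_on_power[OF continuous_on_norm[OF assms(3)]]]
  by (auto simp: L2_fun_def)

section \<open>Hardy functions on the disc and their boundary values\<close>

lemma holomorphic_dilate_continuous:
  assumes "F holomorphic_on unit_disc" "0 \<le> r" "r < 1"
  shows "continuous_on unit_circle (\<lambda>z. F (of_real r * z))"
  by (rule continuous_on_compose2[OF holomorphic_on_imp_continuous_on[OF assms(1)]])
    (use assms(2,3) in \<open>auto simp: norm_mult intro!: continuous_intros\<close>)

lemma hardy2_disc_dilate_L2_fun:
  assumes "F holomorphic_on unit_disc" "0 \<le> r" "r < 1"
  shows "(\<lambda>z. F (of_real r * z)) \<in> L2_fun circle_measure"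
  by (rule continuous_on_circle_L2_fun[OF finite_measure_circle_measure sets_circle_measure
        holomorphic_dilate_continuous[OF assms]])

text \<open>Bounding norms instead of squared means lets closure under sums follow from the triangle
  inequality.\<close>

lemma hardy2_disc_iff:
  "F \<in> hardy2_disc \<longleftrightarrow> F holomorphic_on unit_disc \<and>
     (\<exists>B. \<forall>r\<in>{0..<1}. L2_norm circle_measure (\<lambda>z. F (of_real r * z)) \<le> B)" (is "_ \<longleftrightarrow> ?R")
proof
  assume "F \<in> hardy2_disc"
  then obtain B where "F holomorphic_on unit_disc"
    "\<And>r. r \<in> {0..<1} \<Longrightarrow> (\<integral>z. (cmod (F (of_real r * z)))\<^sup>2 \<partial>circle_measure) \<le> B"
    unfolding hardy2_disc_def by blast
  then show ?R unfolding L2_norm_def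
    by (intro conjI exI[of _ "sqrt B"] ballI real_sqrt_le_mono)
next
  assume ?R
  then obtain B where "F holomorphic_on unit_disc"
    and B: "\<And>r. r \<in> {0..<1} \<Longrightarrow> L2_norm circle_measure (\<lambda>z. F (of_real r * z)) \<le> B"
    by blast
  then show "F \<in> hardy2_disc"
    using power_mono[OF B, of _ 2] unfolding hardy2_disc_def L2_norm_sq[symmetric]
    by (auto intro!: exI[of _ "B\<^sup>2"])
qed

lemma hardy2_disc_add:
  assumes "F \<in> hardy2_disc" "G \<in> hardy2_disc"
  shows "(\<lambda>z. F z + G z) \<in> hardy2_disc"
proof -
  obtain B C where FG: "F holomorphic_on unit_disc" "G holomorphic_on unit_disc"
    and B: "\<And>r. r \<in> {0..<1} \<Longrightarrow> L2_norm circle_measure (\<lambda>z. F (of_real r * z)) \<le> B"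
    and C: "\<And>r. r \<in> {0..<1} \<Longrightarrow> L2_norm circle_measure (\<lambda>z. G (of_real r * z)) \<le> C"
    using assms unfolding hardy2_disc_iff by blast
  have "L2_norm circle_measure (\<lambda>z. F (of_real r * z) + G (of_real r * z)) \<le> B + C" if "r \<in> {0..<1}" for r
    using that B[OF that] C[OF that]
      L2_norm_triangle[OF hardy2_disc_dilate_L2_fun[OF FG(1)] hardy2_disc_dilate_L2_fun[OF FG(2)], of r r]
    by simp
  then show ?thesis
    unfolding hardy2_disc_iff using FG by (intro conjI exI[of _ "B + C"] ballI holomorphic_intros)
qed

lemma hardy2_disc_scale:
  assumes "F \<in> hardy2_disc"
  shows "(\<lambda>z. c * F z) \<in> hardy2_disc"
proof -
  obtain B where F: "F holomorphic_on unit_disc"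
    and B: "\<And>r. r \<in> {0..<1} \<Longrightarrow> L2_norm circle_measure (\<lambda>z. F (of_real r * z)) \<le> B"
    using assms unfolding hardy2_disc_iff by blast
  have "L2_norm circle_measure (\<lambda>z. c * F (of_real r * z)) \<le> cmod c * B" if "r \<in> {0..<1}" for r
    using mult_left_mono[OF B[OF that], of "cmod c"] by (simp add: L2_norm_scale)
  then show ?thesis
    unfolding hardy2_disc_iff using F by (intro conjI exI[of _ "cmod c * B"] ballI holomorphic_intros)
qed

lemma H2_L2_fun: "f \<in> H2 \<Longrightarrow> f \<in> L2_fun circle_measure"
  by (simp add: H2_def)

lemma H2_add:
  assumes "f \<in> H2" "g \<in> H2"
  shows "(\<lambda>z. f z + g z) \<in> H2"
proof -
  obtain F G where F: "F \<in> hardy2_disc" "radial_boundary_function F f"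
    and G: "G \<in> hardy2_disc" "radial_boundary_function G g"
    using assms by (auto simp: H2_def)
  have "radial_boundary_function (\<lambda>z. F z + G z) (\<lambda>z. f z + g z)"
    using F(2) G(2) unfolding radial_boundary_function_def
    by eventually_elim (rule tendsto_add)
  with hardy2_disc_add[OF F(1) G(1)] show ?thesis
    using assms by (auto simp: H2_def intro: L2_fun_add)
qed

lemma H2_scale:
  assumes "f \<in> H2"
  shows "(\<lambda>z. c * f z) \<in> H2"
proof -
  obtain F where F: "F \<in> hardy2_disc" "radial_boundary_function F f"
    using assms by (auto simp: H2_def)
  have "radial_boundary_function (\<lambda>z. c * F z) (\<lambda>z. c * f z)"
    using F(2) unfolding radial_boundary_function_def
    by eventually_elim (rule tendsto_mult_left)
  with hardy2_disc_scale[OF F(1)] show ?thesis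
    using assms by (auto simp: H2_def intro: L2_fun_scale)
qed

lemma H2_zero: "(\<lambda>z. 0) \<in> H2"
proof -
  have "(\<lambda>z. 0) \<in> hardy2_disc" by (auto simp: hardy2_disc_def)
  then show ?thesis
    by (auto simp: H2_def L2_fun_zero radial_boundary_function_def intro!: bexI[of _ "\<lambda>z. 0"])
qed

section \<open>The model space as a linear subspace of L2\<close>

lemma inner_function_mult_L2_fun:
  assumes "inner_function \<Theta>" "g \<in> L2_fun circle_measure"
  shows "(\<lambda>z. \<Theta> z * g z) \<in> L2_fun circle_measure"
proof -
  have m [measurable]: "\<Theta> \<in> borel_measurable circle_measure"
    using assms(1) by (simp add: inner_function_def Hinf_def)
  have mg [measurable]: "g \<in> borel_measurable circle_measure"
    using assms(2) by (rule L2_funD)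
  have "AE z in circle_measure. cmod (\<Theta> z) = 1" using assms(1) by (simp add: inner_function_def)
  then have "AE z in circle_measure. (cmod (\<Theta> z * g z))\<^sup>2 = (cmod (g z))\<^sup>2"
    by eventually_elim (simp add: norm_mult)
  then have "integrable circle_measure (\<lambda>z. (cmod (\<Theta> z * g z))\<^sup>2)"
    using L2_funD(2)[OF assms(2)] by (subst integrable_cong_AE[of _ _ "\<lambda>z. (cmod (g z))\<^sup>2"]) auto
  then show ?thesis by (simp add: L2_fun_def)
qed

lemma model_space_L2_fun: "f \<in> model_space \<Theta> \<Longrightarrow> f \<in> L2_fun circle_measure"
  by (simp add: model_space_def H2_L2_fun)

lemma model_space_add:
  assumes "inner_function \<Theta>" "f \<in> model_space \<Theta>" "g \<in> model_space \<Theta>"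
  shows "(\<lambda>z. f z + g z) \<in> model_space \<Theta>"
proof -
  have "L2_inner circle_measure (\<lambda>z. f z + g z) (\<lambda>z. \<Theta> z * h z) = 0" if "h \<in> H2" for h
    using assms that inner_function_mult_L2_fun[OF assms(1) H2_L2_fun[OF that]]
    by (subst L2_inner_add_left) (auto simp: model_space_def H2_L2_fun)
  then show ?thesis using assms by (simp add: model_space_def H2_add)
qed

lemma model_space_scale:
  assumes "f \<in> model_space \<Theta>"
  shows "(\<lambda>z. c * f z) \<in> model_space \<Theta>"
  using assms by (simp add: model_space_def H2_scale L2_inner_scale_left)

lemma model_space_diff:
  assumes "inner_function \<Theta>" "f \<in> model_space \<Theta>" "g \<in> model_space \<Theta>"
  shows "(\<lambda>z. f z - g z) \<in> model_space \<Theta>"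
  using model_space_add[OF assms(1,2) model_space_scale[OF assms(3), of "-1"]] by simp

lemma model_space_zero: "(\<lambda>z. 0) \<in> model_space \<Theta>"
  by (simp add: model_space_def H2_zero L2_inner_def)

section \<open>Continuous extensions and the bounded extension of their graph\<close>

lemma continuous_extension_L2_fun:
  assumes "finite_measure \<nu>" "sets \<nu> = sets circle_borel" "continuous_extension f F"
  shows "F \<in> L2_fun \<nu>"
proof (rule continuous_on_circle_L2_fun[OF assms(1,2)])
  have "continuous_on (cball 0 1) F" using assms(3) unfolding continuous_extension_def by (rule conjunct1)
  then show "continuous_on unit_circle F" by (rule continuous_on_subset) (rule sphere_cball)
qed

lemma continuous_extension_add:
  assumes "continuous_extension f F" "continuous_extension g G"
  shows "continuous_extension (\<lambda>z. f z + g z) (\<lambda>z. F z + G z)"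
  unfolding continuous_extension_def
proof (intro conjI)
  show "eq_ae circle_measure (\<lambda>z. F z + G z) (\<lambda>z. f z + g z)"
  proof -
    have "AE z in circle_measure. F z = f z" "AE z in circle_measure. G z = g z"
      using assms unfolding continuous_extension_def eq_ae_def by blast+
    then show ?thesis unfolding eq_ae_def by eventually_elim simp
  qed
  show "continuous_on (cball 0 1) (\<lambda>z. F z + G z)"
    using assms unfolding continuous_extension_def by (intro continuous_on_add) blast+
  show "(\<lambda>z. F z + G z) holomorphic_on unit_disc"
    using assms unfolding continuous_extension_def by (intro holomorphic_on_add) blast+
qed

lemma continuous_extension_scale:
  assumes "continuous_extension f F"
  shows "continuous_extension (\<lambda>z. c * f z) (\<lambda>z. c * F z)"
  unfolding continuous_extension_def
proof (intro conjI)
  show "eq_ae circle_measure (\<lambda>z. c * F z) (\<lambda>z. c * f z)"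
  proof -
    have "AE z in circle_measure. F z = f z"
      using assms unfolding continuous_extension_def eq_ae_def by blast
    then show ?thesis unfolding eq_ae_def by eventually_elim simp
  qed
  show "continuous_on (cball 0 1) (\<lambda>z. c * F z)"
    using assms unfolding continuous_extension_def by (intro continuous_on_mult_left) blast
  show "(\<lambda>z. c * F z) holomorphic_on unit_disc"
    using assms unfolding continuous_extension_def by (intro holomorphic_on_mult holomorphic_on_const) blast
qed

text \<open>The datum is a linear relation and not a map, because a continuous extension of f is
  fixed only on the closed disc, so one f is paired with many F. The bound makes all of them agree
  almost everywhere.\<close>

lemma L2_bounded_relation_extends:
  fixes G :: "((complex \<Rightarrow> complex) \<times> (complex \<Rightarrow> complex)) set"
  assumes sub: "G \<subseteq> L2_fun \<nu> \<times> L2_fun \<nu>'" and zero: "((\<lambda>z. 0), (\<lambda>z. 0)) \<in> G"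
    and add: "\<And>f F g H. (f, F) \<in> G \<Longrightarrow> (g, H) \<in> G \<Longrightarrow> ((\<lambda>z. f z + g z), (\<lambda>z. F z + H z)) \<in> G"
    and scale: "\<And>c f F. (f, F) \<in> G \<Longrightarrow> ((\<lambda>z. c * f z), (\<lambda>z. c * F z)) \<in> G"
    and bound: "\<And>f F. (f, F) \<in> G \<Longrightarrow> L2_norm \<nu>' F \<le> C * L2_norm \<nu> f" and C: "C \<ge> 0"
  shows "\<exists>J. L2_bounded_linear \<nu> (L2_fun \<nu>) \<nu>' (L2_fun \<nu>') J \<and> (\<forall>(f, F)\<in>G. eq_ae \<nu>' (J f) F)"
proof -
  have GL: "f \<in> L2_fun \<nu>" "F \<in> L2_fun \<nu>'" if "(f, F) \<in> G" for f F using that sub by auto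
  define D where "D = fst ` G"
  \<comment> \<open>The graph of the composition of the orthogonal projection onto the closure of \<open>D\<close> with the
    continuous extension of \<open>G\<close> to that closure.\<close>
  define R where "R f g \<longleftrightarrow> f \<in> L2_fun \<nu> \<and> g \<in> L2_fun \<nu>' \<and> (\<exists>p d e. p \<in> L2_fun \<nu> \<and>
     (\<forall>n. (d n, e n) \<in> G) \<and> (\<lambda>n. L2_norm \<nu> (\<lambda>z. d n z - p z)) \<longlonglongrightarrow> 0 \<and>
     (\<lambda>n. L2_norm \<nu>' (\<lambda>z. e n z - g z)) \<longlonglongrightarrow> 0 \<and>
     (\<forall>h\<in>D. L2_inner \<nu> (\<lambda>z. f z - p z) h = 0))" for f g :: "complex \<Rightarrow> complex"
  have lim_add: "(\<lambda>n. L2_norm M (\<lambda>z. (a n z + a' n z) - (b z + b' z))) \<longlonglongrightarrow> 0"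
    if "\<And>n. a n \<in> L2_fun M" "\<And>n. a' n \<in> L2_fun M" "b \<in> L2_fun M" "b' \<in> L2_fun M"
      and lim: "(\<lambda>n. L2_norm M (\<lambda>z. a n z - b z)) \<longlonglongrightarrow> 0" "(\<lambda>n. L2_norm M (\<lambda>z. a' n z - b' z)) \<longlonglongrightarrow> 0"
    for a a' :: "nat \<Rightarrow> complex \<Rightarrow> complex" and b b' :: "complex \<Rightarrow> complex" and M
  proof (rule tendsto_sandwich[OF _ _ tendsto_const])
    show "(\<lambda>n. L2_norm M (\<lambda>z. a n z - b z) + L2_norm M (\<lambda>z. a' n z - b' z)) \<longlonglongrightarrow> 0"
      using tendsto_add[OF lim] by simp
    have "L2_norm M (\<lambda>z. (a n z + a' n z) - (b z + b' z))
        \<le> L2_norm M (\<lambda>z. a n z - b z) + L2_norm M (\<lambda>z. a' n z - b' z)" for n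
      using L2_norm_triangle[OF L2_fun_diff[OF that(1,3)] L2_fun_diff[OF that(2,4)], of n n]
      by (simp add: algebra_simps)
    then show "\<forall>\<^sub>F n in sequentially. L2_norm M (\<lambda>z. (a n z + a' n z) - (b z + b' z))
        \<le> L2_norm M (\<lambda>z. a n z - b z) + L2_norm M (\<lambda>z. a' n z - b' z)" by simp
  qed auto
  have lim_scale: "(\<lambda>n. L2_norm M (\<lambda>z. c * a n z - c * b z)) \<longlonglongrightarrow> 0"
    if "(\<lambda>n. L2_norm M (\<lambda>z. a n z - b z)) \<longlonglongrightarrow> 0"
    for a :: "nat \<Rightarrow> complex \<Rightarrow> complex" and b M c
    using tendsto_mult_right_zero[OF that, of "cmod c"]
    by (simp add: L2_norm_scale flip: right_diff_distrib)
  have DL: "h \<in> L2_fun \<nu>" if "h \<in> D" for h using that GL by (auto simp: D_def)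
  have R_add: "R (\<lambda>z. f z + f' z) (\<lambda>z. g z + g' z)" if fg: "R f g" "R f' g'" for f g f' g'
  proof -
    from fg(1) obtain p d e where 1: "f \<in> L2_fun \<nu>" "g \<in> L2_fun \<nu>'" "p \<in> L2_fun \<nu>" "\<And>n. (d n, e n) \<in> G"
      "(\<lambda>n. L2_norm \<nu> (\<lambda>z. d n z - p z)) \<longlonglongrightarrow> 0" "(\<lambda>n. L2_norm \<nu>' (\<lambda>z. e n z - g z)) \<longlonglongrightarrow> 0"
      "\<And>h. h \<in> D \<Longrightarrow> L2_inner \<nu> (\<lambda>z. f z - p z) h = 0" unfolding R_def by blast
    from fg(2) obtain p' d' e' where 2: "f' \<in> L2_fun \<nu>" "g' \<in> L2_fun \<nu>'" "p' \<in> L2_fun \<nu>" "\<And>n. (d' n, e' n) \<in> G"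
      "(\<lambda>n. L2_norm \<nu> (\<lambda>z. d' n z - p' z)) \<longlonglongrightarrow> 0" "(\<lambda>n. L2_norm \<nu>' (\<lambda>z. e' n z - g' z)) \<longlonglongrightarrow> 0"
      "\<And>h. h \<in> D \<Longrightarrow> L2_inner \<nu> (\<lambda>z. f' z - p' z) h = 0" unfolding R_def by blast
    have "L2_inner \<nu> (\<lambda>z. (f z + f' z) - (p z + p' z)) h = 0" if "h \<in> D" for h
      using L2_inner_add_left[OF L2_fun_diff[OF 1(1,3)] L2_fun_diff[OF 2(1,3)] DL[OF that]]
        1(7)[OF that] 2(7)[OF that] by (simp add: algebra_simps)
    with 1 2 show ?thesis unfolding R_def
      by (intro conjI exI[of _ "\<lambda>z. p z + p' z"] exI[of _ "\<lambda>n z. d n z + d' n z"]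
          exI[of _ "\<lambda>n z. e n z + e' n z"] lim_add L2_fun_add allI add ballI) (auto intro: GL)
  qed
  have R_scale: "R (\<lambda>z. c * f z) (\<lambda>z. c * g z)" if fg: "R f g" for f g c
  proof -
    from fg obtain p d e where 1: "f \<in> L2_fun \<nu>" "g \<in> L2_fun \<nu>'" "p \<in> L2_fun \<nu>" "\<And>n. (d n, e n) \<in> G"
      "(\<lambda>n. L2_norm \<nu> (\<lambda>z. d n z - p z)) \<longlonglongrightarrow> 0" "(\<lambda>n. L2_norm \<nu>' (\<lambda>z. e n z - g z)) \<longlonglongrightarrow> 0"
      "\<And>h. h \<in> D \<Longrightarrow> L2_inner \<nu> (\<lambda>z. f z - p z) h = 0" unfolding R_def by blast
    have "L2_inner \<nu> (\<lambda>z. c * f z - c * p z) h = 0" if "h \<in> D" for h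
      using 1(7)[OF that] L2_inner_scale_left[of \<nu> c "\<lambda>z. f z - p z" h] by (simp add: right_diff_distrib)
    with 1 show ?thesis unfolding R_def
      by (intro conjI exI[of _ "\<lambda>z. c * p z"] exI[of _ "\<lambda>n z. c * d n z"]
          exI[of _ "\<lambda>n z. c * e n z"] lim_scale L2_fun_scale allI scale ballI) auto
  qed
  \<comment> \<open>Since f - p is orthogonal to D, <p, d n> = <f, d n>. Hence the squared norm of d
    n is at most (norm f + norm (d n - p)) * norm (d n); after division, the bound on G gives the
    claim in the limit e n -> g.\<close>
  have R_bound: "L2_norm \<nu>' g \<le> C * L2_norm \<nu> f" if fg: "R f g" for f g
  proof -
    from fg obtain p d e where 1: "f \<in> L2_fun \<nu>" "g \<in> L2_fun \<nu>'" "p \<in> L2_fun \<nu>" "\<And>n. (d n, e n) \<in> G"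
      "(\<lambda>n. L2_norm \<nu> (\<lambda>z. d n z - p z)) \<longlonglongrightarrow> 0" "(\<lambda>n. L2_norm \<nu>' (\<lambda>z. e n z - g z)) \<longlonglongrightarrow> 0"
      "\<And>h. h \<in> D \<Longrightarrow> L2_inner \<nu> (\<lambda>z. f z - p z) h = 0" unfolding R_def by blast
    have dD: "d n \<in> D" for n using 1(4)[of n] unfolding D_def by force
    have "L2_norm \<nu> (d n) \<le> L2_norm \<nu> f + L2_norm \<nu> (\<lambda>z. d n z - p z)" for n
    proof -
      have "L2_inner \<nu> p (d n) = L2_inner \<nu> f (d n)"
        using 1(7)[OF dD[of n]] L2_inner_diff_left[OF 1(1,3) DL[OF dD[of n]]] by simp
      then have "of_real ((L2_norm \<nu> (d n))\<^sup>2) = L2_inner \<nu> f (d n) + L2_inner \<nu> (\<lambda>z. d n z - p z) (d n)"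
        using L2_inner_diff_left[OF DL[OF dD[of n]] 1(3) DL[OF dD[of n]]] by (simp add: L2_inner_self)
      then have "(L2_norm \<nu> (d n))\<^sup>2 \<le> cmod (L2_inner \<nu> f (d n)) + cmod (L2_inner \<nu> (\<lambda>z. d n z - p z) (d n))"
        by (metis norm_of_real abs_power2 norm_triangle_ineq abs_of_nonneg zero_le_power2)
      also have "\<dots> \<le> L2_norm \<nu> f * L2_norm \<nu> (d n) + L2_norm \<nu> (\<lambda>z. d n z - p z) * L2_norm \<nu> (d n)"
        by (intro add_mono L2_Cauchy_Schwarz L2_fun_diff 1 DL dD)
      finally have *: "L2_norm \<nu> (d n) * L2_norm \<nu> (d n) \<le> (L2_norm \<nu> f + L2_norm \<nu> (\<lambda>z. d n z - p z)) * L2_norm \<nu> (d n)"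
        by (simp add: power2_eq_square algebra_simps)
      show ?thesis
      proof (cases "L2_norm \<nu> (d n) = 0")
        case False
        then have "L2_norm \<nu> (d n) > 0" using L2_norm_nonneg[of \<nu> "d n"] by linarith
        with * show ?thesis by (rule mult_right_le_imp_le)
      qed simp
    qed
    then have le: "L2_norm \<nu>' (e n) \<le> C * (L2_norm \<nu> f + L2_norm \<nu> (\<lambda>z. d n z - p z))" for n
      using bound[OF 1(4)[of n]] C by (meson mult_left_mono order_trans)
    have "L2_norm \<nu>' g \<le> C * (L2_norm \<nu> f + 0)"
    proof (rule LIMSEQ_le)
      show "(\<lambda>n. L2_norm \<nu>' (e n)) \<longlonglongrightarrow> L2_norm \<nu>' g"
        by (rule L2_norm_tendsto[OF GL(2)[OF 1(4)] 1(2,6)])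
      show "(\<lambda>n. C * (L2_norm \<nu> f + L2_norm \<nu> (\<lambda>z. d n z - p z))) \<longlonglongrightarrow> C * (L2_norm \<nu> f + 0)"
        by (intro tendsto_intros 1)
    qed (use le in blast)
    then show ?thesis by simp
  qed
  have R_total: "\<exists>g. R f g" if f: "f \<in> L2_fun \<nu>" for f
  proof -
    obtain p d where p: "p \<in> L2_fun \<nu>" "\<And>n. d n \<in> D" "(\<lambda>n. L2_norm \<nu> (\<lambda>z. d n z - p z)) \<longlonglongrightarrow> 0"
      "\<And>e. e \<in> D \<Longrightarrow> L2_inner \<nu> (\<lambda>z. f z - p z) e = 0"
    proof (rule L2_projection[of D \<nu> f])
      show "D \<subseteq> L2_fun \<nu>" using DL by blast
      show "D \<noteq> {}" using zero by (auto simp: D_def)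
      show "(\<lambda>z. a z + b z) \<in> D" if "a \<in> D" "b \<in> D" for a b
        using that add unfolding D_def by force
      show "(\<lambda>z. c * a z) \<in> D" if "a \<in> D" for c a
        using that scale unfolding D_def by force
    qed (use f in auto)
    have "\<exists>e. \<forall>n. (d n, e n) \<in> G"
    proof (intro choice allI)
      fix n show "\<exists>e. (d n, e) \<in> G" using p(2)[of n] by (auto simp: D_def)
    qed
    then obtain e where e: "\<And>n. (d n, e n) \<in> G" by blast
    have de: "L2_norm \<nu>' (\<lambda>z. e m z - e n z) \<le> C * L2_norm \<nu> (\<lambda>z. d m z - d n z)" for m n
      using bound[OF add[OF e[of m] scale[OF e[of n], of "-1"]]] by simp
    obtain g where g: "g \<in> L2_fun \<nu>'" "(\<lambda>n. L2_norm \<nu>' (\<lambda>z. e n z - g z)) \<longlonglongrightarrow> 0"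
    proof (rule L2_complete[OF GL(2)[OF e]])
      fix \<epsilon> :: real assume "\<epsilon> > 0"
      \<comment> \<open>C + 1 instead of C, as C may be 0.\<close>
      then have "\<epsilon> / (C + 1) > 0" using C by simp
      from L2_limit_imp_Cauchy[OF GL(1)[OF e] p(1,3) this]
      obtain N where N: "\<And>m n. m \<ge> N \<Longrightarrow> n \<ge> N \<Longrightarrow> L2_norm \<nu> (\<lambda>z. d m z - d n z) \<le> \<epsilon> / (C + 1)"
        by blast
      have "L2_norm \<nu>' (\<lambda>z. e m z - e n z) \<le> \<epsilon>" if "m \<ge> N" "n \<ge> N" for m n
      proof -
        have "C * L2_norm \<nu> (\<lambda>z. d m z - d n z) \<le> C * (\<epsilon> / (C + 1))"
          using N[OF that] C by (rule mult_left_mono)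
        also have "\<dots> \<le> \<epsilon>" using C \<open>\<epsilon> > 0\<close> by (simp add: field_simps)
        finally show ?thesis using de[of m n] by linarith
      qed
      then show "\<exists>N. \<forall>m\<ge>N. \<forall>n\<ge>N. L2_norm \<nu>' (\<lambda>z. e m z - e n z) \<le> \<epsilon>" by blast
    qed
    show ?thesis unfolding R_def using f g p e by blast
  qed
  \<comment> \<open>By linearity of R the difference g - g' is related to f - f = 0, and the bound
    gives it norm 0.\<close>
  have R_unique: "eq_ae \<nu>' g g'" if "R f g" "R f g'" for f g g'
  proof (rule L2_norm_diff_eq_0)
    show "g \<in> L2_fun \<nu>'" "g' \<in> L2_fun \<nu>'" using that by (auto simp: R_def)
    have "R (\<lambda>z. f z + (-1) * f z) (\<lambda>z. g z + (-1) * g' z)"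
      by (intro R_add R_scale that)
    from R_bound[OF this] show "L2_norm \<nu>' (\<lambda>z. g z - g' z) = 0"
      using L2_norm_nonneg[of \<nu>' "\<lambda>z. g z - g' z"] by (simp add: L2_norm_def[of \<nu>])
  qed
  have R_G: "R f F" if "(f, F) \<in> G" for f F
    unfolding R_def using that GL[OF that]
    by (intro conjI exI[of _ f] exI[of _ "\<lambda>_. f"] exI[of _ "\<lambda>_. F"]) (auto simp: L2_norm_def L2_inner_def)
  define J where "J f = (SOME g. R f g)" for f
  have J: "R f (J f)" if "f \<in> L2_fun \<nu>" for f
    unfolding J_def using someI_ex[OF R_total[OF that]] .
  show ?thesis
  proof (intro exI[of _ J] conjI)
    show "\<forall>(f, F)\<in>G. eq_ae \<nu>' (J f) F"
      using R_unique J R_G GL by blast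
    show "L2_bounded_linear \<nu> (L2_fun \<nu>) \<nu>' (L2_fun \<nu>') J"
      unfolding L2_bounded_linear_def
    proof (intro conjI ballI allI exI[of _ C])
      fix f g c assume fg: "f \<in> L2_fun \<nu>" "g \<in> L2_fun \<nu>"
      show "eq_ae \<nu>' (J (\<lambda>z. f z + g z)) (\<lambda>z. J f z + J g z)"
        by (rule R_unique[OF J R_add[OF J J]]) (intro L2_fun_add fg)+
    next
      fix f c assume f: "f \<in> L2_fun \<nu>"
      show "J f \<in> L2_fun \<nu>'" using J[OF f] by (simp add: R_def)
      show "eq_ae \<nu>' (J (\<lambda>z. c * f z)) (\<lambda>z. c * J f z)"
        by (rule R_unique[OF J R_scale[OF J]]) (intro L2_fun_scale f)+
      show "L2_norm \<nu>' (J f) \<le> C * L2_norm \<nu> f" by (rule R_bound[OF J[OF f]])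
    qed
  qed
qed

lemma L2_bounded_linear_subset:
  assumes "L2_bounded_linear \<nu> V \<nu>' W T" "V' \<subseteq> V"
  shows "L2_bounded_linear \<nu> V' \<nu>' W T"
proof -
  obtain C where "\<And>f. f \<in> V \<Longrightarrow> L2_norm \<nu>' (T f) \<le> C * L2_norm \<nu> f"
    using assms(1) unfolding L2_bounded_linear_def by blast
  then have "\<exists>C. \<forall>f\<in>V'. L2_norm \<nu>' (T f) \<le> C * L2_norm \<nu> f"
    using assms(2) by blast
  with assms show ?thesis unfolding L2_bounded_linear_def by (simp add: subset_iff)
qed

text \<open>Discharges the choice in \<open>iota\<close>. The relation to be extended pairs each f
  in the model space with its continuous extensions, and the inequality in \<open>C2\<close> is
  exactly the bound that the extension lemma asks for.\<close>

lemma iota_properties: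
  assumes "inner_function \<Theta>" "\<mu> \<in> C2 \<Theta>"
  shows "L2_bounded_linear circle_measure (model_space \<Theta>) (variation \<mu>) (L2_fun (variation \<mu>)) (iota \<Theta> \<mu>)"
proof -
  from assms(2) obtain C where cm: "complex_measure \<mu>" and C: "C > 0"
    and bound: "\<And>f F. f \<in> model_space \<Theta> \<Longrightarrow> continuous_extension f F \<Longrightarrow>
      L2_norm (variation \<mu>) F \<le> C * L2_norm circle_measure f"
    unfolding C2_def by blast
  define G where "G = {(f, F). f \<in> model_space \<Theta> \<and> continuous_extension f F}"
  have "\<exists>J. L2_bounded_linear circle_measure (L2_fun circle_measure) (variation \<mu>) (L2_fun (variation \<mu>)) J \<and>
      (\<forall>(f, F)\<in>G. eq_ae (variation \<mu>) (J f) F)"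
  proof (rule L2_bounded_relation_extends)
    show "G \<subseteq> L2_fun circle_measure \<times> L2_fun (variation \<mu>)"
      using continuous_extension_L2_fun[OF finite_measure_variation[OF cm]]
      by (auto simp: G_def model_space_L2_fun)
    show "((\<lambda>z. 0), (\<lambda>z. 0)) \<in> G"
      by (simp add: G_def model_space_zero continuous_extension_def eq_ae_def)
    show "L2_norm (variation \<mu>) F \<le> C * L2_norm circle_measure f" if "(f, F) \<in> G" for f F
      using that by (simp add: G_def bound)
    show "((\<lambda>z. f z + g z), (\<lambda>z. F z + H z)) \<in> G" if "(f, F) \<in> G" "(g, H) \<in> G" for f F g H
    proof -
      have "f \<in> model_space \<Theta>" "g \<in> model_space \<Theta>" "continuous_extension f F" "continuous_extension g H"
        using that unfolding G_def by blast+
      then show ?thesis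
        unfolding G_def using model_space_add[OF assms(1)] continuous_extension_add by blast
    qed
    show "((\<lambda>z. c * f z), (\<lambda>z. c * F z)) \<in> G" if "(f, F) \<in> G" for c f F
    proof -
      have "f \<in> model_space \<Theta>" "continuous_extension f F" using that unfolding G_def by blast+
      then show ?thesis
        unfolding G_def using model_space_scale continuous_extension_scale by blast
    qed
    show "C \<ge> 0" using C by simp
  qed
  then obtain J where J: "L2_bounded_linear circle_measure (L2_fun circle_measure) (variation \<mu>) (L2_fun (variation \<mu>)) J"
    "\<And>f F. f \<in> model_space \<Theta> \<Longrightarrow> continuous_extension f F \<Longrightarrow> eq_ae (variation \<mu>) (J f) F"
    unfolding G_def by auto
  have "L2_bounded_linear circle_measure (model_space \<Theta>) (variation \<mu>) (L2_fun (variation \<mu>)) J"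
    by (rule L2_bounded_linear_subset[OF J(1)]) (use model_space_L2_fun in blast)
  then have "\<exists>J. L2_bounded_linear circle_measure (model_space \<Theta>) (variation \<mu>) (L2_fun (variation \<mu>)) J \<and>
     (\<forall>f\<in>model_space \<Theta>. \<forall>F. continuous_extension f F \<longrightarrow> eq_ae (variation \<mu>) (J f) F)"
    using J(2) by (intro exI[of _ J] conjI ballI allI impI)
  from someI_ex[OF this] show ?thesis unfolding iota_def by blast
qed

section \<open>Poisson representation of \<open>H\<^sup>2\<close> functions\<close>

lemma circle_measure_integral:
  fixes f :: "complex \<Rightarrow> 'a::{banach, second_countable_topology}"
  assumes f: "f \<in> borel_measurable circle_borel"
  shows "(\<integral>z. f z \<partial>circle_measure) = (1 / (2 * pi)) *\<^sub>R (LINT t:{0..<2 * pi}|lborel. f (cis t))"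
proof -
  have m: "(\<lambda>t. f (cis t)) \<in> borel_measurable lborel"
    using measurable_compose[OF cis_measurable f] by simp
  have u: "uniform_measure lborel {0..<2 * pi}
      = density lborel (\<lambda>t. ennreal (indicator {0..<2 * pi} t / (2 * pi)))"
    unfolding uniform_measure_def
  proof (rule density_cong)
    show "AE t in lborel. indicator {0..<2 * pi} t / emeasure lborel {0..<2 * pi}
        = ennreal (indicator {0..<2 * pi} t / (2 * pi))"
      by (auto simp: indicator_def divide_ennreal simp flip: ennreal_1 intro!: AE_I2)
  qed auto
  have "(\<integral>z. f z \<partial>circle_measure) = (\<integral>t. f (cis t) \<partial>uniform_measure lborel {0..<2 * pi})"
    unfolding circle_measure_def by (rule integral_distr[OF cis_measurable_uniform f])
  also have "\<dots> = (\<integral>t. (indicator {0..<2 * pi} t / (2 * pi)) *\<^sub>R f (cis t) \<partial>lborel)"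
    unfolding u by (rule integral_density[OF m]) auto
  also have "\<dots> = (\<integral>t. (1 / (2 * pi)) *\<^sub>R (indicator {0..<2 * pi} t *\<^sub>R f (cis t)) \<partial>lborel)"
    by (intro Bochner_Integration.integral_cong refl) (simp add: field_simps)
  also have "\<dots> = (1 / (2 * pi)) *\<^sub>R (LINT t:{0..<2 * pi}|lborel. f (cis t))"
    unfolding set_lebesgue_integral_def by (rule integral_scaleR_right)
  finally show ?thesis .
qed

text \<open>Links the measure, carried by a half-open interval of angles, with the integral over the
  closed interval that a contour integral produces; the extra endpoint is a null set.\<close>

lemma circle_measure_integral_has_integral:
  fixes f :: "complex \<Rightarrow> complex"
  assumes f: "continuous_on unit_circle f"
    and int: "((\<lambda>t. f (cis t)) has_integral I) {0..2 * pi}"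
  shows "(\<integral>z. f z \<partial>circle_measure) = I / (2 * pi)"
proof -
  have c: "continuous_on {0..2 * pi} (\<lambda>t. f (cis t))"
    by (rule continuous_on_compose2[OF f]) (auto intro!: continuous_intros)
  have "(LINT t:{0..<2 * pi}|lborel. f (cis t)) = (LINT t:{0..2 * pi}|lborel. f (cis t))"
    unfolding set_lebesgue_integral_def
  proof (rule integral_cong_AE)
    have "(\<lambda>t. f (cis t)) \<in> borel_measurable lborel"
      using measurable_compose[OF cis_measurable continuous_on_circle_measurable[OF f]] by simp
    then show "(\<lambda>t. indicator {0..<2 * pi} t *\<^sub>R f (cis t)) \<in> borel_measurable lborel"
      "(\<lambda>t. indicator {0..2 * pi} t *\<^sub>R f (cis t)) \<in> borel_measurable lborel" by measurable
    show "AE t in lborel. indicator {0..<2 * pi} t *\<^sub>R f (cis t) = indicator {0..2 * pi} t *\<^sub>R f (cis t)"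
      using AE_lborel_singleton[of "2 * pi"] by eventually_elim (auto simp: indicator_def)
  qed
  also have "\<dots> = integral {0..2 * pi} (\<lambda>t. f (cis t))"
    by (rule set_borel_integral_eq_integral[OF borel_integrable_atLeastAtMost'[OF c]])
  also have "\<dots> = I" using int by (rule integral_unique)
  finally show ?thesis
    using circle_measure_integral[OF continuous_on_circle_measurable[OF f]]
    by (simp add: scaleR_conv_of_real)
qed

section \<open>The Poisson kernel and its reproducing property\<close>

definition poisson :: "complex \<Rightarrow> complex \<Rightarrow> real" where
  "poisson a w = (1 - (cmod a)\<^sup>2) / (cmod (w - a))\<^sup>2"

lemma poisson_nonneg: "cmod a < 1 \<Longrightarrow> poisson a w \<ge> 0"
  by (simp add: poisson_def power_le_one)

lemma poisson_le:
  assumes "cmod a < 1" "cmod w = 1"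
  shows "poisson a w \<le> 2 / (1 - cmod a)"
proof -
  have d: "1 - cmod a \<le> cmod (w - a)" using norm_triangle_ineq2[of w a] assms by simp
  have "poisson a w \<le> (1 - (cmod a)\<^sup>2) / (1 - cmod a)\<^sup>2"
    unfolding poisson_def
    by (rule divide_left_mono) (use assms d in \<open>auto simp: power_le_one intro!: power_mono mult_pos_pos\<close>)
  also have "\<dots> = (1 + cmod a) / (1 - cmod a)"
  proof -
    have "1 - (cmod a)\<^sup>2 = (1 - cmod a) * (1 + cmod a)" by (simp add: power2_eq_square algebra_simps)
    then show ?thesis using assms by (simp add: power2_eq_square)
  qed
  also have "\<dots> \<le> 2 / (1 - cmod a)" using assms by (intro divide_right_mono) auto
  finally show ?thesis .
qed

lemma continuous_on_poisson: "cmod a < 1 \<Longrightarrow> continuous_on unit_circle (poisson a)"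
  unfolding poisson_def by (auto intro!: continuous_intros)

text \<open>Cauchy's formula at a, applied to F(w) (1 - |a|^2) / (1 - cnj a * w). The added factor
  equals 1 at w = a, has no pole in the closed disc, and turns the Cauchy kernel on the circle into
  the Poisson kernel.\<close>

lemma poisson_formula:
  assumes c: "continuous_on (cball 0 1) F" and h: "F holomorphic_on unit_disc" and a: "cmod a < 1"
  shows "(\<integral>w. F w * of_real (poisson a w) \<partial>circle_measure) = F a"
proof -
  have nz: "1 - cnj a * w \<noteq> 0" if "cmod w \<le> 1" for w
  proof
    assume "1 - cnj a * w = 0"
    then have "cmod (cnj a * w) = 1" by (metis eq_iff_diff_eq_0 norm_one)
    moreover have "cmod (cnj a * w) \<le> cmod a * 1"
      using that by (simp add: norm_mult mult_left_le)
    ultimately show False using a by simp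
  qed
  define G where "G w = F w * ((1 - of_real ((cmod a)\<^sup>2)) / (1 - cnj a * w))" for w
  have "((\<lambda>u. G u / (u - a)) has_contour_integral (2 * of_real pi * \<i> * G a)) (circlepath 0 1)"
  proof (rule Cauchy_integral_circlepath)
    show "continuous_on (cball 0 1) G"
      unfolding G_def using nz by (intro continuous_intros c) auto
    show "G holomorphic_on ball 0 1"
      unfolding G_def using nz by (intro holomorphic_intros h) auto
  qed (use a in auto)
  moreover have "G a = F a"
  proof -
    have "(1 - of_real ((cmod a)\<^sup>2)) = 1 - cnj a * a"
      unfolding complex_norm_square by (simp add: mult.commute)
    then show ?thesis using nz[of a] a by (simp add: G_def)
  qed
  ultimately have "((\<lambda>t. G (cis t) / (cis t - a) * \<i> * cis t) has_integral (2 * of_real pi * \<i> * F a)) {0..2 * pi}"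
    using has_contour_integral_part_circlepath_iff[of 0 "2 * pi" "\<lambda>u. G u / (u - a)" _ 0 1]
    by (simp add: circlepath_def)
  \<comment> \<open>Multiplication by -i removes the factor i that comes from the derivative of the
    circle path.\<close>
  then have "((\<lambda>t. (- \<i>) * (G (cis t) / (cis t - a) * \<i> * cis t)) has_integral ((- \<i>) * (2 * of_real pi * \<i> * F a))) {0..2 * pi}"
    by (rule has_integral_mult_right)
  moreover have "(- \<i>) * (G (cis t) / (cis t - a) * \<i> * cis t) = F (cis t) * of_real (poisson a (cis t))" for t
  proof -
    \<comment> \<open>Uses that cis t * cnj (cis t) = 1; this is the point where the conjugate of w
      - a appears.\<close>
    have n: "1 - cnj a * cis t = cis t * cnj (cis t - a)"
      by (simp add: algebra_simps cis_cnj cis_mult)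
    have "G (cis t) / (cis t - a) * cis t
        = F (cis t) * (1 - of_real ((cmod a)\<^sup>2)) * (cis t / (cis t * (cnj (cis t - a) * (cis t - a))))"
      by (simp add: G_def n)
    also have "\<dots> = F (cis t) * (1 - of_real ((cmod a)\<^sup>2)) / ((cis t - a) * cnj (cis t - a))"
      by (simp add: mult.commute)
    also have "(cis t - a) * cnj (cis t - a) = of_real ((cmod (cis t - a))\<^sup>2)"
      by (rule complex_norm_square[symmetric])
    finally show ?thesis by (simp add: poisson_def mult_ac)
  qed
  ultimately have I: "((\<lambda>t. F (cis t) * of_real (poisson a (cis t))) has_integral (2 * of_real pi * F a)) {0..2 * pi}"
    by (simp add: mult_ac)
  have "continuous_on unit_circle (\<lambda>w. F w * of_real (poisson a w))"
    using continuous_on_subset[OF c sphere_cball] continuous_on_poisson[OF a]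
    by (intro continuous_intros) auto
  from circle_measure_integral_has_integral[OF this I] show ?thesis by simp
qed

lemma poisson_integrable: "cmod a < 1 \<Longrightarrow> integrable circle_measure (poisson a)"
  by (rule integrable_continuous_circle[OF finite_measure_circle_measure sets_circle_measure continuous_on_poisson])

lemma poisson_integral: "cmod a < 1 \<Longrightarrow> (\<integral>w. poisson a w \<partial>circle_measure) = 1"
  using poisson_formula[of "\<lambda>_. 1" a] by (simp flip: of_real_eq_iff)

lemma poisson_measurable: "cmod a < 1 \<Longrightarrow> poisson a \<in> borel_measurable circle_measure"
  using borel_measurable_integrable[OF poisson_integrable] .

section \<open>Poisson integrals of L2 boundary functions\<close>

lemma const_L2_fun: "(\<lambda>_. c) \<in> L2_fun circle_measure"
  by (rule continuous_on_circle_L2_fun[OF finite_measure_circle_measure sets_circle_measure]) auto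

lemma L2_norm_one: "L2_norm circle_measure (\<lambda>_. 1) = 1"
  using emeasure_circle_measure_space by (simp add: L2_norm_def measure_def)

lemma circle_integral_le_L2_norm:
  assumes "f \<in> L2_fun circle_measure"
  shows "integrable circle_measure f" "(\<integral>z. cmod (f z) \<partial>circle_measure) \<le> L2_norm circle_measure f"
proof -
  have "integrable circle_measure (\<lambda>z. cmod (f z))"
    using L2_fun_mult_integrable[OF assms const_L2_fun[of 1]] by simp
  then show "integrable circle_measure f"
    using L2_funD(1)[OF assms] by (simp add: integrable_norm_iff)
  show "(\<integral>z. cmod (f z) \<partial>circle_measure) \<le> L2_norm circle_measure f"
    using L2_Cauchy_Schwarz_abs[OF assms const_L2_fun[of 1]] by (simp add: L2_norm_one)
qed

lemma poisson_mult_integrable: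
  fixes f :: "complex \<Rightarrow> 'a::{banach, second_countable_topology, real_normed_field}"
  assumes f: "integrable circle_measure f" and a: "cmod a < 1"
  shows "integrable circle_measure (\<lambda>w. f w * of_real (poisson a w))"
proof (rule Bochner_Integration.integrable_bound)
  show "integrable circle_measure (\<lambda>w. (2 / (1 - cmod a)) * norm (f w))" using f by simp
  show "(\<lambda>w. f w * of_real (poisson a w)) \<in> borel_measurable circle_measure"
    using poisson_measurable[OF a] f by measurable
  have "norm (f w * of_real (poisson a w)) \<le> norm ((2 / (1 - cmod a)) * norm (f w))" if "cmod w = 1" for w
    using mult_right_mono[OF poisson_le[OF a that], of "norm (f w)"] poisson_nonneg[OF a, of w] a
    by (simp add: norm_mult abs_mult mult.commute)
  then show "AE w in circle_measure. norm (f w * of_real (poisson a w)) \<le> norm ((2 / (1 - cmod a)) * norm (f w))"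
    by (intro AE_I2) simp
qed

lemma poisson_integral_diff:
  assumes "f \<in> L2_fun circle_measure" "g \<in> L2_fun circle_measure" and a: "cmod a < 1"
  shows "(\<integral>w. (f w - g w) * of_real (poisson a w) \<partial>circle_measure)
    = (\<integral>w. f w * of_real (poisson a w) \<partial>circle_measure) - (\<integral>w. g w * of_real (poisson a w) \<partial>circle_measure)"
  using poisson_mult_integrable[OF circle_integral_le_L2_norm(1)[OF assms(1)] a]
    poisson_mult_integrable[OF circle_integral_le_L2_norm(1)[OF assms(2)] a]
  by (simp add: left_diff_distrib)

text \<open>At a fixed interior point the kernel is bounded, so L1 convergence on the circle
  suffices there. L1 is the mode in which the dilates of a Hardy function are shown to
  converge.\<close>

lemma poisson_integral_diff_le:
  assumes "f \<in> L2_fun circle_measure" "g \<in> L2_fun circle_measure" and a: "cmod a < 1"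
  shows "cmod ((\<integral>w. f w * of_real (poisson a w) \<partial>circle_measure) - (\<integral>w. g w * of_real (poisson a w) \<partial>circle_measure))
    \<le> 2 / (1 - cmod a) * (\<integral>w. cmod (f w - g w) \<partial>circle_measure)"
proof -
  note i = circle_integral_le_L2_norm(1)
  have d: "integrable circle_measure (\<lambda>w. f w - g w)" using assms by (intro Bochner_Integration.integrable_diff i)
  have "cmod ((\<integral>w. f w * of_real (poisson a w) \<partial>circle_measure) - (\<integral>w. g w * of_real (poisson a w) \<partial>circle_measure))
      = cmod (\<integral>w. (f w - g w) * of_real (poisson a w) \<partial>circle_measure)"
    by (simp only: poisson_integral_diff[OF assms])
  also have "\<dots> \<le> (\<integral>w. 2 / (1 - cmod a) * cmod (f w - g w) \<partial>circle_measure)"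
  proof (rule order_trans[OF integral_norm_bound integral_mono])
    show "norm ((f w - g w) * of_real (poisson a w)) \<le> 2 / (1 - cmod a) * cmod (f w - g w)"
      if "w \<in> space circle_measure" for w
      using mult_right_mono[OF poisson_le[OF a], of w "norm (f w - g w)"] poisson_nonneg[OF a, of w] that
      by (simp add: norm_mult mult.commute)
    show "integrable circle_measure (\<lambda>w. norm ((f w - g w) * of_real (poisson a w)))"
      by (intro integrable_norm poisson_mult_integrable d a)
    show "integrable circle_measure (\<lambda>w. 2 / (1 - cmod a) * cmod (f w - g w))"
      by (intro integrable_mult_right integrable_norm d)
  qed
  also have "\<dots> = 2 / (1 - cmod a) * (\<integral>w. cmod (f w - g w) \<partial>circle_measure)"
    by (rule Bochner_Integration.integral_mult_right_zero)
  finally show ?thesis .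
qed

text \<open>Boundedness in \<open>L\<^sup>2\<close> makes the sequence uniformly integrable: \<open>d \<le> min d K + d\<^sup>2 / K\<close>.\<close>

lemma L2_bounded_AE_tendsto_L1:
  assumes fin: "finite_measure \<nu>" and g: "\<And>n. g n \<in> L2_fun \<nu>" and f: "f \<in> L2_fun \<nu>"
    and B: "\<And>n. L2_norm \<nu> (g n) \<le> B"
    and ae: "AE z in \<nu>. (\<lambda>n. g n z) \<longlonglongrightarrow> f z"
  shows "(\<lambda>n. \<integral>z. cmod (g n z - f z) \<partial>\<nu>) \<longlonglongrightarrow> 0"
proof (rule LIMSEQ_I)
  fix e :: real assume e: "e > 0"
  interpret finite_measure \<nu> by (rule fin)
  define B' where "B' = (B + L2_norm \<nu> f)\<^sup>2"
  have d: "(\<lambda>z. g n z - f z) \<in> L2_fun \<nu>" for n by (intro L2_fun_diff g f)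
  have dB: "(\<integral>z. (cmod (g n z - f z))\<^sup>2 \<partial>\<nu>) \<le> B'" for n
  proof -
    have "L2_norm \<nu> (\<lambda>z. g n z - f z) \<le> B + L2_norm \<nu> f"
      using L2_norm_triangle[OF g[of n] L2_fun_scale[OF f, of "-1"]] B[of n] L2_norm_scale[of \<nu> "-1" f] by simp
    then show ?thesis unfolding B'_def L2_norm_sq[symmetric] by (rule power_mono) simp
  qed
  \<comment> \<open>Makes B' / K smaller than e / 2; the summand 1 keeps K positive when B' =
    0.\<close>
  define K where "K = 2 * (B' + 1) / e"
  have B': "B' \<ge> 0" by (simp add: B'_def)
  have K: "K > 0" "B' / K < e / 2"
    using e B' by (auto simp: K_def field_simps)
  have m: "(\<lambda>z. min (cmod (g n z - f z)) K) \<in> borel_measurable \<nu>" for n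
    using L2_funD(1)[OF d[of n]] by measurable
  \<comment> \<open>The truncated differences are dominated by the constant K, which is integrable
    because the measure is finite.\<close>
  have "(\<lambda>n. \<integral>z. min (cmod (g n z - f z)) K \<partial>\<nu>) \<longlonglongrightarrow> (\<integral>z. 0 \<partial>\<nu>)"
  proof (rule integral_dominated_convergence[where w="\<lambda>_. K"])
    show "AE z in \<nu>. (\<lambda>n. min (cmod (g n z - f z)) K) \<longlonglongrightarrow> 0"
      using ae
    proof eventually_elim
      fix z assume "(\<lambda>n. g n z) \<longlonglongrightarrow> f z"
      then have "(\<lambda>n. cmod (g n z - f z)) \<longlonglongrightarrow> 0" by (simp add: tendsto_norm_zero_iff LIM_zero_iff)
      from tendsto_min[OF this tendsto_const[of K]] K show "(\<lambda>n. min (cmod (g n z - f z)) K) \<longlonglongrightarrow> 0"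
        by simp
    qed
  qed (use m K in auto)
  from LIMSEQ_D[OF this, of "e/2"] e obtain N where
    N: "\<And>n. n \<ge> N \<Longrightarrow> \<bar>\<integral>z. min (cmod (g n z - f z)) K \<partial>\<nu>\<bar> < e / 2" by auto
  have "norm ((\<integral>z. cmod (g n z - f z) \<partial>\<nu>) - 0) < e" if "n \<ge> N" for n
  proof -
    have im: "integrable \<nu> (\<lambda>z. min (cmod (g n z - f z)) K)"
      using K by (intro integrable_const_bound[OF _ m, where B=K]) auto
    have isq: "integrable \<nu> (\<lambda>z. (cmod (g n z - f z))\<^sup>2 / K)" using L2_funD(2)[OF d[of n]] by simp
    have pt: "x \<le> min x K + x\<^sup>2 / K" if "x \<ge> 0" for x :: real
    proof (cases "x \<le> K")
      case False
      then have "x \<le> x * x / K" using K(1) that by (simp add: field_simps)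
      then show ?thesis using False K(1) by (simp add: min_def power2_eq_square)
    qed (use K(1) in auto)
    have "(\<integral>z. cmod (g n z - f z) \<partial>\<nu>) \<le> (\<integral>z. min (cmod (g n z - f z)) K + (cmod (g n z - f z))\<^sup>2 / K \<partial>\<nu>)"
    proof (rule integral_mono')
      show "integrable \<nu> (\<lambda>z. min (cmod (g n z - f z)) K + (cmod (g n z - f z))\<^sup>2 / K)"
        using im isq by (rule Bochner_Integration.integrable_add)
    qed (use pt K(1) in auto)
    also have "\<dots> = (\<integral>z. min (cmod (g n z - f z)) K \<partial>\<nu>) + (\<integral>z. (cmod (g n z - f z))\<^sup>2 \<partial>\<nu>) / K"
      using im isq by simp
    also have "\<dots> < e / 2 + e / 2"
      using N[OF that] divide_right_mono[OF dB[of n], of K] K by linarith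
    finally show ?thesis by (simp add: integral_nonneg_AE)
  qed
  then show "\<exists>N. \<forall>n\<ge>N. norm ((\<integral>z. cmod (g n z - f z) \<partial>\<nu>) - 0) < e" by blast
qed

text \<open>Each dilate of F is continuous on the closed disc and obeys the Poisson formula. As the
  radius tends to 1 the dilates stay bounded in L2 and converge to f almost everywhere, hence in L1,
  which carries the formula over to F and f.\<close>

lemma hardy2_poisson_representation:
  assumes F: "F \<in> hardy2_disc" "radial_boundary_function F f" and f: "f \<in> L2_fun circle_measure"
    and a: "cmod a < 1"
  shows "F a = (\<integral>w. f w * of_real (poisson a w) \<partial>circle_measure)"
proof -
  obtain B where hol: "F holomorphic_on unit_disc"
    and B: "\<And>r. r \<in> {0..<1} \<Longrightarrow> L2_norm circle_measure (\<lambda>z. F (of_real r * z)) \<le> B"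
    using F(1) unfolding hardy2_disc_iff by blast
  \<comment> \<open>Radii tending to 1 from below along a sequence, since the L1 convergence is
    stated for sequences; r 0 = 0 is admissible.\<close>
  define r where "r n = 1 - 1 / real (Suc n)" for n
  have r: "r n \<in> {0..<1}" for n by (simp add: r_def field_simps)
  have r0: "0 \<le> r n" "r n < 1" for n using r[of n] by auto
  have r_lim: "r \<longlonglongrightarrow> 1"
    using tendsto_diff[OF tendsto_const LIMSEQ_Suc[OF lim_1_over_n], of "1::real"] by (simp add: r_def[abs_def])
  have r_left: "filterlim r (at_left 1) sequentially"
    using r_lim r0 by (auto simp: filterlim_at less_imp_neq intro!: always_eventually)
  define g where "g n z = F (of_real (r n) * z)" for n z
  have g: "g n \<in> L2_fun circle_measure" for n
    unfolding g_def by (rule hardy2_disc_dilate_L2_fun[OF hol r0])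
  have L1: "(\<lambda>n. \<integral>z. cmod (g n z - f z) \<partial>circle_measure) \<longlonglongrightarrow> 0"
  proof (rule L2_bounded_AE_tendsto_L1[OF finite_measure_circle_measure g f])
    show "L2_norm circle_measure (g n) \<le> B" for n unfolding g_def by (rule B[OF r])
    show "AE z in circle_measure. (\<lambda>n. g n z) \<longlonglongrightarrow> f z"
      using F(2) unfolding radial_boundary_function_def g_def
      by eventually_elim (rule filterlim_compose[OF _ r_left])
  qed
  let ?P = "\<lambda>f. \<integral>w. f w * of_real (poisson a w) \<partial>circle_measure"
  have g_formula: "?P (g n) = F (of_real (r n) * a)" for n
    unfolding g_def
  proof (rule poisson_formula[OF _ _ a])
    have sub: "(\<lambda>z. of_real (r n) * z) ` cball 0 1 \<subseteq> unit_disc"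
    proof clarsimp
      fix z :: complex assume "cmod z \<le> 1"
      then show "cmod (of_real (r n) * z) < 1"
        using mult_left_le[of "cmod z" "r n"] r0[of n] by (simp add: norm_mult)
    qed
    show "continuous_on (cball 0 1) (\<lambda>z. F (of_real (r n) * z))"
      by (rule continuous_on_compose2[OF holomorphic_on_imp_continuous_on[OF hol] _ sub])
        (intro continuous_intros)
    have "(F \<circ> (\<lambda>z. of_real (r n) * z)) holomorphic_on unit_disc"
    proof (rule holomorphic_on_compose_gen[OF _ hol])
      show "(\<lambda>z. of_real (r n) * z) ` unit_disc \<subseteq> unit_disc"
        using sub image_mono[OF ball_subset_cball] by (rule order_trans[rotated])
    qed (intro holomorphic_intros)
    then show "(\<lambda>z. F (of_real (r n) * z)) holomorphic_on unit_disc" by (simp add: o_def)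
  qed
  have "(\<lambda>n. ?P (g n)) \<longlonglongrightarrow> ?P f"
  proof (rule LIM_zero_cancel, rule Lim_null_comparison)
    show "\<forall>\<^sub>F n in sequentially. norm (?P (g n) - ?P f) \<le> 2 / (1 - cmod a) * (\<integral>w. cmod (g n w - f w) \<partial>circle_measure)"
      by (intro always_eventually allI poisson_integral_diff_le g f a)
    show "(\<lambda>n. 2 / (1 - cmod a) * (\<integral>w. cmod (g n w - f w) \<partial>circle_measure)) \<longlonglongrightarrow> 0"
      using tendsto_mult_right_zero[OF L1] .
  qed
  moreover have "(\<lambda>n. ?P (g n)) \<longlonglongrightarrow> F a"
    unfolding g_formula
  proof (rule continuous_on_tendsto_compose[OF holomorphic_on_imp_continuous_on[OF hol]])
    show "(\<lambda>n. of_real (r n) * a) \<longlonglongrightarrow> a"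
      using tendsto_mult[OF tendsto_of_real[OF r_lim] tendsto_const[of a]] by simp
    show "\<forall>\<^sub>F n in sequentially. of_real (r n) * a \<in> unit_disc"
    proof (intro always_eventually allI)
      fix n
      show "of_real (r n) * a \<in> unit_disc"
        using mult_left_le_one_le[of "cmod a" "r n"] r0[of n] a by (simp add: norm_mult)
    qed
  qed (use a in auto)
  ultimately show ?thesis using LIMSEQ_unique by blast
qed

text \<open>Jensen's inequality for the probability density \<open>poisson a\<close>, obtained from
  Cauchy-Schwarz by splitting the kernel into two square roots.\<close>

lemma poisson_integral_sq_le:
  assumes f: "f \<in> L2_fun circle_measure" and a: "cmod a < 1"
  shows "(cmod (\<integral>w. f w * of_real (poisson a w) \<partial>circle_measure))\<^sup>2
    \<le> (\<integral>w. (cmod (f w))\<^sup>2 * poisson a w \<partial>circle_measure)"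
proof -
  let ?N = "L2_norm circle_measure"
  let ?u = "\<lambda>w. f w * of_real (sqrt (poisson a w))" and ?v = "\<lambda>w. of_real (sqrt (poisson a w)) :: complex"
  have P: "poisson a w \<ge> 0" for w by (rule poisson_nonneg[OF a])
  have sq: "(cmod (?u w))\<^sup>2 = (cmod (f w))\<^sup>2 * poisson a w" "(cmod (?v w))\<^sup>2 = poisson a w" for w
    using P[of w] by (simp_all add: norm_mult power_mult_distrib)
  have u: "?u \<in> L2_fun circle_measure"
    unfolding L2_fun_def mem_Collect_eq sq
    using poisson_mult_integrable[OF L2_funD(2)[OF f] a] L2_funD(1)[OF f] poisson_measurable[OF a] by auto
  have v: "?v \<in> L2_fun circle_measure"
    unfolding L2_fun_def mem_Collect_eq sq using poisson_integrable[OF a] poisson_measurable[OF a] by auto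
  have "cmod (\<integral>w. f w * of_real (poisson a w) \<partial>circle_measure) \<le> (\<integral>w. cmod (f w * of_real (poisson a w)) \<partial>circle_measure)"
    by (rule integral_norm_bound)
  also have "\<dots> = (\<integral>w. cmod (?u w) * cmod (?v w) \<partial>circle_measure)"
    using P by (intro Bochner_Integration.integral_cong refl) (simp add: norm_mult)
  also have "\<dots> \<le> ?N ?u * ?N ?v" by (rule L2_Cauchy_Schwarz_abs[OF u v])
  also have "?N ?v = 1" unfolding L2_norm_def sq using poisson_integral[OF a] by simp
  finally have "(cmod (\<integral>w. f w * of_real (poisson a w) \<partial>circle_measure))\<^sup>2 \<le> (?N ?u * 1)\<^sup>2"
    by (rule power_mono) simp
  also have "\<dots> = (\<integral>w. (cmod (f w))\<^sup>2 * poisson a w \<partial>circle_measure)"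
    unfolding mult_1_right L2_norm_sq sq ..
  finally show ?thesis .
qed

text \<open>Reflects |w - r z| = |z - r w| for unimodular z and w. It lets the kernel be integrated
  over z, after an exchange of integrals, with the same total mass 1.\<close>

lemma poisson_symmetric:
  assumes "cmod z = 1" "cmod w = 1"
  shows "poisson (of_real r * z) w = poisson (of_real r * w) z"
proof -
  have "(cmod (w - of_real r * z))\<^sup>2 = (cmod (z - of_real r * w))\<^sup>2"
  proof -
    have "Re z * Re z + Im z * Im z = 1" "Re w * Re w + Im w * Im w = 1"
      using assms by (simp_all add: cmod_def power2_eq_square)
    then show ?thesis unfolding cmod_power2 by (simp add: power2_eq_square) algebra
  qed
  then show ?thesis using assms by (simp add: poisson_def norm_mult)
qed

text \<open>Jensen at each point, Tonelli, then symmetry of the kernel: integrating out z leaves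
  mass 1 for every w.\<close>

lemma poisson_dilate_norm_le:
  assumes f: "f \<in> L2_fun circle_measure" and r: "0 \<le> r" "r < 1"
    and F: "(\<lambda>z. F (of_real r * z)) \<in> L2_fun circle_measure"
      "\<And>z. cmod z = 1 \<Longrightarrow> F (of_real r * z) = (\<integral>w. f w * of_real (poisson (of_real r * z) w) \<partial>circle_measure)"
  shows "L2_norm circle_measure (\<lambda>z. F (of_real r * z)) \<le> L2_norm circle_measure f"
proof -
  interpret finite_measure circle_measure by (rule finite_measure_circle_measure)
  interpret pair_sigma_finite circle_measure circle_measure ..
  have rz: "cmod (of_real r * z) < 1" if "cmod z = 1" for z using that r by (simp add: norm_mult)
  have id [measurable]: "(\<lambda>z. z) \<in> borel_measurable circle_measure"
    using continuous_on_circle_measurable[of "\<lambda>z. z"] by simp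
  have mf [measurable]: "f \<in> borel_measurable circle_measure" by (rule L2_funD[OF f])
  have m: "(\<lambda>(z, w). ennreal ((cmod (f w))\<^sup>2 * poisson (of_real r * z) w)) \<in> borel_measurable (circle_measure \<Otimes>\<^sub>M circle_measure)"
    unfolding poisson_def by measurable
  have "ennreal ((L2_norm circle_measure (\<lambda>z. F (of_real r * z)))\<^sup>2)
      = (\<integral>\<^sup>+z. ennreal ((cmod (F (of_real r * z)))\<^sup>2) \<partial>circle_measure)"
    by (rule nn_integral_L2[OF F(1), symmetric])
  also have "\<dots> \<le> (\<integral>\<^sup>+z. \<integral>\<^sup>+w. ennreal ((cmod (f w))\<^sup>2 * poisson (of_real r * z) w) \<partial>circle_measure \<partial>circle_measure)"
  proof (rule nn_integral_mono)
    fix z assume "z \<in> space circle_measure"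
    then have z: "cmod z = 1" by simp
    have "ennreal ((cmod (F (of_real r * z)))\<^sup>2) \<le> ennreal (\<integral>w. (cmod (f w))\<^sup>2 * poisson (of_real r * z) w \<partial>circle_measure)"
      unfolding F(2)[OF z] by (intro ennreal_leI poisson_integral_sq_le[OF f rz[OF z]])
    also have "\<dots> = (\<integral>\<^sup>+w. ennreal ((cmod (f w))\<^sup>2 * poisson (of_real r * z) w) \<partial>circle_measure)"
      using poisson_mult_integrable[OF L2_funD(2)[OF f] rz[OF z]] poisson_nonneg[OF rz[OF z]]
      by (intro nn_integral_eq_integral[symmetric]) auto
    finally show "ennreal ((cmod (F (of_real r * z)))\<^sup>2)
      \<le> (\<integral>\<^sup>+w. ennreal ((cmod (f w))\<^sup>2 * poisson (of_real r * z) w) \<partial>circle_measure)" .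
  qed
  also have "\<dots> = (\<integral>\<^sup>+w. \<integral>\<^sup>+z. ennreal ((cmod (f w))\<^sup>2 * poisson (of_real r * z) w) \<partial>circle_measure \<partial>circle_measure)"
    using Fubini'[OF m] by simp
  also have "\<dots> = (\<integral>\<^sup>+w. ennreal ((cmod (f w))\<^sup>2) \<partial>circle_measure)"
  proof (rule nn_integral_cong)
    fix w assume "w \<in> space circle_measure"
    then have w: "cmod w = 1" by simp
    have "(\<integral>\<^sup>+z. ennreal ((cmod (f w))\<^sup>2 * poisson (of_real r * z) w) \<partial>circle_measure)
        = (\<integral>\<^sup>+z. ennreal ((cmod (f w))\<^sup>2) * ennreal (poisson (of_real r * w) z) \<partial>circle_measure)"
      using poisson_symmetric[OF _ w] poisson_nonneg[OF rz[OF w]]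
      by (intro nn_integral_cong) (simp add: ennreal_mult)
    also have "\<dots> = ennreal ((cmod (f w))\<^sup>2) * (\<integral>\<^sup>+z. ennreal (poisson (of_real r * w) z) \<partial>circle_measure)"
      using poisson_measurable[OF rz[OF w]] by (intro nn_integral_cmult) auto
    also have "(\<integral>\<^sup>+z. ennreal (poisson (of_real r * w) z) \<partial>circle_measure) = 1"
      using nn_integral_eq_integral[OF poisson_integrable[OF rz[OF w]]] poisson_nonneg[OF rz[OF w]]
        poisson_integral[OF rz[OF w]] by simp
    finally show "(\<integral>\<^sup>+z. ennreal ((cmod (f w))\<^sup>2 * poisson (of_real r * z) w) \<partial>circle_measure) = ennreal ((cmod (f w))\<^sup>2)"
      by simp
  qed
  also have "\<dots> = ennreal ((L2_norm circle_measure f)\<^sup>2)" by (rule nn_integral_L2[OF f])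
  finally have "(L2_norm circle_measure (\<lambda>z. F (of_real r * z)))\<^sup>2 \<le> (L2_norm circle_measure f)\<^sup>2"
    by (simp add: ennreal_le_iff)
  then show ?thesis by (simp add: power2_le_iff_abs_le)
qed

section \<open>The radial maximal function\<close>

text \<open>From x - x^3 / 6 <= sin x: the left side is at least x / 2 as soon as x^2 <= 3, and 8/5
  is an upper bound for pi / 2 whose square is below 3.\<close>

lemma sin_ge_half:
  assumes "0 \<le> x" "x \<le> pi / 2"
  shows "x / 2 \<le> sin x"
proof -
  have "x \<le> 8 / 5" using assms(2) pi_less_4 pi_approx by (simp add: field_simps)
  then have "x * x \<le> 8 / 5 * (8 / 5)" using assms(1) by (intro mult_mono) auto
  then have "x * (x * x) \<le> x * 3" using assms(1) by (intro mult_left_mono) auto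
  then have "x / 2 \<le> x - x ^ 3 / 6" by (simp add: power3_eq_cube mult.assoc)
  also have "\<dots> \<le> sin x"
  proof -
    have "\<bar>sin x - (\<Sum>m<3. sin_coeff m * x ^ m)\<bar> \<le> inverse (fact 3) * \<bar>x\<bar> ^ 3"
      by (rule Maclaurin_sin_bound)
    moreover have "(\<Sum>m<3. sin_coeff m * x ^ m) = x"
      by (simp add: numeral_3_eq_3 sin_coeff_def)
    moreover have "inverse (fact 3) * \<bar>x\<bar> ^ 3 = x ^ 3 / 6"
      using assms(1) by (simp add: fact_numeral)
    ultimately have "\<bar>sin x - x\<bar> \<le> x ^ 3 / 6" by simp
    then show ?thesis by (simp only: abs_le_iff) linarith
  qed
  finally show ?thesis .
qed

lemma dist_cis: "cmod (cis t - cis x) = 2 * \<bar>sin ((t - x) / 2)\<bar>"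
proof -
  have "(cmod (cis t - cis x))\<^sup>2 = (2 * \<bar>sin ((t - x) / 2)\<bar>)\<^sup>2"
  proof -
    have "(cmod (cis t - cis x))\<^sup>2 = 2 - 2 * cos (t - x)"
      using sin_cos_squared_add[of t] sin_cos_squared_add[of x]
      unfolding cmod_power2 by (simp add: cos_diff power2_eq_square algebra_simps)
    also have "cos (t - x) = 1 - 2 * (sin ((t - x) / 2))\<^sup>2"
      using cos_double_sin[of "(t - x) / 2"] by (simp only: times_divide_eq_right nonzero_mult_div_cancel_left zero_neq_numeral[symmetric] not_False_eq_True)
    finally show ?thesis by (simp add: power_mult_distrib)
  qed
  then show ?thesis by (rule power2_eq_imp_eq) auto
qed

lemma emeasure_circle_measure_eq:
  assumes "E \<in> sets circle_borel"
  shows "emeasure circle_measure E = emeasure lborel ({0..<2 * pi} \<inter> cis -` E) / ennreal (2 * pi)"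
proof -
  have "cis -` E \<in> sets borel" using measurable_sets[OF cis_measurable assms] by simp
  then show ?thesis
    unfolding circle_measure_def using assms
    by (simp add: emeasure_distr emeasure_uniform_measure)
qed

lemma cball_sets_circle: "cball z h \<inter> unit_circle \<in> sets circle_borel"
  unfolding circle_borel_def sets_restrict_space by auto

text \<open>A chord of length at most h spans a small angle. Three intervals of total length 8 h
  contain the admissible angles, and 8 h / (2 pi) <= 2 h because pi >= 2.\<close>

lemma emeasure_circle_cball_le:
  assumes z: "cmod z = 1" and h: "h > 0"
  shows "emeasure circle_measure (cball z h \<inter> unit_circle) \<le> ennreal (2 * h)"
proof -
  obtain x where x: "0 \<le> x" "x < 2 * pi" "z = cis x"
  proof
    show "0 \<le> Arg2pi z" "Arg2pi z < 2 * pi" using Arg2pi by auto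
    show "z = cis (Arg2pi z)" using Arg2pi_eq[of z] z by (simp add: cis_conv_exp)
  qed
  \<comment> \<open>The two intervals at the ends account for wrap-around: half the angle difference
    is within h of 0 or of pi, and in the second case t must be close to 0 or 2 pi.\<close>
  have sub: "{0..<2 * pi} \<inter> cis -` (cball z h \<inter> unit_circle)
    \<subseteq> {x - 2 * h..x + 2 * h} \<union> ({0..2 * h} \<union> {2 * pi - 2 * h..2 * pi})"
  proof
    fix t assume "t \<in> {0..<2 * pi} \<inter> cis -` (cball z h \<inter> unit_circle)"
    then have t: "0 \<le> t" "t < 2 * pi" and d: "cmod (cis t - cis x) \<le> h"
      using x(3) by (auto simp: dist_norm norm_minus_commute)
    define u where "u = \<bar>t - x\<bar> / 2"
    have u: "0 \<le> u" "u < pi" using t x by (auto simp: u_def)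
    have "sin u = \<bar>sin ((t - x) / 2)\<bar>"
    proof (cases "t \<ge> x")
      case True
      then have "u = (t - x) / 2" by (simp add: u_def)
      then show ?thesis using sin_ge_zero[of u] u by (simp only: abs_of_nonneg)
    next
      case False
      then have "u = - ((t - x) / 2)" by (simp add: u_def field_simps)
      then have "\<bar>sin ((t - x) / 2)\<bar> = \<bar>sin u\<bar>" by (simp only: sin_minus abs_minus_cancel)
      then show ?thesis using sin_ge_zero[of u] u by simp
    qed
    then have s: "2 * sin u \<le> h" using d dist_cis[of t x] by simp
    consider "u \<le> pi / 2" | "u > pi / 2" by linarith
    then have "u \<le> h \<or> pi - u \<le> h"
    proof cases
      case 1
      then show ?thesis using sin_ge_half[of u] u s by auto
    next
      case 2
      then show ?thesis using sin_ge_half[of "pi - u"] u s by auto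
    qed
    then show "t \<in> {x - 2 * h..x + 2 * h} \<union> ({0..2 * h} \<union> {2 * pi - 2 * h..2 * pi})"
    proof
      assume "u \<le> h"
      then show ?thesis by (auto simp: u_def abs_if field_simps split: if_splits)
    next
      assume "pi - u \<le> h"
      then have "2 * pi - 2 * h \<le> \<bar>t - x\<bar>" by (simp add: u_def field_simps)
      then show ?thesis using t x by (cases "t \<ge> x") auto
    qed
  qed
  have "emeasure lborel ({0..<2 * pi} \<inter> cis -` (cball z h \<inter> unit_circle))
      \<le> emeasure lborel ({x - 2 * h..x + 2 * h} \<union> ({0..2 * h} \<union> {2 * pi - 2 * h..2 * pi}))"
    by (rule emeasure_mono[OF sub]) auto
  also have "\<dots> \<le> emeasure lborel {x - 2 * h..x + 2 * h} + (emeasure lborel {0..2 * h} + emeasure lborel {2 * pi - 2 * h..2 * pi})"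
    by (intro order_trans[OF emeasure_subadditive] add_left_mono emeasure_subadditive) auto
  also have "\<dots> = ennreal (4 * h + (2 * h + 2 * h))"
    using h by (simp flip: ennreal_plus)
  also have "4 * h + (2 * h + 2 * h) = 8 * h" by simp
  finally have "emeasure circle_measure (cball z h \<inter> unit_circle) \<le> ennreal (8 * h) / ennreal (2 * pi)"
    unfolding emeasure_circle_measure_eq[OF cball_sets_circle] by (rule divide_right_mono_ennreal)
  also have "\<dots> = ennreal (8 * h / (2 * pi))" using h by (simp add: divide_ennreal)
  also have "\<dots> \<le> ennreal (2 * h)"
  proof (rule ennreal_leI)
    have "h * 2 \<le> h * pi" using h pi_approx by (intro mult_left_mono) auto
    then show "8 * h / (2 * pi) \<le> 2 * h" by (simp add: field_simps)
  qed
  finally show ?thesis .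
qed

section \<open>Weak type estimate for the maximal function\<close>

lemma indicator_mult_integrable:
  fixes a :: "'a \<Rightarrow> real"
  assumes "integrable M a" "A \<in> sets M"
  shows "integrable M (\<lambda>w. indicator A w * a w)"
  using integrable_mult_indicator[OF assms(2,1)] by simp

lemma circle_indicator_cball:
  fixes a :: "complex \<Rightarrow> real"
  assumes "integrable circle_measure a"
  shows "integrable circle_measure (\<lambda>w. indicator (cball z h) w * a w)"
proof -
  have "integrable circle_measure (\<lambda>w. indicator (cball z h \<inter> unit_circle) w * a w)"
    by (rule indicator_mult_integrable[OF assms]) (simp add: cball_sets_circle)
  then show ?thesis
    by (rule Bochner_Integration.integrable_cong[THEN iffD1, rotated -1]) (auto simp: indicator_def)
qed

text \<open>\<open>U\<close> is a measurable superset of the set where the Hardy--Littlewood maximal function, taken over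
  chordal discs, exceeds \<open>l\<close>; it comes from the Vitali covering lemma.\<close>

lemma circle_maximal_weak_type:
  fixes a :: "complex \<Rightarrow> real"
  assumes a: "integrable circle_measure a" and nn: "\<And>w. a w \<ge> 0" and l: "l > 0"
  obtains U where "U \<in> sets circle_borel"
    "measure circle_measure U \<le> 10 / l * (\<integral>w. a w \<partial>circle_measure)"
    "\<And>z h. cmod z = 1 \<Longrightarrow> z \<notin> U \<Longrightarrow> h > 0 \<Longrightarrow> (\<integral>w. indicator (cball z h) w * a w \<partial>circle_measure) \<le> l * h"
proof -
  interpret finite_measure circle_measure by (rule finite_measure_circle_measure)
  let ?I = "\<lambda>z h. \<integral>w. indicator (cball z h) w * a w \<partial>circle_measure"
  define A where "A = (\<integral>w. a w \<partial>circle_measure)"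
  define E where "E = {z. cmod z = 1 \<and> (\<exists>h>0. ?I z h > l * h)}"
  define rad where "rad z = (SOME h. h > 0 \<and> ?I z h > l * h)" for z
  have rad: "rad z > 0" "?I z (rad z) > l * rad z" if "z \<in> E" for z
    using someI_ex[of "\<lambda>h. h > 0 \<and> ?I z h > l * h"] that unfolding E_def rad_def by auto
  have I_le: "?I z h \<le> A" for z h
    unfolding A_def using nn by (intro integral_mono circle_indicator_cball a) (auto simp: indicator_def)
  \<comment> \<open>Vitali's lemma needs bounded radii: l * rad z lies below an integral that is
    itself at most A.\<close>
  have bd: "0 < rad z \<and> rad z \<le> A / l" if "z \<in> E" for z
    using rad[OF that] I_le[of z "rad z"] l by (auto simp: field_simps)
  obtain C where C: "countable C" "C \<subseteq> E"
    "pairwise (\<lambda>i j. disjnt (cball i (rad i)) (cball j (rad j))) C"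
    "E \<subseteq> (\<Union>i\<in>C. cball i (5 * rad i))"
  proof (rule Vitali_covering_lemma_cballs[of E "\<lambda>z. z" rad E "A / l"])
    show "E \<subseteq> (\<Union>i\<in>E. cball i (rad i))"
    proof
      fix z assume "z \<in> E"
      then show "z \<in> (\<Union>i\<in>E. cball i (rad i))" using rad(1)[of z] by (intro UN_I[of z]) auto
    qed
  qed (use bd in auto)
  define B where "B z = cball z (5 * rad z) \<inter> unit_circle" for z
  have B: "B z \<in> sets circle_measure" for z by (simp add: B_def cball_sets_circle)
  \<comment> \<open>The constant 10 is 2 from the measure of a disc times 5 from the Vitali
    enlargement. Disjointness of the original discs bounds the sum of their integrals by A.\<close>
  have fin: "measure circle_measure (\<Union>z\<in>F. B z) \<le> 10 / l * A" if F: "finite F" "F \<subseteq> C" for F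
  proof -
    have FE: "z \<in> E" if "z \<in> F" for z using that F C(2) by blast
    have "measure circle_measure (\<Union>z\<in>F. B z) \<le> (\<Sum>z\<in>F. measure circle_measure (B z))"
      by (rule finite_measure_subadditive_finite[OF F(1)]) (use B in auto)
    also have "\<dots> \<le> (\<Sum>z\<in>F. 10 / l * ?I z (rad z))"
    proof (rule sum_mono)
      fix z assume z: "z \<in> F"
      have "emeasure circle_measure (B z) \<le> ennreal (2 * (5 * rad z))"
        unfolding B_def using FE[OF z] rad(1)[OF FE[OF z]]
        by (intro emeasure_circle_cball_le) (auto simp: E_def)
      then have "measure circle_measure (B z) \<le> 10 * rad z"
        using rad(1)[OF FE[OF z]] by (simp add: emeasure_eq_measure ennreal_le_iff)
      also have "\<dots> \<le> 10 / l * ?I z (rad z)"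
        using rad(2)[OF FE[OF z]] l by (simp add: field_simps)
      finally show "measure circle_measure (B z) \<le> 10 / l * ?I z (rad z)" .
    qed
    also have "\<dots> = 10 / l * (\<Sum>z\<in>F. ?I z (rad z))" by (simp add: sum_distrib_left)
    also have "(\<Sum>z\<in>F. ?I z (rad z)) = (\<integral>w. (\<Sum>z\<in>F. indicator (cball z (rad z)) w * a w) \<partial>circle_measure)"
      by (rule Bochner_Integration.integral_sum[symmetric]) (rule circle_indicator_cball[OF a])
    also have "\<dots> \<le> A"
      unfolding A_def
    proof (rule integral_mono)
      show "integrable circle_measure (\<lambda>w. \<Sum>z\<in>F. indicator (cball z (rad z)) w * a w)"
        by (rule Bochner_Integration.integrable_sum) (rule circle_indicator_cball[OF a])
      fix w
      have "(\<Sum>z\<in>F. indicator (cball z (rad z)) w :: real) = indicator (\<Union>z\<in>F. cball z (rad z)) w"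
      proof (rule indicator_UN_disjoint[OF F(1), symmetric])
        show "disjoint_family_on (\<lambda>z. cball z (rad z)) F"
          using C(3) F(2) unfolding disjoint_family_on_def pairwise_def disjnt_def by blast
      qed
      also have "\<dots> \<le> 1" by (simp add: indicator_def)
      finally show "(\<Sum>z\<in>F. indicator (cball z (rad z)) w * a w) \<le> a w"
        using nn[of w] by (simp flip: sum_distrib_right add: mult_left_le_one_le sum_nonneg)
    qed (rule a)
    finally show ?thesis using l by (simp add: divide_right_mono)
  qed
  show ?thesis
  proof
    \<comment> \<open>The countable family of discs is exhausted by finite ones, so that the finite
      bound passes to the union by continuity from below.\<close>
    let ?F = "\<lambda>n. {z \<in> C. to_nat_on C z < n}"
    let ?U = "\<Union>n. \<Union>z\<in>?F n. B z"
    have finF: "finite (?F n)" for n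
    proof (rule finite_subset[of _ "from_nat_into C ` {..<n}"])
      show "?F n \<subseteq> from_nat_into C ` {..<n}"
      proof
        fix z assume "z \<in> ?F n"
        then show "z \<in> from_nat_into C ` {..<n}"
          using from_nat_into_to_nat_on[OF C(1)] by (intro image_eqI[of _ _ "to_nat_on C z"]) auto
      qed
    qed simp
    have m: "(\<Union>z\<in>?F n. B z) \<in> sets circle_measure" for n
      using finF B by (intro sets.finite_UN) auto
    then show "?U \<in> sets circle_borel" by (intro sets.countable_UN) auto
    have "incseq (\<lambda>n. \<Union>z\<in>?F n. B z)" by (auto simp: incseq_def)
    then have "(\<lambda>n. measure circle_measure (\<Union>z\<in>?F n. B z)) \<longlonglongrightarrow> measure circle_measure ?U"
      using m by (intro finite_Lim_measure_incseq) auto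
    then show "measure circle_measure ?U \<le> 10 / l * (\<integral>w. a w \<partial>circle_measure)"
      by (rule LIMSEQ_le_const2) (use fin[OF finF] in \<open>auto simp: A_def\<close>)
    fix z h assume z: "cmod z = 1" "z \<notin> ?U" and h: "(h::real) > 0"
    have "z \<notin> E"
    proof
      assume "z \<in> E"
      then obtain c where "c \<in> C" "z \<in> cball c (5 * rad c)" using C(4) by blast
      then have "z \<in> ?U" using z(1) by (auto simp: B_def intro!: exI[of _ "Suc (to_nat_on C c)"] exI[of _ c])
      with z(2) show False by blast
    qed
    then have "\<not> (\<exists>h>0. ?I z h > l * h)" using z(1) unfolding E_def by blast
    then show "?I z h \<le> l * h" using h not_less by blast
  qed
qed

text \<open>If s lies between 2^(i-1) d and 2^i d, the left side is at most 4 / (4^i d^2), which is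
  the i-th term. It replaces a decaying kernel by a combination of indicators of discs.\<close>

lemma inverse_square_dyadic_le:
  fixes d s :: real
  assumes "d > 0" "0 \<le> s" "s \<le> 2 ^ n * d"
  shows "1 / (d + s)\<^sup>2 \<le> (\<Sum>i\<le>n. 4 / (4 ^ i * d\<^sup>2) * (if s \<le> 2 ^ i * d then 1 else 0))"
  using assms(3)
proof (induction n)
  case 0
  have "1 / (d + s)\<^sup>2 \<le> 1 / d\<^sup>2" using assms(1,2) by (intro divide_left_mono power_mono) auto
  also have "\<dots> \<le> 4 / d\<^sup>2" using assms(1) by (intro divide_right_mono) auto
  finally show ?case using 0 by simp
next
  case (Suc n)
  let ?S = "\<lambda>n. \<Sum>i\<le>n. 4 / (4 ^ i * d\<^sup>2) * (if s \<le> 2 ^ i * d then 1 else (0::real))"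
  show ?case
  proof (cases "s \<le> 2 ^ n * d")
    case True
    have "?S n \<le> ?S (Suc n)" by simp
    with Suc.IH[OF True] show ?thesis by linarith
  next
    case False
    have "1 / (d + s)\<^sup>2 \<le> 1 / (2 ^ n * d)\<^sup>2"
      using False assms by (intro divide_left_mono power_mono mult_pos_pos) (auto intro: add_pos_nonneg)
    also have "(2 ^ n * d)\<^sup>2 = 4 ^ n * d\<^sup>2"
    proof -
      have "(4::real) ^ n = 2 ^ n * 2 ^ n" by (simp flip: power_mult_distrib)
      then show ?thesis by (simp add: power2_eq_square)
    qed
    also have "1 / (4 ^ n * d\<^sup>2) = 4 / (4 ^ Suc n * d\<^sup>2) * (if s \<le> 2 ^ Suc n * d then 1 else 0)"
      using Suc.prems by simp
    also have "\<dots> \<le> ?S (Suc n)"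
      by (simp add: sum_nonneg)
    finally show ?thesis .
  qed
qed

text \<open>Both 1 - r <= D and |w - z| <= D + (1 - r), so the denominator's base is at most 3 D.
  The constant is 18 = 2 * 9, the 2 coming from 1 + r <= 2.\<close>

lemma poisson_chord_le:
  assumes "cmod z = 1" "cmod w = 1" "0 \<le> r" "r < 1"
  shows "poisson (of_real r * z) w \<le> 18 * (1 - r) / ((1 - r) + cmod (w - z))\<^sup>2"
proof -
  define D where "D = cmod (w - of_real r * z)"
  have 1: "1 - r \<le> D" using norm_triangle_ineq2[of w "of_real r * z"] assms by (simp add: D_def norm_mult)
  have "cmod (of_real r * z - z) = 1 - r"
  proof -
    have "of_real r * z - z = of_real (r - 1) * z" by (simp add: algebra_simps)
    then show ?thesis using assms by (simp only: norm_mult norm_of_real) simp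
  qed
  then have 2: "cmod (w - z) \<le> D + (1 - r)"
    using norm_triangle_ineq[of "w - of_real r * z" "of_real r * z - z"] by (simp add: D_def)
  have 3: "((1 - r) + cmod (w - z))\<^sup>2 \<le> (3 * D)\<^sup>2" using 1 2 assms by (intro power_mono) auto
  have pos: "(1 - r) + cmod (w - z) > 0" "D > 0" using 1 assms by (auto intro: add_pos_nonneg)
  have "poisson (of_real r * z) w = (1 - r) * (1 + r) / D\<^sup>2"
    using assms by (simp add: poisson_def D_def norm_mult power2_eq_square algebra_simps)
  also have "\<dots> \<le> (1 - r) * 2 / D\<^sup>2" using assms by (intro divide_right_mono mult_left_mono) auto
  also have "\<dots> = 18 * (1 - r) / (3 * D)\<^sup>2"
    using pos(2) by (simp add: power_mult_distrib field_simps)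
  also have "\<dots> \<le> 18 * (1 - r) / ((1 - r) + cmod (w - z))\<^sup>2"
    using assms pos 3 by (intro divide_left_mono) auto
  finally show ?thesis .
qed

text \<open>The kernel is dominated by dyadic discs about z, with i-th coefficient 72 / (4^i d).
  Inserting the bound l * 2^i * d for each disc leaves a geometric series 72 l 2^(-i), of sum at
  most 144 l.\<close>

lemma poisson_le_maximal:
  fixes a :: "complex \<Rightarrow> real"
  assumes a: "integrable circle_measure a" and nn: "\<And>w. a w \<ge> 0" and l: "l > 0"
    and z: "cmod z = 1" and r: "0 \<le> r" "r < 1"
    and M: "\<And>h. h > 0 \<Longrightarrow> (\<integral>w. indicator (cball z h) w * a w \<partial>circle_measure) \<le> l * h"
  shows "(\<integral>w. a w * poisson (of_real r * z) w \<partial>circle_measure) \<le> 144 * l"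
proof -
  define d where "d = 1 - r"
  have d: "d > 0" using r by (simp add: d_def)
  have rz: "cmod (of_real r * z) < 1" using z r by (simp add: norm_mult)
  \<comment> \<open>The circle has diameter 2, so the disc of radius 2^n d about z contains all of
    it.\<close>
  obtain n where n: "2 / d < 2 ^ n" using real_arch_pow[of 2 "2 / d"] by auto
  let ?c = "\<lambda>i. 18 * d * (4 / (4 ^ i * d\<^sup>2)) :: real"
  have i: "integrable circle_measure (\<lambda>w. ?c i * (indicator (cball z (2 ^ i * d)) w * a w))" for i
    by (intro integrable_mult_right circle_indicator_cball a)
  have "(\<integral>w. a w * poisson (of_real r * z) w \<partial>circle_measure)
    \<le> (\<integral>w. (\<Sum>i\<le>n. ?c i * (indicator (cball z (2 ^ i * d)) w * a w)) \<partial>circle_measure)"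
  proof (rule integral_mono)
    show "integrable circle_measure (\<lambda>w. a w * poisson (of_real r * z) w)"
      using poisson_mult_integrable[OF a rz] by simp
    show "integrable circle_measure (\<lambda>w. \<Sum>i\<le>n. ?c i * (indicator (cball z (2 ^ i * d)) w * a w))"
      by (intro Bochner_Integration.integrable_sum i)
    fix w assume "w \<in> space circle_measure"
    then have w: "cmod w = 1" by simp
    have "cmod (w - z) \<le> 2" using norm_triangle_ineq4[of w z] w z by simp
    also have "\<dots> \<le> 2 ^ n * d" using n d by (simp add: field_simps)
    finally have s: "cmod (w - z) \<le> 2 ^ n * d" .
    have "poisson (of_real r * z) w \<le> 18 * d * (1 / (d + cmod (w - z))\<^sup>2)"
      using poisson_chord_le[OF z w r] by (simp add: d_def)
    also have "\<dots> \<le> 18 * d * (\<Sum>i\<le>n. 4 / (4 ^ i * d\<^sup>2) * (if cmod (w - z) \<le> 2 ^ i * d then 1 else 0))"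
      using inverse_square_dyadic_le[OF d _ s] d by (intro mult_left_mono) auto
    also have "\<dots> = (\<Sum>i\<le>n. ?c i * indicator (cball z (2 ^ i * d)) w)"
      unfolding sum_distrib_left
      by (intro sum.cong refl) (auto simp: indicator_def dist_norm norm_minus_commute)
    finally have "a w * poisson (of_real r * z) w \<le> a w * (\<Sum>i\<le>n. ?c i * indicator (cball z (2 ^ i * d)) w)"
      using nn[of w] by (rule mult_left_mono)
    then show "a w * poisson (of_real r * z) w \<le> (\<Sum>i\<le>n. ?c i * (indicator (cball z (2 ^ i * d)) w * a w))"
      by (simp add: sum_distrib_left mult_ac)
  qed
  also have "\<dots> = (\<Sum>i\<le>n. ?c i * (\<integral>w. indicator (cball z (2 ^ i * d)) w * a w \<partial>circle_measure))"
    by (subst Bochner_Integration.integral_sum[OF i]) simp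
  also have "\<dots> \<le> (\<Sum>i\<le>n. ?c i * (l * (2 ^ i * d)))"
    using d by (intro sum_mono mult_left_mono M) auto
  also have "\<dots> = (\<Sum>i\<le>n. 72 * l * (1/2) ^ i)"
  proof (rule sum.cong[OF refl])
    fix i
    have "(4::real) ^ i = 2 ^ i * 2 ^ i" by (simp flip: power_mult_distrib)
    then show "?c i * (l * (2 ^ i * d)) = 72 * l * (1/2) ^ i"
      using d by (simp add: power2_eq_square field_simps power_divide)
  qed
  also have "\<dots> = 72 * l * (\<Sum>i\<le>n. (1/2) ^ i)" by (rule sum_distrib_left[symmetric])
  also have "(\<Sum>i\<le>n. (1/2) ^ i) \<le> (2::real)"
    using sum_gp_basic[of "1/2::real" n] by simp
  finally show ?thesis using l by simp
qed

text \<open>The maximal estimate is applied to |f|^2 at level c^2 / 144, and Jensen returns to f.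
  This gives the weak L2 bound directly from the weak L1 one; 1440 = 10 * 144.\<close>

lemma poisson_radial_maximal:
  assumes f: "f \<in> L2_fun circle_measure" and c: "c > 0"
  obtains U where "U \<in> sets circle_borel"
    "measure circle_measure U \<le> 1440 / c\<^sup>2 * (L2_norm circle_measure f)\<^sup>2"
    "\<And>z r. cmod z = 1 \<Longrightarrow> z \<notin> U \<Longrightarrow> 0 \<le> r \<Longrightarrow> r < 1 \<Longrightarrow>
      cmod (\<integral>w. f w * of_real (poisson (of_real r * z) w) \<partial>circle_measure) \<le> c"
proof -
  let ?a = "\<lambda>w. (cmod (f w))\<^sup>2"
  have l: "c\<^sup>2 / 144 > 0" using c by simp
  from circle_maximal_weak_type[OF L2_funD(2)[OF f] _ l] obtain U where U: "U \<in> sets circle_borel"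
    "measure circle_measure U \<le> 10 / (c\<^sup>2 / 144) * (\<integral>w. ?a w \<partial>circle_measure)"
    and M: "\<And>z h. cmod z = 1 \<Longrightarrow> z \<notin> U \<Longrightarrow> h > 0 \<Longrightarrow>
      (\<integral>w. indicator (cball z h) w * ?a w \<partial>circle_measure) \<le> c\<^sup>2 / 144 * h"
    by auto
  show ?thesis
  proof
    show "measure circle_measure U \<le> 1440 / c\<^sup>2 * (L2_norm circle_measure f)\<^sup>2"
      using U(2) by (simp add: L2_norm_sq)
    fix z and r :: real assume z: "cmod z = 1" "z \<notin> U" and r: "0 \<le> r" "r < 1"
    have rz: "cmod (of_real r * z) < 1" using z r by (simp add: norm_mult)
    have "(cmod (\<integral>w. f w * of_real (poisson (of_real r * z) w) \<partial>circle_measure))\<^sup>2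
      \<le> (\<integral>w. ?a w * poisson (of_real r * z) w \<partial>circle_measure)"
      by (rule poisson_integral_sq_le[OF f rz])
    also have "\<dots> \<le> 144 * (c\<^sup>2 / 144)"
      by (rule poisson_le_maximal[OF L2_funD(2)[OF f] _ l z(1) r M]) (use z in auto)
    finally show "cmod (\<integral>w. f w * of_real (poisson (of_real r * z) w) \<partial>circle_measure) \<le> c"
      using c by (simp add: power2_le_iff_abs_le)
  qed (rule U(1))
qed

lemma L2_Chebyshev:
  assumes f: "f \<in> L2_fun circle_measure" and c: "c > 0"
  shows "{z \<in> unit_circle. cmod (f z) \<ge> c} \<in> sets circle_borel"
    "measure circle_measure {z \<in> unit_circle. cmod (f z) \<ge> c} \<le> (L2_norm circle_measure f)\<^sup>2 / c\<^sup>2"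
proof -
  interpret finite_measure circle_measure by (rule finite_measure_circle_measure)
  let ?A = "{z \<in> unit_circle. cmod (f z) \<ge> c}"
  have mf [measurable]: "f \<in> borel_measurable circle_measure" by (rule L2_funD[OF f])
  have "{z \<in> space circle_measure. cmod (f z) \<ge> c} \<in> sets circle_measure" by measurable
  then show A: "?A \<in> sets circle_borel" by simp
  have "c\<^sup>2 * measure circle_measure ?A = (\<integral>z. c\<^sup>2 * indicator ?A z \<partial>circle_measure)"
  proof -
    have "?A \<inter> space circle_measure = ?A" by auto
    then show ?thesis by simp
  qed
  also have "\<dots> \<le> (\<integral>z. (cmod (f z))\<^sup>2 \<partial>circle_measure)"
  proof (rule integral_mono)
    show "integrable circle_measure (\<lambda>z. c\<^sup>2 * indicator ?A z)"
      using indicator_mult_integrable[OF integrable_const[of "c\<^sup>2"], of ?A] A by (simp add: mult.commute)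
    fix z show "c\<^sup>2 * indicator ?A z \<le> (cmod (f z))\<^sup>2"
      using c by (auto simp: indicator_def intro!: power_mono)
  qed (rule L2_funD[OF f])
  finally show "measure circle_measure ?A \<le> (L2_norm circle_measure f)\<^sup>2 / c\<^sup>2"
    using c unfolding L2_norm_sq by (simp add: field_simps)
qed

section \<open>Completeness of model spaces and coercive operators\<close>

text \<open>The candidate holomorphic function is the Poisson integral G of g: holomorphic as a
  locally uniform limit of the F n, with dilates bounded by the norm of g. That G has radial limits
  g is an exchange of limits, justified by a bound on F n - G uniform along almost every
  radius.\<close>

lemma H2_closed:
  assumes fn: "\<And>n. f n \<in> H2" and g: "g \<in> L2_fun circle_measure"
    and lim: "(\<lambda>n. L2_norm circle_measure (\<lambda>z. f n z - g z)) \<longlonglongrightarrow> 0"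
  shows "g \<in> H2"
proof -
  let ?N = "L2_norm circle_measure"
  let ?P = "\<lambda>f a. \<integral>w. f w * of_real (poisson a w) \<partial>circle_measure"
  interpret finite_measure circle_measure by (rule finite_measure_circle_measure)
  have fL: "f n \<in> L2_fun circle_measure" for n by (rule H2_L2_fun[OF fn])
  have d: "(\<lambda>z. f n z - g z) \<in> L2_fun circle_measure" for n by (intro L2_fun_diff fL g)
  have "\<exists>F. \<forall>n. F n \<in> hardy2_disc \<and> radial_boundary_function (F n) (f n)"
    using fn by (intro choice) (auto simp: H2_def)
  then obtain F where F: "\<And>n. F n \<in> hardy2_disc" "\<And>n. radial_boundary_function (F n) (f n)" by blast
  have FP: "F n a = ?P (f n) a" if "cmod a < 1" for n a
    by (rule hardy2_poisson_representation[OF F fL that])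
  define G where "G a = ?P g a" for a
  have FG: "cmod (F n a - G a) \<le> 2 / (1 - cmod a) * ?N (\<lambda>z. f n z - g z)" if a: "cmod a < 1" for n a
  proof -
    have "cmod (F n a - G a) \<le> 2 / (1 - cmod a) * (\<integral>w. cmod (f n w - g w) \<partial>circle_measure)"
      unfolding FP[OF a] G_def by (rule poisson_integral_diff_le[OF fL g a])
    also have "\<dots> \<le> 2 / (1 - cmod a) * ?N (\<lambda>z. f n z - g z)"
      using a by (intro mult_left_mono circle_integral_le_L2_norm d) auto
    finally show ?thesis .
  qed
  have hol: "G holomorphic_on unit_disc"
  proof (rule holomorphic_uniform_sequence[of _ F])
    show "open unit_disc" by simp
    show "F n holomorphic_on unit_disc" for n using F(1)[of n] by (simp add: hardy2_disc_def)
    fix x :: complex assume "x \<in> unit_disc"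
    then have x: "cmod x < 1" by simp
    \<comment> \<open>The disc of radius (1 - |x|) / 2 about x stays within modulus R < 1, where the
      Poisson bound has a fixed constant.\<close>
    define R where "R = (1 + cmod x) / 2"
    have R: "R < 1" "cmod x + (1 - cmod x) / 2 = R" using x by (auto simp: R_def field_simps)
    have cb: "cmod a \<le> R" if "a \<in> cball x ((1 - cmod x) / 2)" for a
    proof -
      have "cmod (a - x) \<le> (1 - cmod x) / 2" using that by (simp add: dist_norm norm_minus_commute)
      then show ?thesis using norm_triangle_ineq2[of a x] R(2) by linarith
    qed
    show "\<exists>d>0. cball x d \<subseteq> unit_disc \<and> uniform_limit (cball x d) F G sequentially"
    proof (intro exI[of _ "(1 - cmod x) / 2"] conjI)
      show "cball x ((1 - cmod x) / 2) \<subseteq> unit_disc"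
        using cb R(1) by fastforce
      show "uniform_limit (cball x ((1 - cmod x) / 2)) F G sequentially"
      proof (rule uniform_limitI)
        fix e :: real assume e: "e > 0"
        have "(\<lambda>n. 2 / (1 - R) * ?N (\<lambda>z. f n z - g z)) \<longlonglongrightarrow> 0"
          using tendsto_mult_right_zero[OF lim] .
        from order_tendstoD(2)[OF this e]
        show "\<forall>\<^sub>F n in sequentially. \<forall>a\<in>cball x ((1 - cmod x) / 2). dist (F n a) (G a) < e"
        proof eventually_elim
          case (elim n)
          show ?case
          proof
            fix a assume a: "a \<in> cball x ((1 - cmod x) / 2)"
            have a1: "cmod a < 1" using cb[OF a] R(1) by simp
            have "dist (F n a) (G a) \<le> 2 / (1 - cmod a) * ?N (\<lambda>z. f n z - g z)"
              using FG[OF a1] by (simp add: dist_norm)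
            also have "\<dots> \<le> 2 / (1 - R) * ?N (\<lambda>z. f n z - g z)"
              using cb[OF a] R(1) a1 by (intro mult_right_mono divide_left_mono) auto
            finally show "dist (F n a) (G a) < e" using elim by linarith
          qed
        qed
      qed
    qed (use x in simp)
  qed
  have rz: "cmod (of_real r * z) < 1" if "cmod z = 1" "0 \<le> r" "r < 1" for r z
    using that by (simp add: norm_mult)
  have GH: "G \<in> hardy2_disc"
    unfolding hardy2_disc_iff
  proof (intro conjI hol exI[of _ "?N g"] ballI)
    fix r :: real assume "r \<in> {0..<1}"
    then have r: "0 \<le> r" "r < 1" by auto
    show "?N (\<lambda>z. G (of_real r * z)) \<le> ?N g"
      by (rule poisson_dilate_norm_le[OF g r hardy2_disc_dilate_L2_fun[OF hol r]]) (simp add: G_def)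
  qed
  \<comment> \<open>Error 4^(-j) against threshold 2^(-j): the weak type and Chebyshev bounds then
    leave exceptional sets of measure at most (1440 + 1) * 4^(-j), which is summable.\<close>
  have "\<exists>k. \<forall>j. ?N (\<lambda>z. f (k j) z - g z) < (1/4) ^ j"
  proof (intro choice allI)
    fix j
    from order_tendstoD(2)[OF lim, of "(1/4) ^ j"]
    show "\<exists>n. ?N (\<lambda>z. f n z - g z) < (1/4) ^ j"
      by (auto simp: eventually_sequentially)
  qed
  then obtain k where k: "\<And>j. ?N (\<lambda>z. f (k j) z - g z) < (1/4) ^ j" by blast
  have "\<exists>U. \<forall>j. U j \<in> sets circle_borel \<and> measure circle_measure (U j) \<le> 1441 * (1/4) ^ j \<and>
    (\<forall>z. cmod z = 1 \<longrightarrow> z \<notin> U j \<longrightarrow> cmod (f (k j) z - g z) \<le> (1/2) ^ j \<and>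
      (\<forall>r. 0 \<le> r \<longrightarrow> r < 1 \<longrightarrow> cmod (F (k j) (of_real r * z) - G (of_real r * z)) \<le> (1/2) ^ j))"
  proof (intro choice allI)
    fix j
    let ?c = "(1/2) ^ j :: real" and ?d = "\<lambda>z. f (k j) z - g z"
    let ?V = "{z \<in> unit_circle. cmod (?d z) \<ge> ?c}"
    have c: "?c > 0" by simp
    have c2: "?c\<^sup>2 = (1/4) ^ j" by (simp add: power2_eq_square flip: power_mult_distrib)
    obtain U where U: "U \<in> sets circle_borel" "measure circle_measure U \<le> 1440 / ?c\<^sup>2 * (?N ?d)\<^sup>2"
      and rad: "\<And>z r. cmod z = 1 \<Longrightarrow> z \<notin> U \<Longrightarrow> 0 \<le> r \<Longrightarrow> r < 1 \<Longrightarrow> cmod (?P ?d (of_real r * z)) \<le> ?c"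
      by (rule poisson_radial_maximal[OF d c]) blast
    note V = L2_Chebyshev[OF d[of "k j"] c]
    have q: "(?N ?d)\<^sup>2 \<le> (1/4) ^ j * ?c\<^sup>2"
      unfolding c2 using power_mono[OF less_imp_le[OF k[of j]], of 2] by (simp add: power2_eq_square)
    show "\<exists>U. U \<in> sets circle_borel \<and> measure circle_measure U \<le> 1441 * (1/4) ^ j \<and>
      (\<forall>z. cmod z = 1 \<longrightarrow> z \<notin> U \<longrightarrow> cmod (f (k j) z - g z) \<le> (1/2) ^ j \<and>
      (\<forall>r. 0 \<le> r \<longrightarrow> r < 1 \<longrightarrow> cmod (F (k j) (of_real r * z) - G (of_real r * z)) \<le> (1/2) ^ j))"
    proof (intro exI[of _ "U \<union> ?V"] conjI allI impI)
      show "U \<union> ?V \<in> sets circle_borel" using U(1) V(1) by (rule sets.Un)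
      have "measure circle_measure (U \<union> ?V) \<le> measure circle_measure U + measure circle_measure ?V"
        using U(1) V(1) by (intro measure_Un_le) auto
      also have "\<dots> \<le> 1440 / ?c\<^sup>2 * ((1/4) ^ j * ?c\<^sup>2) + ((1/4) ^ j * ?c\<^sup>2) / ?c\<^sup>2"
        using mult_left_mono[OF q, of "1440 / ?c\<^sup>2"] divide_right_mono[OF q, of "?c\<^sup>2"] U(2) V(2) by simp
      also have "\<dots> = 1441 * (1/4) ^ j" by simp
      finally show "measure circle_measure (U \<union> ?V) \<le> 1441 * (1/4) ^ j" .
      fix z :: complex assume z: "cmod z = 1" "z \<notin> U \<union> ?V"
      then show "cmod (f (k j) z - g z) \<le> ?c" by auto
      fix r :: real assume r: "0 \<le> r" "r < 1"
      show "cmod (F (k j) (of_real r * z) - G (of_real r * z)) \<le> ?c"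
        using rad[OF z(1) _ r] z(2) unfolding FP[OF rz[OF z(1) r]] G_def
        by (subst poisson_integral_diff[OF fL g rz[OF z(1) r], symmetric]) simp
    qed
  qed
  then obtain U where U: "\<And>j. U j \<in> sets circle_borel" "\<And>j. measure circle_measure (U j) \<le> 1441 * (1/4) ^ j"
    and Uf: "\<And>j z. cmod z = 1 \<Longrightarrow> z \<notin> U j \<Longrightarrow> cmod (f (k j) z - g z) \<le> (1/2) ^ j"
    and UF: "\<And>j z r. cmod z = 1 \<Longrightarrow> z \<notin> U j \<Longrightarrow> 0 \<le> r \<Longrightarrow> r < 1 \<Longrightarrow>
      cmod (F (k j) (of_real r * z) - G (of_real r * z)) \<le> (1/2) ^ j"
    by metis
  \<comment> \<open>By Borel-Cantelli almost every z escapes all but finitely many of the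
    exceptional sets.\<close>
  have "AE z in circle_measure. \<forall>\<^sub>F j in sequentially. z \<in> space circle_measure - U j"
  proof (rule borel_cantelli_AE1)
    have "summable (\<lambda>j. 1441 * (1/4::real) ^ j)" by (intro summable_mult summable_geometric) simp
    then show "summable (\<lambda>j. measure circle_measure (U j))"
      by (rule summable_comparison_test'[where N=0]) (use U(2) in simp)
  qed (use U(1) in \<open>auto simp: less_top[symmetric]\<close>)
  moreover have "AE z in circle_measure. \<forall>n. ((\<lambda>r. F n (of_real r * z)) \<longlongrightarrow> f n z) (at_left 1)"
    using F(2) unfolding radial_boundary_function_def by (simp add: AE_all_countable)
  ultimately have "radial_boundary_function G g"
    unfolding radial_boundary_function_def
  proof eventually_elim
    fix z
    assume ev: "\<forall>\<^sub>F j in sequentially. z \<in> space circle_measure - U j"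
      and lims: "\<forall>n. ((\<lambda>r. F n (of_real r * z)) \<longlongrightarrow> f n z) (at_left 1)"
    show "((\<lambda>r. G (of_real r * z)) \<longlongrightarrow> g z) (at_left 1)"
    proof (rule tendstoI)
      fix e :: real assume e: "e > 0"
      have "(\<lambda>j. (1/2::real) ^ j) \<longlonglongrightarrow> 0" by (rule LIMSEQ_power_zero) simp
      from order_tendstoD(2)[OF this, of "e/3"] e
      have "\<forall>\<^sub>F j in sequentially. (1/2) ^ j < e / 3" by simp
      with ev have "\<forall>\<^sub>F j in sequentially. z \<in> space circle_measure - U j \<and> (1/2) ^ j < e / 3"
        by (rule eventually_conj)
      \<comment> \<open>One j is fixed before r tends to 1. This is legitimate because the estimate
        of F (k j) - G holds for all radii at once.\<close>
      then obtain j where "z \<in> space circle_measure - U j" and j: "(1/2) ^ j < e / 3"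
        using eventually_happens'[OF sequentially_bot] by blast
      then have z: "cmod z = 1" "z \<notin> U j" by auto
      have "\<forall>\<^sub>F r in at_left 1. dist (F (k j) (of_real r * z)) (f (k j) z) < e / 3"
        using lims e by (intro tendstoD) auto
      moreover have "\<forall>\<^sub>F r in at_left (1::real). r \<in> {0<..<1}"
        by (rule eventually_at_left_real) simp
      ultimately show "\<forall>\<^sub>F r in at_left 1. dist (G (of_real r * z)) (g z) < e"
      proof eventually_elim
        case (elim r)
        have "cmod (G (of_real r * z) - g z) \<le> cmod (F (k j) (of_real r * z) - G (of_real r * z))
            + cmod (F (k j) (of_real r * z) - f (k j) z) + cmod (f (k j) z - g z)"
          using norm_triangle_ineq[of "F (k j) (of_real r * z) - f (k j) z" "f (k j) z - g z"]
            norm_triangle_ineq4[of "F (k j) (of_real r * z) - g z" "F (k j) (of_real r * z) - G (of_real r * z)"]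
          by simp
        moreover have "cmod (F (k j) (of_real r * z) - G (of_real r * z)) \<le> (1/2) ^ j"
          using UF[OF z] elim(2) by simp
        ultimately show ?case
          using Uf[OF z] j elim(1) by (simp add: dist_norm)
      qed
    qed
  qed
  with GH g show ?thesis by (auto simp: H2_def)
qed

lemma model_space_closed:
  assumes "inner_function \<Theta>" and fn: "\<And>n. f n \<in> model_space \<Theta>" and g: "g \<in> L2_fun circle_measure"
    and lim: "(\<lambda>n. L2_norm circle_measure (\<lambda>z. f n z - g z)) \<longlonglongrightarrow> 0"
  shows "g \<in> model_space \<Theta>"
proof -
  have "g \<in> H2"
    by (rule H2_closed[OF _ g lim]) (use fn in \<open>simp add: model_space_def\<close>)
  moreover have "L2_inner circle_measure g (\<lambda>z. \<Theta> z * h z) = 0" if h: "h \<in> H2" for h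
  proof -
    have "(\<lambda>n. L2_inner circle_measure (f n) (\<lambda>z. \<Theta> z * h z)) \<longlonglongrightarrow> L2_inner circle_measure g (\<lambda>z. \<Theta> z * h z)"
      by (rule L2_inner_tendsto[OF model_space_L2_fun[OF fn] g
            inner_function_mult_L2_fun[OF assms(1) H2_L2_fun[OF h]] lim])
    moreover have "L2_inner circle_measure (f n) (\<lambda>z. \<Theta> z * h z) = 0" for n
      using fn[of n] h by (simp add: model_space_def)
    ultimately show ?thesis by (simp add: LIMSEQ_const_iff)
  qed
  ultimately show ?thesis by (simp add: model_space_def)
qed

section \<open>Inversion of coercive operators on the model space\<close>

lemma model_operatorD:
  assumes "model_operator \<Theta> A"
  shows "f \<in> model_space \<Theta> \<Longrightarrow> A f \<in> model_space \<Theta>"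
    and "f \<in> model_space \<Theta> \<Longrightarrow> g \<in> model_space \<Theta> \<Longrightarrow>
      eq_ae circle_measure (A (\<lambda>z. f z + g z)) (\<lambda>z. A f z + A g z)"
    and "f \<in> model_space \<Theta> \<Longrightarrow> eq_ae circle_measure (A (\<lambda>z. c * f z)) (\<lambda>z. c * A f z)"
    and "\<exists>M>0. \<forall>f\<in>model_space \<Theta>. L2_norm circle_measure (A f) \<le> M * L2_norm circle_measure f"
proof -
  have A: "L2_bounded_linear circle_measure (model_space \<Theta>) circle_measure (model_space \<Theta>) A"
    using assms by (simp add: model_operator_def)
  then show "f \<in> model_space \<Theta> \<Longrightarrow> A f \<in> model_space \<Theta>"
    "f \<in> model_space \<Theta> \<Longrightarrow> g \<in> model_space \<Theta> \<Longrightarrow> eq_ae circle_measure (A (\<lambda>z. f z + g z)) (\<lambda>z. A f z + A g z)"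
    "f \<in> model_space \<Theta> \<Longrightarrow> eq_ae circle_measure (A (\<lambda>z. c * f z)) (\<lambda>z. c * A f z)"
    unfolding L2_bounded_linear_def by blast+
  obtain C where C: "\<And>f. f \<in> model_space \<Theta> \<Longrightarrow> L2_norm circle_measure (A f) \<le> C * L2_norm circle_measure f"
    using A unfolding L2_bounded_linear_def by blast
  \<comment> \<open>The bound in the definition may carry any real constant; enlarging it makes it
    positive, so that later arguments can divide by it.\<close>
  have "L2_norm circle_measure (A f) \<le> (\<bar>C\<bar> + 1) * L2_norm circle_measure f" if "f \<in> model_space \<Theta>" for f
  proof -
    have "C * L2_norm circle_measure f \<le> (\<bar>C\<bar> + 1) * L2_norm circle_measure f"
      by (rule mult_right_mono) auto
    with C[OF that] show ?thesis by linarith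
  qed
  then show "\<exists>M>0. \<forall>f\<in>model_space \<Theta>. L2_norm circle_measure (A f) \<le> M * L2_norm circle_measure f"
    by (intro exI[of _ "\<bar>C\<bar> + 1"]) auto
qed

lemma model_operator_diff:
  assumes "inner_function \<Theta>" "model_operator \<Theta> A" "f \<in> model_space \<Theta>" "g \<in> model_space \<Theta>"
  shows "eq_ae circle_measure (A (\<lambda>z. f z - g z)) (\<lambda>z. A f z - A g z)"
proof -
  have "eq_ae circle_measure (A (\<lambda>z. f z + (-1) * g z)) (\<lambda>z. A f z - A g z)"
    using model_operatorD(2)[OF assms(2,3) model_space_scale[OF assms(4), of "-1"]]
      model_operatorD(3)[OF assms(2,4), of "-1"]
    unfolding eq_ae_def by eventually_elim simp
  then show ?thesis by simp
qed

text \<open>Solves \<open>A x = y\<close> by the iteration \<open>x \<mapsto> x - t (A x - y)\<close>, a contraction for small \<open>t\<close>.\<close>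

lemma coercive_surjective:
  assumes inn: "inner_function \<Theta>" and A: "model_operator \<Theta> A" and c: "c > 0"
    and coercive: "\<And>f. f \<in> model_space \<Theta> \<Longrightarrow>
      c * (L2_norm circle_measure f)\<^sup>2 \<le> Re (L2_inner circle_measure (A f) f)"
    and y: "y \<in> model_space \<Theta>"
  shows "\<exists>x\<in>model_space \<Theta>. eq_ae circle_measure (A x) y"
proof -
  let ?N = "L2_norm circle_measure" and ?K = "model_space \<Theta>"
  note KL = model_space_L2_fun[of _ \<Theta>]
  note AK = model_operatorD(1)[OF A]
  obtain M where M: "M > 0" "\<And>f. f \<in> ?K \<Longrightarrow> ?N (A f) \<le> M * ?N f"
    using model_operatorD(4)[OF A] by blast
  \<comment> \<open>Adding c guarantees c <= M', so that 1 - c^2 / M'^2 has a real square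
    root.\<close>
  define M' where "M' = M + c"
  have M': "M' > 0" "c \<le> M'" using M c by (auto simp: M'_def)
  have M'N: "?N (A f) \<le> M' * ?N f" if "f \<in> ?K" for f
  proof -
    have "M * ?N f \<le> M' * ?N f" using c by (intro mult_right_mono) (auto simp: M'_def)
    with M(2)[OF that] show ?thesis by linarith
  qed
  \<comment> \<open>This t minimizes 1 - 2 t c + t^2 M'^2, with minimum 1 - c^2 / M'^2, the square
    of the contraction factor q.\<close>
  define t where "t = c / M'\<^sup>2"
  define q where "q = sqrt (1 - c\<^sup>2 / M'\<^sup>2)"
  have t: "t > 0" using c M' by (simp add: t_def)
  have cM: "c\<^sup>2 / M'\<^sup>2 \<le> 1" "c\<^sup>2 / M'\<^sup>2 > 0" using c M' by (auto simp: power_mono)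
  have q: "0 \<le> q" "q < 1" using cM by (auto simp: q_def real_sqrt_lt_1_iff)
  have contr: "?N (\<lambda>z. f z - of_real t * A f z) \<le> q * ?N f" if f: "f \<in> ?K" for f
  proof (rule power2_le_imp_le)
    have sc: "L2_inner circle_measure f (\<lambda>z. of_real t * A f z) = of_real t * cnj (L2_inner circle_measure (A f) f)"
    proof -
      have "L2_inner circle_measure f (A f) = cnj (L2_inner circle_measure (A f) f)"
        unfolding L2_inner_def by (subst Bochner_Integration.integral_cnj[symmetric]) (simp add: mult.commute)
      then show ?thesis by (simp add: L2_inner_scale_right)
    qed
    have "(?N (\<lambda>z. f z - of_real t * A f z))\<^sup>2 = (?N f)\<^sup>2 - 2 * (t * Re (L2_inner circle_measure (A f) f)) + t\<^sup>2 * (?N (A f))\<^sup>2"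
      using L2_norm_sq_diff[OF KL[OF f] L2_fun_scale[OF KL[OF AK[OF f]]], of "of_real t"]
      unfolding sc by (simp add: L2_norm_scale power_mult_distrib)
    also have "\<dots> \<le> (?N f)\<^sup>2 - 2 * (t * (c * (?N f)\<^sup>2)) + t\<^sup>2 * (M' * ?N f)\<^sup>2"
      using t coercive[OF f] M'N[OF f] by (intro add_mono diff_left_mono mult_left_mono power_mono) auto
    also have "\<dots> = (1 - c\<^sup>2 / M'\<^sup>2) * (?N f)\<^sup>2"
      using M'(1) by (simp add: t_def power2_eq_square field_simps)
    also have "\<dots> = (q * ?N f)\<^sup>2" using cM by (simp add: q_def power_mult_distrib)
    finally show "(?N (\<lambda>z. f z - of_real t * A f z))\<^sup>2 \<le> (q * ?N f)\<^sup>2" .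
  qed (use q in simp)
  define x where "x n = ((\<lambda>u z. u z - of_real t * (A u z - y z)) ^^ n) (\<lambda>z. 0)" for n
  have x_Suc: "x (Suc n) = (\<lambda>z. x n z - of_real t * (A (x n) z - y z))" for n by (simp add: x_def)
  have xK: "x n \<in> ?K" for n
  proof (induction n)
    case 0
    show ?case by (simp add: x_def model_space_zero)
  next
    case (Suc n)
    then show ?case unfolding x_Suc
      by (intro model_space_diff[OF inn] model_space_scale AK y)
  qed
  \<comment> \<open>A is additive only up to null sets, so the increment recursion holds almost
    everywhere and is used through its norm.\<close>
  have step: "?N (\<lambda>z. x (Suc (Suc n)) z - x (Suc n) z) \<le> q * ?N (\<lambda>z. x (Suc n) z - x n z)" for n
  proof -
    let ?d = "\<lambda>z. x (Suc n) z - x n z"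
    have dK: "?d \<in> ?K" by (intro model_space_diff[OF inn] xK)
    have "eq_ae circle_measure (\<lambda>z. x (Suc (Suc n)) z - x (Suc n) z) (\<lambda>z. ?d z - of_real t * A ?d z)"
      using model_operator_diff[OF inn A xK[of "Suc n"] xK[of n]] unfolding eq_ae_def
    proof eventually_elim
      fix z assume e: "A ?d z = A (x (Suc n)) z - A (x n) z"
      have "x (Suc (Suc n)) z - x (Suc n) z = ?d z - of_real t * (A (x (Suc n)) z - A (x n) z)"
        unfolding x_Suc[of "Suc n"] x_Suc[of n] by (simp add: algebra_simps)
      then show "x (Suc (Suc n)) z - x (Suc n) z = ?d z - of_real t * A ?d z" by (simp only: e)
    qed
    then have "?N (\<lambda>z. x (Suc (Suc n)) z - x (Suc n) z) = ?N (\<lambda>z. ?d z - of_real t * A ?d z)"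
      by (rule L2_norm_cong; intro L2_funD(1) L2_fun_diff L2_fun_scale KL xK AK dK)
    with contr[OF dK] show ?thesis by simp
  qed
  define D where "D = ?N (\<lambda>z. x (Suc 0) z - x 0 z)"
  have geo: "?N (\<lambda>z. x (Suc n) z - x n z) \<le> q ^ n * D" for n
  proof (induction n)
    case (Suc n)
    have "q * ?N (\<lambda>z. x (Suc n) z - x n z) \<le> q * (q ^ n * D)" by (rule mult_left_mono[OF Suc q(1)])
    with step[of n] show ?case by (simp add: mult.assoc)
  qed (simp add: D_def)
  have far: "?N (\<lambda>z. x (n + m) z - x n z) \<le> q ^ n * D / (1 - q)" for n m
  proof -
    have "?N (\<lambda>z. x (n + m) z - x n z) \<le> (\<Sum>i<m. q ^ (n + i) * D)"
    proof (induction m)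
      case 0
      then show ?case by (simp add: L2_norm_def)
    next
      case (Suc m)
      show ?case
        using L2_norm_triangle_diff[OF KL[OF xK[of "Suc (n + m)"]] KL[OF xK[of "n + m"]] KL[OF xK[of n]]]
          geo[of "n + m"] Suc by simp
    qed
    also have "\<dots> = q ^ n * D * (\<Sum>i<m. q ^ i)" by (simp add: power_add sum_distrib_left mult_ac)
    also have "\<dots> \<le> q ^ n * D * (1 / (1 - q))"
    proof (rule mult_left_mono)
      show "(\<Sum>i<m. q ^ i) \<le> 1 / (1 - q)"
        using sum_le_suminf[of "\<lambda>i. q ^ i" "{..<m}"] q suminf_geometric[of q] summable_geometric[of q] by simp
    qed (use q in \<open>simp add: D_def\<close>)
    finally show ?thesis by simp
  qed
  have q_lim: "(\<lambda>n. 2 * (q ^ n * D / (1 - q))) \<longlonglongrightarrow> 0"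
    using tendsto_mult_right_zero[OF LIMSEQ_power_zero[of q], of "2 * D / (1 - q)"] q by (simp add: mult_ac)
  obtain u where u: "u \<in> L2_fun circle_measure" "(\<lambda>n. ?N (\<lambda>z. x n z - u z)) \<longlonglongrightarrow> 0"
  proof (rule L2_complete[OF KL[OF xK]])
    fix e :: real assume "e > 0"
    from order_tendstoD(2)[OF q_lim this] obtain N where N: "2 * (q ^ N * D / (1 - q)) < e"
      by (auto simp: eventually_sequentially)
    have "?N (\<lambda>z. x m z - x n z) \<le> e" if "m \<ge> N" "n \<ge> N" for m n
    proof -
      have "?N (\<lambda>z. x m z - x N z) \<le> q ^ N * D / (1 - q)" "?N (\<lambda>z. x n z - x N z) \<le> q ^ N * D / (1 - q)"
        using far[of N "m - N"] far[of N "n - N"] that by simp_all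
      then have "?N (\<lambda>z. x m z - x n z) \<le> q ^ N * D / (1 - q) + q ^ N * D / (1 - q)"
        unfolding L2_norm_minus_commute[of circle_measure "x n" "x N"]
        by (rule order_trans[OF L2_norm_triangle_diff[OF KL[OF xK[of m]] KL[OF xK[of N]] KL[OF xK[of n]]] add_mono])
      then show ?thesis using N unfolding mult_2 by (rule order_trans[OF _ less_imp_le])
    qed
    then show "\<exists>N. \<forall>m\<ge>N. \<forall>n\<ge>N. ?N (\<lambda>z. x m z - x n z) \<le> e" by blast
  qed
  have uK: "u \<in> ?K" by (rule model_space_closed[OF inn xK u])
  have "?N (\<lambda>z. A u z - y z) \<le> 0"
  proof (rule LIMSEQ_le_const)
    have "(\<lambda>n. q ^ n * D) \<longlonglongrightarrow> 0"
      using tendsto_mult_left_zero[OF LIMSEQ_power_zero[of q]] q by simp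
    then have "(\<lambda>n. M * ?N (\<lambda>z. x n z - u z) + q ^ n * D / t) \<longlonglongrightarrow> M * 0 + 0 / t"
      using t by (intro tendsto_add tendsto_mult_left tendsto_divide u tendsto_const) auto
    then show "(\<lambda>n. M * ?N (\<lambda>z. x n z - u z) + q ^ n * D / t) \<longlonglongrightarrow> 0" by simp
    have "?N (\<lambda>z. A u z - y z) \<le> M * ?N (\<lambda>z. x n z - u z) + q ^ n * D / t" for n
    proof -
      have dK: "(\<lambda>z. u z - x n z) \<in> ?K" by (intro model_space_diff[OF inn] uK xK)
      have "?N (\<lambda>z. A u z - A (x n) z) = ?N (A (\<lambda>z. u z - x n z))"
        by (rule sym, rule L2_norm_cong[OF model_operator_diff[OF inn A uK xK]])
          (intro L2_funD(1) L2_fun_diff KL AK dK uK xK)+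
      also have "\<dots> \<le> M * ?N (\<lambda>z. u z - x n z)" by (rule M(2)[OF dK])
      finally have 1: "?N (\<lambda>z. A u z - A (x n) z) \<le> M * ?N (\<lambda>z. x n z - u z)"
        by (simp add: L2_norm_minus_commute)
      \<comment> \<open>The residual A (x n) - y is, up to the factor -1/t, the n-th increment of
        the iteration, which decays geometrically.\<close>
      have "t * ?N (\<lambda>z. A (x n) z - y z) = ?N (\<lambda>z. x (Suc n) z - x n z)"
      proof -
        have "(\<lambda>z. x (Suc n) z - x n z) = (\<lambda>z. (- of_real t) * (A (x n) z - y z))"
          by (simp add: x_Suc)
        then show ?thesis using t by (simp only: L2_norm_scale) simp
      qed
      then have 2: "?N (\<lambda>z. A (x n) z - y z) \<le> q ^ n * D / t"
        using geo[of n] t by (simp add: field_simps)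
      show ?thesis
        using L2_norm_triangle_diff[OF KL[OF AK[OF uK]] KL[OF AK[OF xK[of n]]] KL[OF y]] 1 2 by linarith
    qed
    then show "\<exists>N. \<forall>n\<ge>N. ?N (\<lambda>z. A u z - y z) \<le> M * ?N (\<lambda>z. x n z - u z) + q ^ n * D / t" by blast
  qed
  then have "?N (\<lambda>z. A u z - y z) = 0" by (simp add: order_antisym)
  then have "eq_ae circle_measure (A u) y"
    by (rule L2_norm_diff_eq_0[OF KL[OF AK[OF uK]] KL[OF y]])
  with uK show ?thesis by blast
qed

lemma coercive_bounded_below:
  assumes A: "model_operator \<Theta> A" and c: "c > 0" and f: "f \<in> model_space \<Theta>"
    and coercive: "c * (L2_norm circle_measure f)\<^sup>2 \<le> Re (L2_inner circle_measure (A f) f)"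
  shows "c * L2_norm circle_measure f \<le> L2_norm circle_measure (A f)"
proof (cases "L2_norm circle_measure f = 0")
  case False
  then have pos: "L2_norm circle_measure f > 0" by (simp add: less_le)
  have "c * L2_norm circle_measure f * L2_norm circle_measure f \<le> Re (L2_inner circle_measure (A f) f)"
    using coercive by (simp add: power2_eq_square mult.assoc)
  also have "\<dots> \<le> L2_norm circle_measure (A f) * L2_norm circle_measure f"
    using L2_Cauchy_Schwarz[OF model_space_L2_fun[OF model_operatorD(1)[OF A f]] model_space_L2_fun[OF f]]
      complex_Re_le_cmod order_trans by blast
  finally show ?thesis using pos by (rule mult_right_le_imp_le)
qed simp

text \<open>A preimage is unique only almost everywhere, so B is a choice of preimages. Its
  linearity is checked after applying A, where both sides agree, and pulled back by injectivity; its
  bound 1 / c is the lower bound for A.\<close>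

lemma coercive_invertible:
  assumes inn: "inner_function \<Theta>" and A: "model_operator \<Theta> A" and c: "c > 0"
    and coercive: "\<And>f. f \<in> model_space \<Theta> \<Longrightarrow>
      c * (L2_norm circle_measure f)\<^sup>2 \<le> Re (L2_inner circle_measure (A f) f)"
  shows "model_invertible \<Theta> A"
proof -
  let ?N = "L2_norm circle_measure" and ?K = "model_space \<Theta>"
  note KL = model_space_L2_fun[of _ \<Theta>]
  note AK = model_operatorD(1)[OF A]
  have below: "c * ?N f \<le> ?N (A f)" if "f \<in> ?K" for f
    by (rule coercive_bounded_below[OF A c that coercive[OF that]])
  have inj: "eq_ae circle_measure f g" if f: "f \<in> ?K" "g \<in> ?K" and eq: "eq_ae circle_measure (A f) (A g)" for f g
  proof (rule L2_norm_diff_eq_0[OF KL[OF f(1)] KL[OF f(2)]])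
    have d: "(\<lambda>z. f z - g z) \<in> ?K" by (rule model_space_diff[OF inn f])
    have "AE z in circle_measure. A (\<lambda>z. f z - g z) z = 0"
      using model_operator_diff[OF inn A f] eq unfolding eq_ae_def by eventually_elim simp
    then have "?N (A (\<lambda>z. f z - g z)) = 0" using L2_norm_eq_0_iff[OF KL[OF AK[OF d]]] by simp
    then have "c * ?N (\<lambda>z. f z - g z) \<le> 0" using below[OF d] by simp
    then show "?N (\<lambda>z. f z - g z) = 0"
      using c L2_norm_nonneg[of circle_measure "\<lambda>z. f z - g z"] by (simp add: mult_le_0_iff)
  qed
  define B where "B y = (SOME x. x \<in> ?K \<and> eq_ae circle_measure (A x) y)" for y
  have B: "B y \<in> ?K" "eq_ae circle_measure (A (B y)) y" if "y \<in> ?K" for y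
    using someI_ex[of "\<lambda>x. x \<in> ?K \<and> eq_ae circle_measure (A x) y"]
      coercive_surjective[OF inn A c coercive that] unfolding B_def by blast+
  show ?thesis
    unfolding model_invertible_def
  proof (intro exI[of _ B] conjI ballI)
    fix f assume f: "f \<in> ?K"
    show "eq_ae circle_measure (A (B f)) f" by (rule B(2)[OF f])
    show "eq_ae circle_measure (B (A f)) f"
      by (rule inj[OF B(1)[OF AK[OF f]] f B(2)[OF AK[OF f]]])
  next
    show "model_operator \<Theta> B"
      unfolding model_operator_def L2_bounded_linear_def
    proof (intro conjI ballI allI exI[of _ "1 / c"])
      fix f assume f: "f \<in> ?K"
      show "B f \<in> ?K" by (rule B(1)[OF f])
      have "?N (A (B f)) = ?N f"
        by (rule L2_norm_cong[OF B(2)[OF f]]) (intro L2_funD(1) KL AK B f)+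
      then show "?N (B f) \<le> 1 / c * ?N f"
        using below[OF B(1)[OF f]] c by (simp add: field_simps)
    next
      fix f g assume f: "f \<in> ?K" and g: "g \<in> ?K"
      note s = model_space_add[OF inn f g]
      show "eq_ae circle_measure (B (\<lambda>z. f z + g z)) (\<lambda>z. B f z + B g z)"
      proof (rule inj[OF B(1)[OF s] model_space_add[OF inn B(1)[OF f] B(1)[OF g]]])
        show "eq_ae circle_measure (A (B (\<lambda>z. f z + g z))) (A (\<lambda>z. B f z + B g z))"
          using B(2)[OF s] B(2)[OF f] B(2)[OF g] model_operatorD(2)[OF A B(1)[OF f] B(1)[OF g]]
          unfolding eq_ae_def by eventually_elim simp
      qed
    next
      fix c f assume f: "f \<in> ?K"
      note s = model_space_scale[OF f, of c]
      show "eq_ae circle_measure (B (\<lambda>z. c * f z)) (\<lambda>z. c * B f z)"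
      proof (rule inj[OF B(1)[OF s] model_space_scale[OF B(1)[OF f]]])
        show "eq_ae circle_measure (A (B (\<lambda>z. c * f z))) (A (\<lambda>z. c * B f z))"
          using B(2)[OF s] B(2)[OF f] model_operatorD(3)[OF A B(1)[OF f], of c]
          unfolding eq_ae_def by eventually_elim simp
      qed
    qed
  qed
qed

section \<open>Operators defined by measures\<close>

lemma model_operator_form_add:
  assumes inn: "inner_function \<Theta>" and A: "model_operator \<Theta> A"
    and f: "f \<in> model_space \<Theta>" and g: "g \<in> model_space \<Theta>"
  shows "L2_inner circle_measure (A (\<lambda>z. f z + c * g z)) (\<lambda>z. f z + c * g z)
    = L2_inner circle_measure (A f) f + cnj c * L2_inner circle_measure (A f) g
      + c * L2_inner circle_measure (A g) f + of_real ((cmod c)\<^sup>2) * L2_inner circle_measure (A g) g"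
proof -
  note KL = model_space_L2_fun[of _ \<Theta>]
  note AK = model_operatorD(1)[OF A]
  note cg = model_space_scale[OF g, of c]
  note s = model_space_add[OF inn f cg]
  have L: "f \<in> L2_fun circle_measure" "g \<in> L2_fun circle_measure" "A f \<in> L2_fun circle_measure"
    "A g \<in> L2_fun circle_measure" "(\<lambda>z. c * g z) \<in> L2_fun circle_measure"
    "(\<lambda>z. c * A g z) \<in> L2_fun circle_measure" "(\<lambda>z. f z + c * g z) \<in> L2_fun circle_measure"
    by (intro KL AK f g cg s L2_fun_scale)+
  have "eq_ae circle_measure (A (\<lambda>z. f z + c * g z)) (\<lambda>z. A f z + c * A g z)"
    using model_operatorD(2)[OF A f cg] model_operatorD(3)[OF A g, of c]
    unfolding eq_ae_def by eventually_elim simp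
  then have "L2_inner circle_measure (A (\<lambda>z. f z + c * g z)) (\<lambda>z. f z + c * g z)
      = L2_inner circle_measure (\<lambda>z. A f z + c * A g z) (\<lambda>z. f z + c * g z)"
    by (rule L2_inner_cong_left[OF _ KL[OF AK[OF s]] L2_fun_add[OF L(3,6)] L(7)])
  also have "\<dots> = L2_inner circle_measure (A f) f + cnj c * L2_inner circle_measure (A f) g
      + c * (L2_inner circle_measure (A g) f + cnj c * L2_inner circle_measure (A g) g)"
    unfolding L2_inner_add_left[OF L(3,6,7)] L2_inner_scale_left
      L2_inner_add_right[OF L(1,5,3)] L2_inner_add_right[OF L(1,5,4)] L2_inner_scale_right by simp
  also have "\<dots> = L2_inner circle_measure (A f) f + cnj c * L2_inner circle_measure (A f) g
      + c * L2_inner circle_measure (A g) f + of_real ((cmod c)\<^sup>2) * L2_inner circle_measure (A g) g"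
    unfolding complex_norm_square by (simp add: algebra_simps)
  finally show ?thesis .
qed

text \<open>The Cauchy-Schwarz argument for the form <A f, g>, with the optimization done in
  advance: nonnegativity is evaluated at the single vector f - (1/M) A f.\<close>

lemma nonneg_operator_norm_sq_le:
  assumes inn: "inner_function \<Theta>" and A: "model_operator \<Theta> A"
    and nn: "\<And>f. f \<in> model_space \<Theta> \<Longrightarrow> L2_inner circle_measure (A f) f \<in> \<real>\<^sub>\<ge>\<^sub>0"
    and M: "M > 0" "\<And>f. f \<in> model_space \<Theta> \<Longrightarrow> L2_norm circle_measure (A f) \<le> M * L2_norm circle_measure f"
    and f: "f \<in> model_space \<Theta>"
  shows "(L2_norm circle_measure (A f))\<^sup>2 \<le> M * Re (L2_inner circle_measure (A f) f)"
proof -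
  let ?S = "\<lambda>f g. L2_inner circle_measure (A f) g"
  define N where "N = (L2_norm circle_measure (A f))\<^sup>2"
  note KL = model_space_L2_fun[of _ \<Theta>]
  note AK = model_operatorD(1)[OF A]
  have g: "A f \<in> model_space \<Theta>" by (rule AK[OF f])
  have S: "?S f (A f) = of_real N" by (simp add: L2_inner_self N_def)
  have real: "Im (?S h h) = 0" "Re (?S h h) \<ge> 0" if "h \<in> model_space \<Theta>" for h
    using nn[OF that] by (auto simp: complex_nonneg_Reals_iff)
  \<comment> \<open>Symmetry is extracted from reality of the form: the imaginary part at f + i A f
    is Re <A (A f), f> - Re <A f, A f>, and it vanishes.\<close>
  have "Re (?S f (A f)) = Re (?S (A f) f)"
    using real(1)[OF model_space_add[OF inn f model_space_scale[OF g, of \<i>]]] real(1)[OF f] real(1)[OF g]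
    unfolding model_operator_form_add[OF inn A f g] by simp
  then have S': "Re (?S (A f) f) = N" using S by simp
  have "Re (?S (A f) (A f)) \<le> L2_norm circle_measure (A (A f)) * L2_norm circle_measure (A f)"
    using L2_Cauchy_Schwarz[OF KL[OF AK[OF g]] KL[OF g]] complex_Re_le_cmod order_trans by blast
  also have "\<dots> \<le> (M * L2_norm circle_measure (A f)) * L2_norm circle_measure (A f)"
    by (rule mult_right_mono[OF M(2)[OF g]]) simp
  also have "\<dots> = M * N" by (simp add: N_def power2_eq_square)
  finally have G: "Re (?S (A f) (A f)) \<le> M * N" .
  \<comment> \<open>The two cross terms are both equal to N and give -2 N / M; the quadratic term
    returns at most N / M.\<close>
  have "0 \<le> Re (?S f f) - 2 * N / M + (1 / M\<^sup>2) * Re (?S (A f) (A f))"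
    using real(2)[OF model_space_add[OF inn f model_space_scale[OF g, of "- of_real (1 / M)"]]]
    unfolding model_operator_form_add[OF inn A f g] using S S' M(1)
    by (simp add: norm_divide power_divide)
  also have "\<dots> \<le> Re (?S f f) - 2 * N / M + (1 / M\<^sup>2) * (M * N)"
    using G by (intro add_left_mono mult_left_mono) auto
  also have "\<dots> = Re (?S f f) - N / M" using M(1) by (simp add: power2_eq_square field_simps)
  finally show ?thesis using M(1) by (simp add: N_def field_simps)
qed

text \<open>The final constant is (K / c)^2, with K a bound for \<open>iota\<close> and c the lower
  bound of A.\<close>

lemma iota_bounded_below:
  assumes inn: "inner_function \<Theta>" and \<mu>: "\<mu> \<in> C2 \<Theta>" and op: "is_measure_operator \<Theta> \<mu> A"
    and below: "model_bounded_below \<Theta> A"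
  shows "\<exists>C>0. \<forall>f\<in>model_space \<Theta>.
    (L2_norm circle_measure f)\<^sup>2 \<le> C * (L2_norm (variation \<mu>) (iota \<Theta> \<mu> f))\<^sup>2"
proof -
  let ?N = "L2_norm circle_measure" and ?V = "L2_norm (variation \<mu>)" and ?J = "iota \<Theta> \<mu>"
  have A: "model_operator \<Theta> A" using op by (simp add: is_measure_operator_def)
  have cm: "complex_measure \<mu>" using \<mu> by (simp add: C2_def)
  have J: "L2_bounded_linear circle_measure (model_space \<Theta>) (variation \<mu>) (L2_fun (variation \<mu>)) ?J"
    by (rule iota_properties[OF inn \<mu>])
  have JL: "?J f \<in> L2_fun (variation \<mu>)" if "f \<in> model_space \<Theta>" for f
    using J that unfolding L2_bounded_linear_def by blast
  obtain K0 where K0: "\<And>f. f \<in> model_space \<Theta> \<Longrightarrow> ?V (?J f) \<le> K0 * ?N f"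
    using J unfolding L2_bounded_linear_def by blast
  define K where "K = \<bar>K0\<bar> + 1"
  have K: "K > 0" by (simp add: K_def)
  have KJ: "?V (?J f) \<le> K * ?N f" if "f \<in> model_space \<Theta>" for f
  proof -
    have "K0 * ?N f \<le> K * ?N f" by (rule mult_right_mono) (auto simp: K_def)
    with K0[OF that] show ?thesis by linarith
  qed
  obtain c where c: "c > 0" "\<And>f. f \<in> model_space \<Theta> \<Longrightarrow> c * ?N f \<le> ?N (A f)"
    using below unfolding model_bounded_below_def by blast
  have main: "?N f \<le> K / c * ?V (?J f)" if f: "f \<in> model_space \<Theta>" for f
  proof -
    have g: "A f \<in> model_space \<Theta>" by (rule model_operatorD(1)[OF A f])
    have "(?N (A f))\<^sup>2 = cmod (L2_inner circle_measure (A f) (A f))" by (simp add: L2_inner_self norm_power)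
    also have "\<dots> = cmod (complex_integral \<mu> (\<lambda>z. ?J f z * cnj (?J (A f) z)))"
      using op f g by (simp add: is_measure_operator_def)
    also have "\<dots> \<le> (\<integral>z. cmod (?J f z * cnj (?J (A f) z)) \<partial>variation \<mu>)"
      by (rule norm_complex_integral_le[OF cm])
    also have "\<dots> \<le> ?V (?J f) * ?V (?J (A f))"
      using L2_Cauchy_Schwarz_abs[OF JL[OF f] JL[OF g]] by (simp add: norm_mult)
    also have "\<dots> \<le> ?V (?J f) * (K * ?N (A f))"
      by (rule mult_left_mono[OF KJ[OF g]]) simp
    finally have *: "?N (A f) * ?N (A f) \<le> (K * ?V (?J f)) * ?N (A f)"
      by (simp add: power2_eq_square mult_ac)
    have "?N (A f) \<le> K * ?V (?J f)"
    \<comment> \<open>A common factor norm (A f) is cancelled, which requires it to be nonzero; if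
      it is 0 the claim is trivial.\<close>
    proof (cases "?N (A f) = 0")
      case True
      then show ?thesis using K by simp
    next
      case False
      then have "?N (A f) > 0" by (simp add: less_le)
      with * show ?thesis by (rule mult_right_le_imp_le)
    qed
    with c(2)[OF f] have "c * ?N f \<le> K * ?V (?J f)" by linarith
    then show ?thesis using c(1) by (simp add: field_simps)
  qed
  have "(?N f)\<^sup>2 \<le> (K / c)\<^sup>2 * (?V (?J f))\<^sup>2" if "f \<in> model_space \<Theta>" for f
    using power_mono[OF main[OF that], of 2] by (simp add: power_mult_distrib power_divide)
  moreover have "(K / c)\<^sup>2 > 0" using K c(1) by simp
  ultimately show ?thesis by blast
qed

text \<open>With M' bounding the inverse, norm f <= M' * norm (A f), and the squared norm of A f is
  at most M <A f, f>; hence C = M'^2 * M. In the other direction C becomes the coercivity constant 1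
  / C.\<close>

lemma nonneg_invertible_iff_coercive:
  assumes inn: "inner_function \<Theta>" and A: "model_operator \<Theta> A"
    and nn: "\<And>f. f \<in> model_space \<Theta> \<Longrightarrow> L2_inner circle_measure (A f) f \<in> \<real>\<^sub>\<ge>\<^sub>0"
  shows "model_invertible \<Theta> A \<longleftrightarrow> (\<exists>C>0. \<forall>f\<in>model_space \<Theta>.
    (L2_norm circle_measure f)\<^sup>2 \<le> C * Re (L2_inner circle_measure (A f) f))"
proof
  let ?N = "L2_norm circle_measure"
  note AK = model_operatorD(1)[OF A]
  assume "model_invertible \<Theta> A"
  then obtain B where B: "model_operator \<Theta> B"
    and BA: "\<And>f. f \<in> model_space \<Theta> \<Longrightarrow> eq_ae circle_measure (B (A f)) f"
    unfolding model_invertible_def by blast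
  obtain M where M: "M > 0" "\<And>f. f \<in> model_space \<Theta> \<Longrightarrow> ?N (A f) \<le> M * ?N f"
    using model_operatorD(4)[OF A] by blast
  obtain M' where M': "M' > 0" "\<And>f. f \<in> model_space \<Theta> \<Longrightarrow> ?N (B f) \<le> M' * ?N f"
    using model_operatorD(4)[OF B] by blast
  have "(?N f)\<^sup>2 \<le> M'\<^sup>2 * M * Re (L2_inner circle_measure (A f) f)" if f: "f \<in> model_space \<Theta>" for f
  proof -
    have "?N f = ?N (B (A f))"
      by (rule sym, rule L2_norm_cong[OF BA[OF f]])
        (intro L2_funD(1) model_space_L2_fun[of _ \<Theta>] model_operatorD(1)[OF B] AK f)+
    also have "\<dots> \<le> M' * ?N (A f)" by (rule M'(2)[OF AK[OF f]])
    finally have "(?N f)\<^sup>2 \<le> (M' * ?N (A f))\<^sup>2" by (rule power_mono) simp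
    also have "\<dots> \<le> M'\<^sup>2 * (M * Re (L2_inner circle_measure (A f) f))"
      unfolding power_mult_distrib
      by (rule mult_left_mono[OF nonneg_operator_norm_sq_le[OF inn A nn M f]]) auto
    finally show ?thesis by (simp add: mult.assoc)
  qed
  moreover have "M'\<^sup>2 * M > 0" using M(1) M'(1) by simp
  ultimately show "\<exists>C>0. \<forall>f\<in>model_space \<Theta>. (?N f)\<^sup>2 \<le> C * Re (L2_inner circle_measure (A f) f)" by blast
next
  assume "\<exists>C>0. \<forall>f\<in>model_space \<Theta>. (L2_norm circle_measure f)\<^sup>2 \<le> C * Re (L2_inner circle_measure (A f) f)"
  then obtain C where C: "C > 0"
    "\<And>f. f \<in> model_space \<Theta> \<Longrightarrow> (L2_norm circle_measure f)\<^sup>2 \<le> C * Re (L2_inner circle_measure (A f) f)"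
    by blast
  show "model_invertible \<Theta> A"
  proof (rule coercive_invertible[OF inn A])
    show "1 / C > 0" using C(1) by simp
    show "1 / C * (L2_norm circle_measure f)\<^sup>2 \<le> Re (L2_inner circle_measure (A f) f)"
      if "f \<in> model_space \<Theta>" for f
      using C(2)[OF that] C(1) by (simp add: field_simps)
  qed
qed

theorem theorem8p3:
  fixes \<Theta> :: "complex \<Rightarrow> complex"
  assumes "inner_function \<Theta>"
  shows
    "(\<forall>A \<mu>. A \<in> TTO \<Theta> \<longrightarrow> \<mu> \<in> C2 \<Theta> \<longrightarrow> is_measure_operator \<Theta> \<mu> A \<longrightarrow>
        model_bounded_below \<Theta> A \<longrightarrow>
        (\<exists>C>0. \<forall>f\<in>model_space \<Theta>.
           (\<integral>z. (cmod (f z))\<^sup>2 \<partial>circle_measure)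
             \<le> C * (\<integral>z. (cmod (iota \<Theta> \<mu> f z))\<^sup>2 \<partial>variation \<mu>)))
     \<and> (\<forall>A \<mu>. A \<in> TTO_nonneg \<Theta> \<longrightarrow> \<mu> \<in> C2_pos \<Theta> \<longrightarrow> is_measure_operator \<Theta> \<mu> A \<longrightarrow>
        (model_invertible \<Theta> A \<longleftrightarrow>
          (\<exists>C>0. \<forall>f\<in>model_space \<Theta>.
             (\<integral>z. (cmod (f z))\<^sup>2 \<partial>circle_measure)
               \<le> C * Re (complex_integral \<mu> (\<lambda>z. of_real ((cmod (iota \<Theta> \<mu> f z))\<^sup>2))))))"
proof (intro conjI allI impI)
  fix A \<mu>
  assume "\<mu> \<in> C2 \<Theta>" "is_measure_operator \<Theta> \<mu> A" "model_bounded_below \<Theta> A"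
  from iota_bounded_below[OF assms this]
  show "\<exists>C>0. \<forall>f\<in>model_space \<Theta>. (\<integral>z. (cmod (f z))\<^sup>2 \<partial>circle_measure)
      \<le> C * (\<integral>z. (cmod (iota \<Theta> \<mu> f z))\<^sup>2 \<partial>variation \<mu>)"
    unfolding L2_norm_sq .
next
  fix A \<mu>
  assume nn: "A \<in> TTO_nonneg \<Theta>" and op: "is_measure_operator \<Theta> \<mu> A"
  \<comment> \<open>Taking g = f in the defining identity of the measure operator turns the
    integrand into the squared modulus.\<close>
  have "L2_inner circle_measure (A f) f = complex_integral \<mu> (\<lambda>z. of_real ((cmod (iota \<Theta> \<mu> f z))\<^sup>2))"
    if "f \<in> model_space \<Theta>" for f
    using op that unfolding is_measure_operator_def complex_norm_square by blast
  moreover have "model_operator \<Theta> A" using op by (simp add: is_measure_operator_def)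
  moreover have "L2_inner circle_measure (A f) f \<in> \<real>\<^sub>\<ge>\<^sub>0" if "f \<in> model_space \<Theta>" for f
    using nn that by (simp add: TTO_nonneg_def)
  ultimately show "model_invertible \<Theta> A \<longleftrightarrow> (\<exists>C>0. \<forall>f\<in>model_space \<Theta>.
      (\<integral>z. (cmod (f z))\<^sup>2 \<partial>circle_measure)
        \<le> C * Re (complex_integral \<mu> (\<lambda>z. of_real ((cmod (iota \<Theta> \<mu> f z))\<^sup>2))))"
    using nonneg_invertible_iff_coercive[OF assms, of A] unfolding L2_norm_sq by simp
qed

end
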